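(* Let $\mathbb{G}$ be a stratified Lie group of homogeneous dimension $Q$. Let $0<s<1<p<\infty$ with $Q>ps$, and let $p<q<p_s^*:=\frac{Qp}{Q-ps}$. Then the problem $(-\Delta_{p,\mathbb{G}})^s u+|u|^{p-2}u=|u|^{q-2}u$, $u\in W_0^{s,p}(\mathbb{G})$, has a least energy solution $\phi\in W_0^{s,p}(\mathbb{G})$. Moreover, its energy is $d=I(\phi)=\inf_{u\in\mathcal{N}}I(u)$.
   Context: Stratified Lie group: a Lie group $\mathbb{G}=(\mathbb{R}^N,\circ)$ with a decomposition $\mathbb{R}^N=\mathbb{R}^{N_1}\times\cdots\times\mathbb{R}^{N_k}$ such that (i) for each $\lambda>0$ the dilation $D_\lambda(x)=(\lambda x^{(1)},\lambda^2x^{(2)},\dots,\lambda^kx^{(k)})$, $x^{(i)}\in\mathbb{R}^{N_i}$, is an automorphism of $\mathbb{G}$; (ii) if $X_1,\dots,X_{N_1}$ are the left-invariant vector fields with $X_j(0)=\partial/\partial x_j|_0$, then the Lie algebra they generate has rank $N$ at every point. Its homogeneous dimension is $Q=\sum_{i=1}^k iN_i$. Haar measure $dx$ is Lebesgue measure on $\mathbb{R}^N$. $|\cdot|:\mathbb{G}\to[0,\infty)$ is a fixed homogeneous quasi-norm: continuous, $|x|=0$ iff $x=0$, $|x^{-1}|=|x|$, $|D_\lambda x|=\lambda|x|$ for $\lambda>0$. Write $y^{-1}x=y^{-1}\circ x$. $W^{s,p}(\mathbb{G})=\{u\in L^p(\mathbb{G}):[u]_{s,p}<\infty\}$, with $[u]_{s,p}^p=\iint_{\mathbb{G}\times\mathbb{G}}\frac{|u(x)-u(y)|^p}{|y^{-1}x|^{Q+ps}}dxdy$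 and norm $\|u\|_{W^{s,p}}^p=\|u\|_{L^p}^p+[u]_{s,p}^p$; $W_0^{s,p}(\mathbb{G})$ is the closure of $C_c^\infty(\mathbb{G})$ in this norm (it equals $W^{s,p}(\mathbb{G})$). The equation is understood weakly: $u\in W_0^{s,p}(\mathbb{G})$ is a weak solution if for all $\psi\in W_0^{s,p}(\mathbb{G})$ $$\iint_{\mathbb{G}\times\mathbb{G}}\frac{|u(x)-u(y)|^{p-2}(u(x)-u(y))(\psi(x)-\psi(y))}{|y^{-1}x|^{Q+ps}}dxdy+\int_{\mathbb{G}}(|u|^{p-2}u\psi-|u|^{q-2}u\psi)dx=0.$$ Energy: $I(u)=\frac1p[u]_{s,p}^p+\frac1p\int_{\mathbb{G}}|u|^pdx-\frac1q\int_{\mathbb{G}}|u|^qdx$ on $W_0^{s,p}(\mathbb{G})$; the left-hand side of the weak formulation is $\langle I'(u),\psi\rangle$. Set $\mathcal{L}(u)=\langle I'(u),u\rangle=[u]_{s,p}^p+\int_{\mathbb{G}}(|u|^p-|u|^q)dx$ and $\mathcal{N}=\{u\in W_0^{s,p}(\mathbb{G})\setminus\{0\}:\mathcal{L}(u)=0\}$. Let $\Gamma$ be the set of nonzero weak solutions. A least energy solution is a $u\in\Gamma$ with $I(u)\le I(v)$ for all $v\in\Gamma$. *)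

theory Defs
  imports "HOL-Analysis.Analysis" "HOL-Algebra.Group"
begin

section \<open>Smooth maps\<close>

text \<open>In finite dimension, a map is \<open>C\<close>-\<open>(n+1)\<close> iff it is differentiable and all its directional
  derivatives are \<open>C\<close>-\<open>n\<close>.\<close>

primrec Ck :: "nat \<Rightarrow> ('a::euclidean_space \<Rightarrow> 'b::euclidean_space) \<Rightarrow> bool" where
  "Ck 0 f \<longleftrightarrow> continuous_on UNIV f"
| "Ck (Suc n) f \<longleftrightarrow> (\<forall>x. f differentiable (at x)) \<and>
     (\<forall>v. Ck n (\<lambda>x. frechet_derivative f (at x) v))"

definition smooth :: "('a::euclidean_space \<Rightarrow> 'b::euclidean_space) \<Rightarrow> bool" where
  "smooth f \<longleftrightarrow> (\<forall>n. Ck n f)"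

section \<open>Stratified Lie groups\<close>

text \<open>The splitting of \<open>real ^ 'n\<close> into layers is given by \<open>\<sigma> :: 'n \<Rightarrow> nat\<close>: the coordinate \<open>j\<close>
  belongs to the layer of index \<open>\<sigma> j\<close>, so that the layer of index \<open>i\<close> has dimension
  \<open>card {j. \<sigma> j = i}\<close>. The layers need not consist of consecutive coordinates.\<close>

definition dilation :: "('n \<Rightarrow> nat) \<Rightarrow> real \<Rightarrow> real ^ 'n \<Rightarrow> real ^ 'n" where
  "dilation \<sigma> r x = (\<chi> j. r ^ \<sigma> j * x $ j)"

definition homogeneous_dimension :: "nat \<Rightarrow> ('n \<Rightarrow> nat) \<Rightarrow> nat" where
  "homogeneous_dimension k \<sigma> = (\<Sum>i=1..k. i * card {j. \<sigma> j = i})"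

text \<open>A vector field is identified with its coefficient map.\<close>

definition left_invariant :: "(real ^ 'n) monoid \<Rightarrow> (real ^ 'n \<Rightarrow> real ^ 'n) \<Rightarrow> bool" where
  "left_invariant G X \<longleftrightarrow>
     (\<forall>x y. X (x \<otimes>\<^bsub>G\<^esub> y) = frechet_derivative (\<lambda>z. x \<otimes>\<^bsub>G\<^esub> z) (at y) (X y))"

definition lie_bracket ::
  "(real ^ 'n \<Rightarrow> real ^ 'n) \<Rightarrow> (real ^ 'n \<Rightarrow> real ^ 'n) \<Rightarrow> real ^ 'n \<Rightarrow> real ^ 'n" where
  "lie_bracket X Y = (\<lambda>x. frechet_derivative Y (at x) (X x) - frechet_derivative X (at x) (Y x))"

inductive_set generated_lie_algebra ::
  "(real ^ 'n \<Rightarrow> real ^ 'n) set \<Rightarrow> (real ^ 'n \<Rightarrow> real ^ 'n) set"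
  for S :: "(real ^ 'n \<Rightarrow> real ^ 'n) set" where
  base: "X \<in> S \<Longrightarrow> X \<in> generated_lie_algebra S"
| zero: "(\<lambda>x. 0) \<in> generated_lie_algebra S"
| add: "X \<in> generated_lie_algebra S \<Longrightarrow> Y \<in> generated_lie_algebra S \<Longrightarrow>
    (\<lambda>x. X x + Y x) \<in> generated_lie_algebra S"
| scale: "X \<in> generated_lie_algebra S \<Longrightarrow> (\<lambda>x. c *\<^sub>R X x) \<in> generated_lie_algebra S"
| bracket: "X \<in> generated_lie_algebra S \<Longrightarrow> Y \<in> generated_lie_algebra S \<Longrightarrow>
    lie_bracket X Y \<in> generated_lie_algebra S"

definition first_layer_fields ::
  "(real ^ 'n) monoid \<Rightarrow> ('n \<Rightarrow> nat) \<Rightarrow> (real ^ 'n \<Rightarrow> real ^ 'n) set" where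
  "first_layer_fields G \<sigma> = {X. left_invariant G X \<and> (\<exists>j. \<sigma> j = 1 \<and> X 0 = axis j 1)}"

text \<open>That the neutral element is the origin follows from \<open>dilation_iso\<close>.\<close>

locale stratified_group = group G for G :: "(real ^ 'n) monoid" (structure) +
  fixes k :: nat and \<sigma> :: "'n \<Rightarrow> nat"
  assumes carrier_UNIV: "carrier G = UNIV"
    and smooth_mult: "smooth (\<lambda>(x, y). x \<otimes> y)"
    and smooth_inv: "smooth (\<lambda>x. inv x)"
    and layer: "\<sigma> j \<in> {1..k}"
    and dilation_iso: "r > 0 \<Longrightarrow> dilation \<sigma> r \<in> iso G G"
    and full_rank: "dim {X x | X. X \<in> generated_lie_algebra (first_layer_fields G \<sigma>)} = CARD('n)"

definition homogeneous_quasi_norm ::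
  "(real ^ 'n) monoid \<Rightarrow> ('n \<Rightarrow> nat) \<Rightarrow> (real ^ 'n \<Rightarrow> real) \<Rightarrow> bool" where
  "homogeneous_quasi_norm G \<sigma> h \<longleftrightarrow>
     continuous_on UNIV h \<and> (\<forall>x. h x \<ge> 0) \<and> (\<forall>x. h x = 0 \<longleftrightarrow> x = 0) \<and>
     (\<forall>x. h (inv\<^bsub>G\<^esub> x) = h x) \<and> (\<forall>r>0. \<forall>x. h (dilation \<sigma> r x) = r * h x)"

section \<open>Fractional Sobolev spaces\<close>

text \<open>Elements of the spaces are Borel representatives; functions that agree almost everywhere
  are not identified. Below, \<open>G\<close> is the group, \<open>h\<close> the quasi-norm and \<open>Q\<close> the homogeneous
  dimension. The kernel has the value \<open>1 / 0 = 0\<close> on the diagonal, which is a null set.\<close>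

definition gagliardo_kernel :: "(real ^ 'n) monoid \<Rightarrow> (real ^ 'n \<Rightarrow> real) \<Rightarrow> nat \<Rightarrow> real \<Rightarrow> real \<Rightarrow>
    real ^ 'n \<Rightarrow> real ^ 'n \<Rightarrow> real" where
  "gagliardo_kernel G h Q s p x y = 1 / h (inv\<^bsub>G\<^esub> y \<otimes>\<^bsub>G\<^esub> x) powr (real Q + p * s)"

text \<open>The \<open>p\<close>-th power of the Gagliardo seminorm.\<close>

definition gagliardo_p :: "(real ^ 'n) monoid \<Rightarrow> (real ^ 'n \<Rightarrow> real) \<Rightarrow> nat \<Rightarrow> real \<Rightarrow> real \<Rightarrow>
    (real ^ 'n \<Rightarrow> real) \<Rightarrow> real" where
  "gagliardo_p G h Q s p u =
     (LINT (x, y) | (lborel \<Otimes>\<^sub>M lborel). \<bar>u x - u y\<bar> powr p * gagliardo_kernel G h Q s p x y)"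

definition sobolev :: "(real ^ 'n) monoid \<Rightarrow> (real ^ 'n \<Rightarrow> real) \<Rightarrow> nat \<Rightarrow> real \<Rightarrow> real \<Rightarrow>
    (real ^ 'n \<Rightarrow> real) set" where
  "sobolev G h Q s p = {u \<in> borel_measurable lborel.
     integrable lborel (\<lambda>x. \<bar>u x\<bar> powr p) \<and>
     integrable (lborel \<Otimes>\<^sub>M lborel) (\<lambda>(x, y). \<bar>u x - u y\<bar> powr p * gagliardo_kernel G h Q s p x y)}"

definition sobolev_norm :: "(real ^ 'n) monoid \<Rightarrow> (real ^ 'n \<Rightarrow> real) \<Rightarrow> nat \<Rightarrow> real \<Rightarrow> real \<Rightarrow>
    (real ^ 'n \<Rightarrow> real) \<Rightarrow> real" where
  "sobolev_norm G h Q s p u =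
     ((LINT x | lborel. \<bar>u x\<bar> powr p) + gagliardo_p G h Q s p u) powr (1 / p)"

definition test_functions :: "(real ^ 'n \<Rightarrow> real) set" where
  "test_functions = {\<phi>. smooth \<phi> \<and> compact (closure {x. \<phi> x \<noteq> 0})}"

text \<open>Test functions always have finite norm; intersecting with \<open>sobolev G h Q s p\<close> only ensures
  that the integrals in \<open>sobolev_norm\<close> are genuine.\<close>

definition sobolev0 :: "(real ^ 'n) monoid \<Rightarrow> (real ^ 'n \<Rightarrow> real) \<Rightarrow> nat \<Rightarrow> real \<Rightarrow> real \<Rightarrow>
    (real ^ 'n \<Rightarrow> real) set" where
  "sobolev0 G h Q s p = {u \<in> sobolev G h Q s p.
     \<forall>\<epsilon>>0. \<exists>\<phi> \<in> test_functions \<inter> sobolev G h Q s p.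
       sobolev_norm G h Q s p (\<lambda>x. u x - \<phi> x) < \<epsilon>}"

section \<open>The variational problem\<close>

definition energy :: "(real ^ 'n) monoid \<Rightarrow> (real ^ 'n \<Rightarrow> real) \<Rightarrow> nat \<Rightarrow> real \<Rightarrow> real \<Rightarrow> real \<Rightarrow>
    (real ^ 'n \<Rightarrow> real) \<Rightarrow> real" where
  "energy G h Q s p q u = 1 / p * gagliardo_p G h Q s p u
     + 1 / p * (LINT x | lborel. \<bar>u x\<bar> powr p) - 1 / q * (LINT x | lborel. \<bar>u x\<bar> powr q)"

text \<open>\<open>\<langle>I'(u), \<psi>\<rangle>\<close>, that is, the left-hand side of the weak formulation. For \<open>p < 2\<close> the term
  \<open>\<bar>a\<bar> powr (p - 2) * a\<close> is \<open>0\<close> at \<open>a = 0\<close>, as usual.\<close>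

definition energy_deriv :: "(real ^ 'n) monoid \<Rightarrow> (real ^ 'n \<Rightarrow> real) \<Rightarrow> nat \<Rightarrow> real \<Rightarrow> real \<Rightarrow> real \<Rightarrow>
    (real ^ 'n \<Rightarrow> real) \<Rightarrow> (real ^ 'n \<Rightarrow> real) \<Rightarrow> real" where
  "energy_deriv G h Q s p q u \<psi> =
     (LINT (x, y) | (lborel \<Otimes>\<^sub>M lborel).
        \<bar>u x - u y\<bar> powr (p - 2) * (u x - u y) * (\<psi> x - \<psi> y) * gagliardo_kernel G h Q s p x y)
     + (LINT x | lborel. \<bar>u x\<bar> powr (p - 2) * u x * \<psi> x - \<bar>u x\<bar> powr (q - 2) * u x * \<psi> x)"

definition nontrivial :: "(real ^ 'n \<Rightarrow> real) \<Rightarrow> bool" where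
  "nontrivial u \<longleftrightarrow> \<not> (AE x in lborel. u x = 0)"

definition weak_solution :: "(real ^ 'n) monoid \<Rightarrow> (real ^ 'n \<Rightarrow> real) \<Rightarrow> nat \<Rightarrow> real \<Rightarrow> real \<Rightarrow> real \<Rightarrow>
    (real ^ 'n \<Rightarrow> real) \<Rightarrow> bool" where
  "weak_solution G h Q s p q u \<longleftrightarrow> u \<in> sobolev0 G h Q s p \<and>
     (\<forall>\<psi> \<in> sobolev0 G h Q s p. energy_deriv G h Q s p q u \<psi> = 0)"

definition least_energy_solution :: "(real ^ 'n) monoid \<Rightarrow> (real ^ 'n \<Rightarrow> real) \<Rightarrow> nat \<Rightarrow> real \<Rightarrow>
    real \<Rightarrow> real \<Rightarrow> (real ^ 'n \<Rightarrow> real) \<Rightarrow> bool" where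
  "least_energy_solution G h Q s p q u \<longleftrightarrow> weak_solution G h Q s p q u \<and> nontrivial u \<and>
     (\<forall>v. weak_solution G h Q s p q v \<and> nontrivial v \<longrightarrow>
        energy G h Q s p q u \<le> energy G h Q s p q v)"

definition nehari :: "(real ^ 'n) monoid \<Rightarrow> (real ^ 'n \<Rightarrow> real) \<Rightarrow> nat \<Rightarrow> real \<Rightarrow> real \<Rightarrow> real \<Rightarrow>
    (real ^ 'n \<Rightarrow> real) set" where
  "nehari G h Q s p q =
     {u \<in> sobolev0 G h Q s p. nontrivial u \<and> energy_deriv G h Q s p q u u = 0}"

lemma powr_diff_two_mult: "\<bar>a\<bar> powr (r - 2) * a * a = \<bar>a\<bar> powr r" for a r :: real
proof (cases "a = 0")
  case False
  then have "a * a = \<bar>a\<bar> powr 2"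
    by (simp add: powr_numeral flip: power2_eq_square)
  then have "\<bar>a\<bar> powr (r - 2) * a * a = \<bar>a\<bar> powr (r - 2) * \<bar>a\<bar> powr 2"
    by (simp only: mult.assoc)
  also have "\<dots> = \<bar>a\<bar> powr r"
    by (simp only: powr_add [symmetric] diff_add_cancel)
  finally show ?thesis .
qed simp

lemma energy_deriv_self:
  "energy_deriv G h Q s p q u u =
     gagliardo_p G h Q s p u + (LINT x | lborel. \<bar>u x\<bar> powr p - \<bar>u x\<bar> powr q)"
  by (simp add: energy_deriv_def gagliardo_p_def powr_diff_two_mult)

end

theory Submission
  imports Defs "HOL-Complex_Analysis.Great_Picard"
begin

text \<open>Write \<open>N u\<close> for the \<open>p\<close>-th power of the Sobolev norm and \<open>R u\<close> for the integral of
  \<open>\<bar>u\<bar>\<^sup>q\<close>. One minimises \<open>N\<close> over \<open>R u = 1\<close>. A minimising sequence does not vanish: averaging over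
  the balls of a fixed small radius shows that some ball carries a fixed amount of mass of
  \<open>\<bar>u\<bar>\<^sup>p\<close>, and left translation moves this ball to the origin. Along a subsequence the translated
  functions converge almost everywhere to some \<open>v \<noteq> 0\<close>, and the Brezis-Lieb lemma, applied both to
  \<open>N\<close> (an \<open>L\<^sup>p\<close> norm on a sum of two measure spaces) and to \<open>R\<close>, gives
  \<open>S \<ge> S (t powr (p/q) + (1 - t) powr (p/q))\<close> with \<open>t = R v\<close> and \<open>S\<close> the infimum. Strict concavity
  forces \<open>t = 1\<close>, so \<open>v\<close> is a minimiser. The Euler-Lagrange equation and homogeneity turn a multiple of
  \<open>v\<close> into a weak solution, which minimises the energy on the Nehari set because there the energy is
  \<open>(1/p - 1/q) N\<close>.\<close>

section \<open>Powers of absolute values\<close>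

text \<open>\<open>N\<close> and \<open>R\<close> do not see translations, so a minimising sequence
  may drift away. \<open>p < q\<close> makes \<open>p / q < 1\<close>, which forbids splitting, and
  the gap between \<open>q\<close> and the critical exponent controls large values in the
  non-vanishing step. A stratified group is given only by its law in coordinates, so left invariance
  of Lebesgue measure has to be derived from smoothness and dilations. Subcritical integrability
  comes from a pointwise bound of \<open>u\<close> by the inner Gagliardo integral
  \<open>D u\<close>: it lifts integrability from the power \<open>t\<close> to
  \<open>p + t * \<theta>\<close>, where \<open>\<theta> = p * s / Q\<close>, and the iteration
  converges to the critical exponent \<open>p / (1 - \<theta>)\<close>. The same integral bounds the
  distance from \<open>u\<close> to its averages over radius \<open>r\<close> by a multiple of
  \<open>r powr (p * s)\<close>; equicontinuity of the averages then yields convergence almost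
  everywhere. That limits stay in \<open>W0\<close> is again a consequence of Brezis-Lieb. The
  Euler-Lagrange equation uses the homogeneous inequality
  \<open>S * R v powr (p / q) \<le> N v\<close>, valid on all of \<open>W0\<close>, so variations
  may leave the constraint.\<close>

lemma powr_add_le:
  fixes a b r :: real
  assumes "r > 0"
  shows "\<bar>a + b\<bar> powr r \<le> 2 powr r * (\<bar>a\<bar> powr r + \<bar>b\<bar> powr r)"
proof -
  have "\<bar>a + b\<bar> powr r \<le> (2 * max \<bar>a\<bar> \<bar>b\<bar>) powr r"
    using assms by (intro powr_mono2) auto
  also have "\<dots> = 2 powr r * (max \<bar>a\<bar> \<bar>b\<bar>) powr r"
    by (simp add: powr_mult)
  also have "\<dots> \<le> 2 powr r * (\<bar>a\<bar> powr r + \<bar>b\<bar> powr r)"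
    by (intro mult_left_mono) (auto simp: max_def)
  finally show ?thesis .
qed

lemma powr_mvt_le:
  fixes x y p :: real
  assumes "0 \<le> y" "y \<le> x" "1 < p"
  shows "x powr p - y powr p \<le> p * x powr (p - 1) * (x - y)"
proof (cases "y = x")
  case False
  then have "y < x" using assms by simp
  obtain l z where z: "y < z" "z < x" "DERIV (\<lambda>z. z powr p) z :> l"
      "x powr p - y powr p = (x - y) * l"
  proof -
    have "\<exists>l z. y < z \<and> z < x \<and> DERIV (\<lambda>z. z powr p) z :> l \<and> x powr p - y powr p = (x - y) * l"
    proof (rule MVT[OF \<open>y < x\<close>])
      show "continuous_on {y..x} (\<lambda>z. z powr p)"
        using assms by (intro continuous_on_powr' continuous_intros) auto
    next
      fix z assume "y < z" "z < x"
      then show "(\<lambda>z. z powr p) differentiable at z"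
        using assms has_real_derivative_powr[of z p] by (auto simp: real_differentiable_def)
    qed
    then show ?thesis using that by blast
  qed
  have "l = p * z powr (p - 1)"
    using z(3) has_real_derivative_powr[of z p] z(1) assms by (auto intro: DERIV_unique)
  moreover have "z powr (p - 1) \<le> x powr (p - 1)"
    using z assms by (intro powr_mono2) auto
  ultimately have "l \<le> p * x powr (p - 1)" using assms by simp
  then show ?thesis using z \<open>y < x\<close> by (simp add: mult.commute mult_left_mono)
qed simp

text \<open>The mean value bound is kept linear in \<open>\<bar>b\<bar>\<close>. It dominates the
  difference quotients in \<open>Lp_derivative\<close> and, for \<open>b\<close> small against
  \<open>a\<close>, gives the absorption inequality behind Brezis-Lieb.\<close>

lemma abs_powr_add_diff_le:
  fixes a b p :: real
  assumes "1 < p"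
  shows "\<bar>\<bar>a + b\<bar> powr p - \<bar>a\<bar> powr p\<bar> \<le> p * (\<bar>a\<bar> + \<bar>b\<bar>) powr (p - 1) * \<bar>b\<bar>"
proof -
  have *: "x powr p - y powr p \<le> p * (\<bar>a\<bar> + \<bar>b\<bar>) powr (p - 1) * \<bar>b\<bar>"
    if "0 \<le> y" "0 \<le> x" "x \<le> \<bar>a\<bar> + \<bar>b\<bar>" "x - y \<le> \<bar>b\<bar>" for x y
  proof (cases "y \<le> x")
    case True
    have "x powr p - y powr p \<le> p * x powr (p - 1) * (x - y)"
      using powr_mvt_le[of y x p] that True assms by simp
    also have "\<dots> \<le> p * (\<bar>a\<bar> + \<bar>b\<bar>) powr (p - 1) * \<bar>b\<bar>"
      using that assms True by (intro mult_mono mult_left_mono powr_mono2) auto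
    finally show ?thesis .
  next
    case False
    then have "x powr p \<le> y powr p" using that assms by (intro powr_mono2) auto
    moreover have "0 \<le> p * (\<bar>a\<bar> + \<bar>b\<bar>) powr (p - 1) * \<bar>b\<bar>" using assms by simp
    ultimately show ?thesis by linarith
  qed
  have "\<bar>a + b\<bar> powr p - \<bar>a\<bar> powr p \<le> p * (\<bar>a\<bar> + \<bar>b\<bar>) powr (p - 1) * \<bar>b\<bar>"
    by (rule *) auto
  moreover have "\<bar>a\<bar> powr p - \<bar>a + b\<bar> powr p \<le> p * (\<bar>a\<bar> + \<bar>b\<bar>) powr (p - 1) * \<bar>b\<bar>"
    by (rule *) auto
  ultimately show ?thesis by linarith
qed

lemma mult_powr_pred:
  fixes x p :: real
  assumes "x \<ge> 0"
  shows "x powr (p - 1) * x = x powr p"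
  using assms by (cases "x = 0") (simp_all add: powr_diff)

text \<open>If \<open>\<bar>b\<bar> \<le> \<eta> * \<bar>a\<bar>\<close>, the mean value bound is a
  small multiple of \<open>\<bar>a\<bar> powr p\<close>. Otherwise \<open>\<bar>a\<bar>\<close> is
  less than \<open>\<bar>b\<bar> / \<eta>\<close> and everything is charged to
  \<open>\<bar>b\<bar> powr p\<close>.\<close>

lemma abs_powr_add_diff_small:
  fixes p e :: real
  assumes p: "1 < p" and e: "e > 0"
  obtains C where "C \<ge> 0" "\<And>a b. \<bar>\<bar>a + b\<bar> powr p - \<bar>a\<bar> powr p\<bar> \<le> e * \<bar>a\<bar> powr p + C * \<bar>b\<bar> powr p"
proof -
  \<comment> \<open>The cap at 1 gives
    \<open>\<bar>a\<bar> + \<bar>b\<bar> \<le> 2 * \<bar>a\<bar>\<close> in the first case; the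
    other term compensates the factor \<open>p * 2 powr (p - 1)\<close> that results.\<close>
  define \<eta> where "\<eta> = min 1 (e / (p * 2 powr (p - 1)))"
  have \<eta>: "\<eta> > 0" "\<eta> \<le> 1" using p e by (auto simp: \<eta>_def)
  have \<eta>e: "p * 2 powr (p - 1) * \<eta> \<le> e"
  proof -
    have "p * 2 powr (p - 1) * \<eta> \<le> p * 2 powr (p - 1) * (e / (p * 2 powr (p - 1)))"
      using p by (intro mult_left_mono) (auto simp: \<eta>_def)
    then show ?thesis using p by simp
  qed
  define C where "C = p * (1 / \<eta> + 1) powr (p - 1)"
  have "\<bar>\<bar>a + b\<bar> powr p - \<bar>a\<bar> powr p\<bar> \<le> e * \<bar>a\<bar> powr p + C * \<bar>b\<bar> powr p" for a b :: real
  proof (cases "\<bar>b\<bar> \<le> \<eta> * \<bar>a\<bar>")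
    case True
    then have ba: "\<bar>b\<bar> \<le> \<bar>a\<bar>" using \<eta> mult_right_mono[of \<eta> 1 "\<bar>a\<bar>"] by simp
    have "\<bar>\<bar>a + b\<bar> powr p - \<bar>a\<bar> powr p\<bar> \<le> p * (\<bar>a\<bar> + \<bar>b\<bar>) powr (p - 1) * \<bar>b\<bar>"
      by (rule abs_powr_add_diff_le[OF p])
    also have "\<dots> \<le> p * (2 * \<bar>a\<bar>) powr (p - 1) * (\<eta> * \<bar>a\<bar>)"
      using p ba True by (intro mult_mono mult_left_mono powr_mono2) auto
    also have "\<dots> = p * 2 powr (p - 1) * \<eta> * (\<bar>a\<bar> powr (p - 1) * \<bar>a\<bar>)"
      by (simp add: powr_mult)
    also have "\<dots> = p * 2 powr (p - 1) * \<eta> * \<bar>a\<bar> powr p"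
      by (simp only: mult_powr_pred abs_ge_zero)
    also have "\<dots> \<le> e * \<bar>a\<bar> powr p" using \<eta>e by (intro mult_right_mono) auto
    also have "\<dots> \<le> e * \<bar>a\<bar> powr p + C * \<bar>b\<bar> powr p" using p \<eta> by (simp add: C_def)
    finally show ?thesis .
  next
    case False
    then have ab: "\<bar>a\<bar> \<le> 1 / \<eta> * \<bar>b\<bar>" using \<eta> by (simp add: field_simps)
    have "\<bar>\<bar>a + b\<bar> powr p - \<bar>a\<bar> powr p\<bar> \<le> p * (\<bar>a\<bar> + \<bar>b\<bar>) powr (p - 1) * \<bar>b\<bar>"
      by (rule abs_powr_add_diff_le[OF p])
    also have "\<dots> \<le> p * ((1 / \<eta> + 1) * \<bar>b\<bar>) powr (p - 1) * \<bar>b\<bar>"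
      using p ab by (intro mult_mono mult_left_mono powr_mono2) (auto simp: distrib_right)
    also have "\<dots> = C * (\<bar>b\<bar> powr (p - 1) * \<bar>b\<bar>)"
      using \<eta> by (simp add: powr_mult C_def)
    also have "\<dots> = C * \<bar>b\<bar> powr p" by (simp only: mult_powr_pred abs_ge_zero)
    also have "\<dots> \<le> e * \<bar>a\<bar> powr p + C * \<bar>b\<bar> powr p" using e by simp
    finally show ?thesis .
  qed
  moreover have "C \<ge> 0" using p \<eta> by (simp add: C_def)
  ultimately show ?thesis using that by blast
qed

text \<open>At 0 the difference quotient has absolute value
  \<open>\<bar>h\<bar> powr (p - 1)\<close>, which tends to 0 as \<open>p > 1\<close>; the formula
  also gives 0 there, even for \<open>p < 2\<close>, because of the factor \<open>a\<close>.\<close>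

lemma abs_powr_has_derivative:
  fixes a p :: real
  assumes "1 < p"
  shows "((\<lambda>x. \<bar>x\<bar> powr p) has_real_derivative p * (\<bar>a\<bar> powr (p - 2) * a)) (at a)"
proof -
  consider "a > 0" | "a < 0" | "a = 0" by linarith
  then show ?thesis
  proof cases
    case 1
    have "((\<lambda>x. x powr p) has_real_derivative p * (\<bar>a\<bar> powr (p - 2) * a)) (at a)"
      using has_real_derivative_powr[of a p] 1 mult_powr_pred[of a "p - 1"] by simp
    then show ?thesis
      by (rule has_field_derivative_transform_within[of _ _ _ _ a]) (use 1 in \<open>auto simp: dist_real_def\<close>)
  next
    case 2
    have "((\<lambda>x. (- x) powr p) has_real_derivative - (p * (-a) powr (p - 1))) (at a)"
      using DERIV_chain2[OF has_real_derivative_powr[of "-a" p] DERIV_minus[OF DERIV_ident]] 2 by simp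
    moreover have "- (p * (-a) powr (p - 1)) = p * (\<bar>a\<bar> powr (p - 2) * a)"
    proof -
      have "(-a) powr (p - 1) = (-a) powr (p - 2) * (-a)"
        using 2 mult_powr_pred[of "-a" "p - 1"] by simp
      then show ?thesis using 2 by (metis abs_of_neg minus_mult_right minus_minus)
    qed
    ultimately have "((\<lambda>x. (- x) powr p) has_real_derivative p * (\<bar>a\<bar> powr (p - 2) * a)) (at a)"
      by simp
    then show ?thesis
      by (rule has_field_derivative_transform_within[of _ _ _ _ "-a"]) (use 2 in \<open>auto simp: dist_real_def\<close>)
  next
    case 3
    have "((\<lambda>h. \<bar>h\<bar> powr (p - 1)) \<longlongrightarrow> 0) (at (0::real))"
      using tendsto_powr'[of "\<lambda>h::real. \<bar>h\<bar>" 0 "at 0" "\<lambda>_. p - 1" "p - 1"] assms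
      by (auto intro!: tendsto_eq_intros)
    moreover have "\<bar>\<bar>h\<bar> powr p / h\<bar> = \<bar>h\<bar> powr (p - 1)" for h :: real
      by (cases "h = 0") (auto simp: powr_diff)
    ultimately have "((\<lambda>h. \<bar>h\<bar> powr p / h) \<longlongrightarrow> 0) (at (0::real))"
      using tendsto_rabs_zero_iff[of "\<lambda>h. \<bar>h\<bar> powr p / h" "at 0"] by simp
    then show ?thesis using 3 by (simp add: DERIV_def)
  qed
qed

section \<open>Functions with integrable powers\<close>

text \<open>The measure and the exponent stay parameters because the lemmas are applied to
  \<open>lborel\<close> with \<open>p\<close> and with \<open>q\<close>, and to the product measure
  with \<open>p\<close>.\<close>

definition Lp :: "'a measure \<Rightarrow> real \<Rightarrow> ('a \<Rightarrow> real) \<Rightarrow> bool" where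
  "Lp M p f \<longleftrightarrow> f \<in> borel_measurable M \<and> integrable M (\<lambda>x. \<bar>f x\<bar> powr p)"

lemma Lp_measurable [measurable_dest]: "Lp M p f \<Longrightarrow> f \<in> borel_measurable M"
  by (simp add: Lp_def)

lemma Lp_integrable: "Lp M p f \<Longrightarrow> integrable M (\<lambda>x. \<bar>f x\<bar> powr p)"
  by (simp add: Lp_def)

lemma Lp_scale: "Lp M p f \<Longrightarrow> Lp M p (\<lambda>x. c * f x)"
  by (auto simp: Lp_def abs_mult powr_mult)

lemma integral_powr_scale:
  fixes c :: real and f :: "'a \<Rightarrow> real"
  shows "(LINT x|M. \<bar>c * f x\<bar> powr p) = \<bar>c\<bar> powr p * (LINT x|M. \<bar>f x\<bar> powr p)"
  by (simp add: abs_mult powr_mult)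

text \<open>Norms are handled through their \<open>p\<close>-th powers throughout; the factor
  \<open>2 powr p\<close> is the price for the triangle inequality in that form.\<close>

lemma Lp_add:
  assumes "p > 0" and f: "Lp M p f" and g: "Lp M p g"
  shows "Lp M p (\<lambda>x. f x + g x)"
    and "(LINT x|M. \<bar>f x + g x\<bar> powr p)
      \<le> 2 powr p * ((LINT x|M. \<bar>f x\<bar> powr p) + (LINT x|M. \<bar>g x\<bar> powr p))"
proof -
  have [measurable]: "f \<in> borel_measurable M" "g \<in> borel_measurable M" using f g by (auto simp: Lp_def)
  have i: "integrable M (\<lambda>x. 2 powr p * (\<bar>f x\<bar> powr p + \<bar>g x\<bar> powr p))"
    using f g by (auto simp: Lp_def)
  have j: "integrable M (\<lambda>x. \<bar>f x + g x\<bar> powr p)"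
    by (rule Bochner_Integration.integrable_bound[OF i])
      (auto intro!: AE_I2 order_trans[OF powr_add_le[OF \<open>p > 0\<close>]])
  then show "Lp M p (\<lambda>x. f x + g x)" by (simp add: Lp_def)
  have "(LINT x|M. \<bar>f x + g x\<bar> powr p) \<le> (LINT x|M. 2 powr p * (\<bar>f x\<bar> powr p + \<bar>g x\<bar> powr p))"
    by (intro integral_mono i j powr_add_le \<open>p > 0\<close>)
  also have "\<dots> = 2 powr p * ((LINT x|M. \<bar>f x\<bar> powr p) + (LINT x|M. \<bar>g x\<bar> powr p))"
    using f g by (simp add: Lp_def)
  finally show "(LINT x|M. \<bar>f x + g x\<bar> powr p)
      \<le> 2 powr p * ((LINT x|M. \<bar>f x\<bar> powr p) + (LINT x|M. \<bar>g x\<bar> powr p))" .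
qed

lemma Lp_diff:
  assumes "p > 0" and f: "Lp M p f" and g: "Lp M p g"
  shows "Lp M p (\<lambda>x. f x - g x)"
    and "(LINT x|M. \<bar>f x - g x\<bar> powr p)
      \<le> 2 powr p * ((LINT x|M. \<bar>f x\<bar> powr p) + (LINT x|M. \<bar>g x\<bar> powr p))"
  using Lp_add[OF \<open>p > 0\<close> f Lp_scale[OF g, of "-1"]] by simp_all

text \<open>Fatou's lemma is how limits enter the spaces: a bound on the \<open>p\<close>-th powers
  and convergence almost everywhere suffice.\<close>

lemma Lp_Fatou:
  assumes p: "p > 0" and f: "\<And>n. Lp M p (f n)" and B: "\<And>n. (LINT x|M. \<bar>f n x\<bar> powr p) \<le> B"
    and g: "g \<in> borel_measurable M" and lim: "AE x in M. (\<lambda>n. f n x) \<longlonglongrightarrow> g x"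
  shows "Lp M p g" and "(LINT x|M. \<bar>g x\<bar> powr p) \<le> B"
proof -
  note [measurable] = g Lp_measurable[OF f]
  have B0: "B \<ge> 0" by (rule order_trans[OF Bochner_Integration.integral_nonneg_AE B[of 0]]) simp
  have "AE x in M. ennreal (\<bar>g x\<bar> powr p) = liminf (\<lambda>n. ennreal (\<bar>f n x\<bar> powr p))"
    using lim
  proof eventually_elim
    case (elim x)
    then have "(\<lambda>n. \<bar>f n x\<bar> powr p) \<longlonglongrightarrow> \<bar>g x\<bar> powr p"
      using p by (auto intro!: tendsto_powr' tendsto_intros)
    then show ?case
      by (intro lim_imp_Liminf[symmetric] tendsto_ennrealI) auto
  qed
  then have "(\<integral>\<^sup>+x. ennreal (\<bar>g x\<bar> powr p) \<partial>M) = (\<integral>\<^sup>+x. liminf (\<lambda>n. ennreal (\<bar>f n x\<bar> powr p)) \<partial>M)"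
    by (rule nn_integral_cong_AE)
  also have "\<dots> \<le> liminf (\<lambda>n. \<integral>\<^sup>+x. ennreal (\<bar>f n x\<bar> powr p) \<partial>M)"
    by (rule nn_integral_liminf) simp
  also have "\<dots> \<le> liminf (\<lambda>n::nat. ennreal B)"
  proof (rule Liminf_mono, rule always_eventually, rule allI)
    fix n
    show "(\<integral>\<^sup>+x. ennreal (\<bar>f n x\<bar> powr p) \<partial>M) \<le> ennreal B"
      using B[of n] f[of n] by (subst nn_integral_eq_integral) (auto simp: Lp_def intro: ennreal_leI)
  qed
  also have "\<dots> = ennreal B" by (simp add: Liminf_const)
  finally have le: "(\<integral>\<^sup>+x. ennreal (\<bar>g x\<bar> powr p) \<partial>M) \<le> ennreal B" .
  have i: "integrable M (\<lambda>x. \<bar>g x\<bar> powr p)"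
    by (rule integrableI_nonneg) (use le in \<open>auto simp: less_top[symmetric] top_unique\<close>)
  then show "Lp M p g" using g by (simp add: Lp_def)
  show "(LINT x|M. \<bar>g x\<bar> powr p) \<le> B"
    using le B0 by (subst (asm) nn_integral_eq_integral[OF i]) auto
qed

text \<open>The part \<open>W\<close> of \<open>\<bar>r n x\<bar>\<close> exceeding
  \<open>\<epsilon> * \<bar>f n x - g x\<bar> powr p\<close> is dominated by
  \<open>(C + 1) * \<bar>g x\<bar> powr p\<close>, so its integral tends to 0. What was cut off has
  integral at most \<open>\<epsilon> * B'\<close>, uniformly in \<open>n\<close>.\<close>

lemma brezis_lieb:
  assumes p: "p > 1" and f: "\<And>n. Lp M p (f n)" and B: "\<And>n. (LINT x|M. \<bar>f n x\<bar> powr p) \<le> B"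
    and g: "g \<in> borel_measurable M" and lim: "AE x in M. (\<lambda>n. f n x) \<longlonglongrightarrow> g x"
  shows "(\<lambda>n. (LINT x|M. \<bar>f n x\<bar> powr p) - (LINT x|M. \<bar>f n x - g x\<bar> powr p))
           \<longlonglongrightarrow> (LINT x|M. \<bar>g x\<bar> powr p)"
proof -
  note [measurable] = g Lp_measurable[OF f]
  have p0: "p > 0" using p by simp
  have g': "Lp M p g" by (rule Lp_Fatou[OF p0 f B g lim])
  have d: "Lp M p (\<lambda>x. f n x - g x)" for n by (rule Lp_diff[OF p0 f g'])
  \<comment> \<open>The summand 1 keeps \<open>B'\<close> positive, since \<open>\<epsilon>\<close>
    is defined by a division by it.\<close>
  define B' where "B' = 2 powr p * (B + (LINT x|M. \<bar>g x\<bar> powr p)) + 1"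
  have B': "(LINT x|M. \<bar>f n x - g x\<bar> powr p) \<le> B'" for n
  proof -
    have "(LINT x|M. \<bar>f n x - g x\<bar> powr p)
      \<le> 2 powr p * ((LINT x|M. \<bar>f n x\<bar> powr p) + (LINT x|M. \<bar>g x\<bar> powr p))"
      by (rule Lp_diff[OF p0 f g'])
    also have "\<dots> \<le> 2 powr p * (B + (LINT x|M. \<bar>g x\<bar> powr p))"
      by (intro mult_left_mono add_right_mono B) auto
    finally show ?thesis by (simp add: B'_def)
  qed
  have "B \<ge> 0" by (rule order_trans[OF Bochner_Integration.integral_nonneg_AE B[of 0]]) simp
  then have B'0: "B' > 0"
    unfolding B'_def by (intro add_nonneg_pos mult_nonneg_nonneg add_nonneg_nonneg) auto
  define r where "r n x = \<bar>f n x\<bar> powr p - \<bar>f n x - g x\<bar> powr p - \<bar>g x\<bar> powr p" for n x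
  have ir: "integrable M (r n)" for n
    unfolding r_def using Lp_integrable[OF f] Lp_integrable[OF d] Lp_integrable[OF g']
    by (intro Bochner_Integration.integrable_diff) auto
  have rlim: "AE x in M. (\<lambda>n. r n x) \<longlonglongrightarrow> 0 \<and> (\<lambda>n. \<bar>f n x - g x\<bar> powr p) \<longlonglongrightarrow> 0"
    using lim
  proof eventually_elim
    case (elim x)
    have 1: "(\<lambda>n. \<bar>f n x\<bar> powr p) \<longlonglongrightarrow> \<bar>g x\<bar> powr p"
      using elim p by (auto intro!: tendsto_powr' tendsto_intros)
    have "(\<lambda>n. \<bar>f n x - g x\<bar> powr p) \<longlonglongrightarrow> \<bar>g x - g x\<bar> powr p"
      using elim p by (intro tendsto_powr' tendsto_intros) auto
    then have 2: "(\<lambda>n. \<bar>f n x - g x\<bar> powr p) \<longlonglongrightarrow> 0" by simp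
    have "(\<lambda>n. r n x) \<longlonglongrightarrow> \<bar>g x\<bar> powr p - 0 - \<bar>g x\<bar> powr p"
      unfolding r_def by (intro tendsto_diff 1 2 tendsto_const)
    then show ?case using 2 by simp
  qed
  have "(\<lambda>n. LINT x|M. r n x) \<longlonglongrightarrow> 0"
  proof (rule LIMSEQ_I)
    fix e :: real assume "0 < e"
    define \<epsilon> where "\<epsilon> = e / (2 * B')"
    have \<epsilon>: "\<epsilon> > 0" using \<open>0 < e\<close> B'0 by (simp add: \<epsilon>_def)
    obtain C where C: "C \<ge> 0"
      "\<And>a b. \<bar>\<bar>a + b\<bar> powr p - \<bar>a\<bar> powr p\<bar> \<le> \<epsilon> * \<bar>a\<bar> powr p + C * \<bar>b\<bar> powr p"
      using abs_powr_add_diff_small[OF p \<epsilon>] by blast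
    define W where "W n x = max 0 (\<bar>r n x\<bar> - \<epsilon> * \<bar>f n x - g x\<bar> powr p)" for n x
    have Wb: "\<bar>W n x\<bar> \<le> (C + 1) * \<bar>g x\<bar> powr p" for n x
    proof -
      have "\<bar>\<bar>f n x\<bar> powr p - \<bar>f n x - g x\<bar> powr p\<bar> \<le> \<epsilon> * \<bar>f n x - g x\<bar> powr p + C * \<bar>g x\<bar> powr p"
        using C(2)[of "f n x - g x" "g x"] by simp
      then have "\<bar>r n x\<bar> \<le> \<epsilon> * \<bar>f n x - g x\<bar> powr p + (C + 1) * \<bar>g x\<bar> powr p"
        unfolding r_def distrib_right using powr_ge_zero[of "\<bar>g x\<bar>" p] by linarith
      moreover have "0 \<le> (C + 1) * \<bar>g x\<bar> powr p" using C by simp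
      ultimately show ?thesis unfolding W_def by linarith
    qed
    have [measurable]: "r n \<in> borel_measurable M" for n using ir by auto
    have Wm [measurable]: "W n \<in> borel_measurable M" for n unfolding W_def by measurable
    have iW: "integrable M (W n)" for n
      by (rule Bochner_Integration.integrable_bound[of M "\<lambda>x. (C + 1) * \<bar>g x\<bar> powr p"])
        (use Lp_integrable[OF g'] Wb C in auto)
    have "(\<lambda>n. LINT x|M. W n x) \<longlonglongrightarrow> (LINT x|M. 0)"
    proof (rule integral_dominated_convergence[where w = "\<lambda>x. (C + 1) * \<bar>g x\<bar> powr p"])
      show "integrable M (\<lambda>x. (C + 1) * \<bar>g x\<bar> powr p)" using Lp_integrable[OF g'] by auto
      show "AE x in M. (\<lambda>n. W n x) \<longlonglongrightarrow> 0"
        using rlim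
      proof eventually_elim
        case (elim x)
        then have "(\<lambda>n. W n x) \<longlonglongrightarrow> max 0 (\<bar>0\<bar> - \<epsilon> * 0)"
          unfolding W_def by (intro tendsto_intros) auto
        then show ?case by simp
      qed
    qed (use Wb in auto)
    then have "(\<lambda>n. LINT x|M. W n x) \<longlonglongrightarrow> 0" by simp
    from LIMSEQ_D[OF this, of "e / 2"] \<open>0 < e\<close>
    obtain no where no: "\<And>n. n \<ge> no \<Longrightarrow> \<bar>LINT x|M. W n x\<bar> < e / 2" by auto
    show "\<exists>no. \<forall>n\<ge>no. norm ((LINT x|M. r n x) - 0) < e"
    proof (intro exI[of _ no] allI impI)
      fix n assume "n \<ge> no"
      have "\<bar>LINT x|M. r n x\<bar> \<le> (LINT x|M. \<bar>r n x\<bar>)" by simp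
      also have "\<dots> \<le> (LINT x|M. W n x + \<epsilon> * \<bar>f n x - g x\<bar> powr p)"
        using ir iW Lp_integrable[OF d] by (intro integral_mono) (auto simp: W_def)
      also have "\<dots> = (LINT x|M. W n x) + \<epsilon> * (LINT x|M. \<bar>f n x - g x\<bar> powr p)"
        using iW Lp_integrable[OF d] by simp
      also have "\<dots> \<le> (LINT x|M. W n x) + \<epsilon> * B'"
        using \<epsilon> B' by (intro add_left_mono mult_left_mono) auto
      also have "\<dots> < e / 2 + e / 2"
        using no[OF \<open>n \<ge> no\<close>] B'0 by (simp add: \<epsilon>_def)
      finally show "norm ((LINT x|M. r n x) - 0) < e" by simp
    qed
  qed
  then have "(\<lambda>n. (LINT x|M. r n x) + (LINT x|M. \<bar>g x\<bar> powr p)) \<longlonglongrightarrow> 0 + (LINT x|M. \<bar>g x\<bar> powr p)"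
    by (intro tendsto_intros)
  moreover have "(LINT x|M. r n x) = (LINT x|M. \<bar>f n x\<bar> powr p) - (LINT x|M. \<bar>f n x - g x\<bar> powr p)
      - (LINT x|M. \<bar>g x\<bar> powr p)" for n
    unfolding r_def using Lp_integrable[OF f] Lp_integrable[OF d] Lp_integrable[OF g'] by simp
  ultimately show ?thesis by simp
qed

text \<open>Differentiation under the integral sign. Along a sequence of increments bounded by
  \<open>K\<close> the quotients are dominated by a multiple of \<open>w\<close>, an integrable
  majorant of \<open>(\<bar>f x\<bar> + \<bar>g x\<bar>) powr p\<close>.\<close>

lemma Lp_derivative:
  assumes p: "p > 1" and f: "Lp M p f" and g: "Lp M p g"
  shows "integrable M (\<lambda>x. \<bar>f x\<bar> powr (p - 2) * f x * g x)" (is ?i)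
    and "((\<lambda>t. LINT x|M. \<bar>f x + t * g x\<bar> powr p) has_real_derivative
           p * (LINT x|M. \<bar>f x\<bar> powr (p - 2) * f x * g x)) (at 0)" (is ?d)
proof -
  note [measurable] = Lp_measurable[OF f] Lp_measurable[OF g]
  have p0: "p > 0" using p by simp
  define w where "w x = 2 powr p * (\<bar>f x\<bar> powr p + \<bar>g x\<bar> powr p)" for x
  have iw: "integrable M w" unfolding w_def using Lp_integrable[OF f] Lp_integrable[OF g] by auto
  have w: "(\<bar>f x\<bar> + \<bar>g x\<bar>) powr p \<le> w x" for x
    unfolding w_def using powr_add_le[OF p0, of "\<bar>f x\<bar>" "\<bar>g x\<bar>"] by simp
  show ?i
  proof (rule Bochner_Integration.integrable_bound[OF iw])
    show "AE x in M. norm (\<bar>f x\<bar> powr (p - 2) * f x * g x) \<le> norm (w x)"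
    proof (rule AE_I2)
      fix x
      have "norm (\<bar>f x\<bar> powr (p - 2) * f x * g x) = \<bar>f x\<bar> powr (p - 1) * \<bar>g x\<bar>"
        using mult_powr_pred[of "\<bar>f x\<bar>" "p - 1"] by (simp add: abs_mult)
      also have "\<dots> \<le> (\<bar>f x\<bar> + \<bar>g x\<bar>) powr (p - 1) * (\<bar>f x\<bar> + \<bar>g x\<bar>)"
        using p by (intro mult_mono powr_mono2) auto
      also have "\<dots> \<le> w x" using w[of x] by (simp add: mult_powr_pred)
      finally show "norm (\<bar>f x\<bar> powr (p - 2) * f x * g x) \<le> norm (w x)" by simp
    qed
  qed simp
  show ?d
    unfolding DERIV_def tendsto_at_iff_sequentially
  proof (intro allI impI)
    fix X :: "nat \<Rightarrow> real" assume X0: "\<forall>i. X i \<in> UNIV - {0}" and X: "X \<longlonglongrightarrow> 0"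
    obtain K0 where K0: "\<And>i. \<bar>X i\<bar> \<le> K0"
      using convergent_imp_Bseq[OF convergentI[OF X]] by (auto simp: Bseq_def)
    \<comment> \<open>With \<open>K \<ge> 1\<close> the single factor \<open>K\<close> dominates
      both \<open>\<bar>f x\<bar>\<close> and \<open>\<bar>X i * g x\<bar>\<close>.\<close>
    define K where "K = max 1 K0"
    have K: "K \<ge> 1" "\<And>i. \<bar>X i\<bar> \<le> K" using K0 by (auto simp: K_def le_max_iff_disj)
    define q where "q i x = (\<bar>f x + X i * g x\<bar> powr p - \<bar>f x\<bar> powr p) / X i" for i x
    have "(\<lambda>i. LINT x|M. q i x) \<longlonglongrightarrow> (LINT x|M. p * (\<bar>f x\<bar> powr (p - 2) * f x * g x))"
    proof (rule integral_dominated_convergence[where w = "\<lambda>x. p * K powr (p - 1) * w x"])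
      show "integrable M (\<lambda>x. p * K powr (p - 1) * w x)" using iw by auto
      show "AE x in M. (\<lambda>i. q i x) \<longlonglongrightarrow> p * (\<bar>f x\<bar> powr (p - 2) * f x * g x)"
      proof (rule AE_I2)
        fix x
        have "((\<lambda>t. \<bar>f x + t * g x\<bar> powr p) has_real_derivative
            p * (\<bar>f x + 0 * g x\<bar> powr (p - 2) * (f x + 0 * g x)) * g x) (at 0)"
          by (rule DERIV_chain2[OF abs_powr_has_derivative[OF p]]) (auto intro!: derivative_eq_intros)
        then have "((\<lambda>h. (\<bar>f x + h * g x\<bar> powr p - \<bar>f x\<bar> powr p) / h) \<longlongrightarrow>
            p * (\<bar>f x\<bar> powr (p - 2) * f x * g x)) (at 0)"
          by (simp add: DERIV_def mult.assoc)
        from this[unfolded tendsto_at_iff_sequentially] X0 X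
        show "(\<lambda>i. q i x) \<longlonglongrightarrow> p * (\<bar>f x\<bar> powr (p - 2) * f x * g x)"
          by (auto simp: o_def q_def)
      qed
      show "AE x in M. norm (q i x) \<le> p * K powr (p - 1) * w x" for i
      proof (rule AE_I2)
        fix x
        have Xi: "X i \<noteq> 0" using X0 by auto
        have "\<bar>\<bar>f x + X i * g x\<bar> powr p - \<bar>f x\<bar> powr p\<bar>
            \<le> p * (\<bar>f x\<bar> + \<bar>X i * g x\<bar>) powr (p - 1) * \<bar>X i * g x\<bar>"
          by (rule abs_powr_add_diff_le[OF p])
        then have "norm (q i x) \<le> p * (\<bar>f x\<bar> + \<bar>X i * g x\<bar>) powr (p - 1) * \<bar>g x\<bar>"
          using Xi by (simp add: q_def abs_mult divide_simps mult.assoc mult.commute)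
        also have "\<dots> \<le> p * (K * (\<bar>f x\<bar> + \<bar>g x\<bar>)) powr (p - 1) * (\<bar>f x\<bar> + \<bar>g x\<bar>)"
        proof -
          have "\<bar>f x\<bar> \<le> K * \<bar>f x\<bar>" using K(1) mult_right_mono[of 1 K "\<bar>f x\<bar>"] by simp
          moreover have "\<bar>X i * g x\<bar> \<le> K * \<bar>g x\<bar>" using K by (simp add: abs_mult mult_right_mono)
          ultimately show ?thesis
            using p by (intro mult_mono mult_left_mono powr_mono2) (auto simp: distrib_left)
        qed
        also have "\<dots> = p * K powr (p - 1) * ((\<bar>f x\<bar> + \<bar>g x\<bar>) powr (p - 1) * (\<bar>f x\<bar> + \<bar>g x\<bar>))"
          using K by (simp add: powr_mult)
        also have "\<dots> \<le> p * K powr (p - 1) * w x"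
          using p w[of x] by (intro mult_left_mono) (auto simp: mult_powr_pred)
        finally show "norm (q i x) \<le> p * K powr (p - 1) * w x" .
      qed
    qed (auto simp: q_def)
    moreover have "(LINT x|M. q i x) = ((LINT x|M. \<bar>f x + X i * g x\<bar> powr p) - (LINT x|M. \<bar>f x\<bar> powr p)) / X i" for i
      unfolding q_def
      using Lp_integrable[OF Lp_add(1)[OF p0 f Lp_scale[OF g, of "X i"]]] Lp_integrable[OF f] by simp
    ultimately show "((\<lambda>h. ((LINT x|M. \<bar>f x + (0 + h) * g x\<bar> powr p) - (LINT x|M. \<bar>f x + 0 * g x\<bar> powr p)) / h) \<circ> X)
        \<longlonglongrightarrow> p * (LINT x|M. \<bar>f x\<bar> powr (p - 2) * f x * g x)"
      by (simp add: o_def)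
  qed
qed

section \<open>Calculus of smooth maps\<close>

lemma Ck_Suc_imp: "Ck (Suc n) f \<Longrightarrow> Ck n f"
proof (induction n arbitrary: f)
  case 0
  then show ?case
    by (auto simp: continuous_on_eq_continuous_at intro: differentiable_imp_continuous_within)
qed auto

lemma has_derivative_frechet:
  "f differentiable (at x) \<Longrightarrow> (f has_derivative frechet_derivative f (at x)) (at x)"
  by (simp add: frechet_derivative_works)

lemma Ck_SucI:
  assumes "\<And>x. (f has_derivative f' x) (at x)" "\<And>v. Ck n (\<lambda>x. f' x v)"
  shows "Ck (Suc n) f"
proof -
  have "frechet_derivative f (at x) = f' x" for x
    using frechet_derivative_at[OF assms(1)] by simp
  then show ?thesis using assms by (auto simp: differentiable_def)
qed

lemma Ck_const: "Ck n (\<lambda>x. c)"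
proof (induction n arbitrary: c)
  case (Suc n)
  show ?case by (rule Ck_SucI[where f' = "\<lambda>_ _. 0"]) (auto intro: Suc)
qed simp

lemma Ck_add: "Ck n f \<Longrightarrow> Ck n g \<Longrightarrow> Ck n (\<lambda>x. f x + g x)"
proof (induction n arbitrary: f g)
  case (Suc n)
  show ?case
    by (rule Ck_SucI[where f' = "\<lambda>x v. frechet_derivative f (at x) v + frechet_derivative g (at x) v"])
      (use Suc in \<open>auto intro!: has_derivative_add has_derivative_frechet\<close>)
qed (auto intro: continuous_on_add)

lemma Ck_sum: "finite A \<Longrightarrow> (\<And>i. i \<in> A \<Longrightarrow> Ck n (f i)) \<Longrightarrow> Ck n (\<lambda>x. \<Sum>i\<in>A. f i x)"
  by (induction A rule: finite_induct) (auto intro: Ck_const Ck_add)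

lemma Ck_bounded_linear:
  assumes "bounded_linear L"
  shows "Ck n L"
proof (cases n)
  case 0
  then show ?thesis using assms by (simp add: linear_continuous_on)
next
  case (Suc m)
  show ?thesis unfolding Suc
    by (rule Ck_SucI[where f' = "\<lambda>_. L"]) (auto intro: bounded_linear_imp_has_derivative assms Ck_const)
qed

lemma Ck_scaleR:
  fixes f :: "'a::euclidean_space \<Rightarrow> real"
  shows "Ck n f \<Longrightarrow> Ck n g \<Longrightarrow> Ck n (\<lambda>x. f x *\<^sub>R g x)"
proof (induction n arbitrary: f g)
  case (Suc n)
  show ?case
  proof (rule Ck_SucI[where f' = "\<lambda>x v. f x *\<^sub>R frechet_derivative g (at x) v + frechet_derivative f (at x) v *\<^sub>R g x"])
    show "((\<lambda>x. f x *\<^sub>R g x) has_derivative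
        (\<lambda>v. f x *\<^sub>R frechet_derivative g (at x) v + frechet_derivative f (at x) v *\<^sub>R g x)) (at x)" for x
      using Suc.prems by (intro has_derivative_scaleR has_derivative_frechet) auto
    show "Ck n (\<lambda>x. f x *\<^sub>R frechet_derivative g (at x) v + frechet_derivative f (at x) v *\<^sub>R g x)" for v
      using Suc.prems Ck_Suc_imp[OF Suc.prems(1)] Ck_Suc_imp[OF Suc.prems(2)]
      by (intro Ck_add Suc.IH) auto
  qed
qed (auto intro: continuous_on_scaleR)

lemma linear_Basis_expansion:
  fixes f :: "'a::euclidean_space \<Rightarrow> 'b::real_vector"
  assumes "linear f"
  shows "f w = (\<Sum>i\<in>Basis. (w \<bullet> i) *\<^sub>R f i)"
  by (subst (1) euclidean_representation[of w, symmetric])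
    (simp only: linear_sum[OF assms] linear_scale[OF assms])

text \<open>In the chain rule the direction \<open>?D g x v\<close> varies with \<open>x\<close>,
  whereas \<open>Ck\<close> speaks of fixed directions. Expanding it in \<open>Basis\<close> gives a
  finite sum of products of scalar functions with compositions, and the induction hypothesis covers
  the latter.\<close>

lemma Ck_compose:
  fixes f :: "'b::euclidean_space \<Rightarrow> 'c::euclidean_space" and g :: "'a::euclidean_space \<Rightarrow> 'b"
  shows "Ck n f \<Longrightarrow> Ck n g \<Longrightarrow> Ck n (\<lambda>x. f (g x))"
proof (induction n arbitrary: f)
  case 0
  then show ?case by (auto intro: continuous_on_compose2)
next
  case (Suc n)
  let ?D = "\<lambda>f x v. frechet_derivative f (at x) v"
  have f: "(f has_derivative ?D f x) (at x)" for x using Suc.prems by (simp add: has_derivative_frechet)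
  have g: "(g has_derivative ?D g x) (at x)" for x using Suc.prems by (simp add: has_derivative_frechet)
  have exp: "?D f y w = (\<Sum>i\<in>Basis. (w \<bullet> i) *\<^sub>R ?D f y i)" for y w
    by (rule linear_Basis_expansion[OF has_derivative_linear[OF f]])
  show ?case
  proof (rule Ck_SucI[where f' = "\<lambda>x v. \<Sum>i\<in>Basis. (?D g x v \<bullet> i) *\<^sub>R ?D f (g x) i"])
    fix x
    have "((\<lambda>x. f (g x)) has_derivative (\<lambda>v. ?D f (g x) (?D g x v))) (at x)"
      by (rule has_derivative_compose[OF g f])
    then show "((\<lambda>x. f (g x)) has_derivative (\<lambda>v. \<Sum>i\<in>Basis. (?D g x v \<bullet> i) *\<^sub>R ?D f (g x) i)) (at x)"
      by (simp only: exp[symmetric])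
  next
    fix v
    have inner: "Ck n (\<lambda>x. h x \<bullet> i)" if "Ck n h" for h :: "'a \<Rightarrow> 'b" and i
    proof -
      have "Ck m (\<lambda>x. h x \<bullet> i)" if "Ck m h" for m and h :: "'a \<Rightarrow> 'b"
        using that
      proof (induction m arbitrary: h)
        case 0
        then show ?case by (auto intro: continuous_on_inner)
      next
        case (Suc m)
        show ?case
          by (rule Ck_SucI[where f' = "\<lambda>x v. ?D h x v \<bullet> i"])
            (use Suc in \<open>auto intro!: has_derivative_inner_left has_derivative_frechet\<close>)
      qed
      then show ?thesis using that .
    qed
    show "Ck n (\<lambda>x. \<Sum>i\<in>Basis. (?D g x v \<bullet> i) *\<^sub>R ?D f (g x) i)"
      by (intro Ck_sum Ck_scaleR inner Suc.IH) (use Suc.prems Ck_Suc_imp[OF Suc.prems(2)] in auto)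
  qed
qed

lemma smooth_compose: "smooth f \<Longrightarrow> smooth g \<Longrightarrow> smooth (\<lambda>x. f (g x))"
  by (auto simp: smooth_def intro: Ck_compose)

lemma smooth_add: "smooth f \<Longrightarrow> smooth g \<Longrightarrow> smooth (\<lambda>x. f x + g x)"
  by (auto simp: smooth_def intro: Ck_add)

lemma smooth_scale: "smooth f \<Longrightarrow> smooth (\<lambda>x. (c::real) *\<^sub>R f x)"
  by (auto simp: smooth_def intro: Ck_scaleR Ck_const)

lemma smooth_Pair: "smooth (\<lambda>x. (a, x))"
proof -
  have "smooth (\<lambda>x. (a, 0) + (0, x))"
    unfolding smooth_def
    by (intro allI Ck_add Ck_const Ck_bounded_linear bounded_linear_Pair bounded_linear_zero bounded_linear_ident)
  then show ?thesis by simp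
qed

lemma smooth_imp_continuous: "smooth f \<Longrightarrow> continuous_on UNIV f"
  unfolding smooth_def using Ck.simps(1) by blast

lemma smooth_imp_has_derivative:
  "smooth f \<Longrightarrow> (f has_derivative frechet_derivative f (at x)) (at x)"
  unfolding smooth_def using Ck.simps(2)[of 0 f] by (auto intro: has_derivative_frechet)

lemma smooth_imp_continuous_derivative:
  "smooth f \<Longrightarrow> continuous_on UNIV (\<lambda>x. frechet_derivative f (at x) v)"
  unfolding smooth_def using Ck.simps(2)[of 0 f] by auto

text \<open>Expressed through the joint derivative, the partial derivative is visibly continuous in
  both variables together, as needed near the identity and over compact sets.\<close>

lemma smooth_partial_derivative:
  assumes "smooth f"
  shows "((\<lambda>y. f (b, y)) has_derivative (\<lambda>w. frechet_derivative f (at (b, x)) (0, w))) (at x)"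
proof -
  have "((\<lambda>y. (b, y)) has_derivative (\<lambda>w. (0, w))) (at x)"
    by (auto intro!: derivative_eq_intros)
  from has_derivative_compose[OF this smooth_imp_has_derivative[OF assms]] show ?thesis .
qed

section \<open>A smooth bump function\<close>

text \<open>For \<open>m = 0\<close> this is the classical smooth function that is flat at 0. The
  powers of \<open>1 / t\<close> make the family closed under differentiation up to linear
  combinations.\<close>

definition flat_fun :: "nat \<Rightarrow> real \<Rightarrow> real" where
  "flat_fun m t = (if t > 0 then exp (- inverse t) * inverse t ^ m else 0)"

lemma flat_fun_tendsto: "(flat_fun m \<longlongrightarrow> 0) (at 0)"
proof (subst filterlim_at_split, intro conjI)
  have "((\<lambda>t. inverse t ^ m / exp (inverse t)) \<longlongrightarrow> 0) (at_right (0::real))"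
    by (rule filterlim_compose[OF tendsto_power_div_exp_0 filterlim_inverse_at_top_right])
  moreover have "\<forall>\<^sub>F t in at_right 0. inverse t ^ m / exp (inverse t) = flat_fun m t"
    using eventually_at_right_less[of 0]
    by eventually_elim (auto simp: flat_fun_def exp_minus field_simps)
  ultimately show "(flat_fun m \<longlongrightarrow> 0) (at_right 0)"
    by (rule Lim_transform_eventually)
  have "\<forall>\<^sub>F t in at_left 0. 0 = flat_fun m t"
    by (rule eventually_at_leftI[of "-1"]) (auto simp: flat_fun_def)
  then show "(flat_fun m \<longlongrightarrow> 0) (at_left 0)"
    by (rule Lim_transform_eventually[OF tendsto_const])
qed

lemma flat_fun_has_derivative:
  "(flat_fun m has_real_derivative flat_fun (m + 2) t - m * flat_fun (m + 1) t) (at t)"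
proof -
  consider "t > 0" | "t < 0" | "t = 0" by linarith
  then show ?thesis
  proof cases
    case 1
    have "((\<lambda>t. exp (- inverse t) * inverse t ^ m) has_real_derivative
        flat_fun (m + 2) t - m * flat_fun (m + 1) t) (at t)"
    proof -
      have "((\<lambda>t. exp (- inverse t) * inverse t ^ m) has_real_derivative
          exp (- inverse t) * inverse t ^ 2 * inverse t ^ m
          + real m * (- (inverse t ^ 2)) * inverse t ^ (m - 1) * exp (- inverse t)) (at t)"
        using 1 by (auto intro!: derivative_eq_intros simp: power2_eq_square)
      moreover have "exp (- inverse t) * inverse t ^ 2 * inverse t ^ m
          + real m * (- (inverse t ^ 2)) * inverse t ^ (m - 1) * exp (- inverse t)
          = flat_fun (m + 2) t - m * flat_fun (m + 1) t"
        using 1 by (cases m) (simp_all add: flat_fun_def power2_eq_square algebra_simps)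
      ultimately show ?thesis by simp
    qed
    then show ?thesis
      by (rule has_field_derivative_transform_within[of _ _ _ _ t]) (use 1 in \<open>auto simp: flat_fun_def dist_real_def\<close>)
  next
    case 2
    have "((\<lambda>t. 0) has_real_derivative flat_fun (m + 2) t - m * flat_fun (m + 1) t) (at t)"
      using 2 by (simp add: flat_fun_def)
    then show ?thesis
      by (rule has_field_derivative_transform_within[of _ _ _ _ "-t"]) (use 2 in \<open>auto simp: flat_fun_def dist_real_def\<close>)
  next
    case 3
    have "flat_fun m h / h = flat_fun (Suc m) h" for h
      by (auto simp: flat_fun_def divide_inverse)
    then show ?thesis using 3 flat_fun_tendsto[of "Suc m"] by (simp add: DERIV_def flat_fun_def[of _ 0])
  qed
qed

text \<open>The closure rules are those produced by differentiating
  \<open>flat_fun m (1 - x \<bullet> x)\<close>, so all directional derivatives stay in the class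
  and smoothness becomes an induction on the order.\<close>

inductive_set bump_class :: "('a::euclidean_space \<Rightarrow> real) set" where
  base: "(\<lambda>x. flat_fun m (1 - x \<bullet> x)) \<in> bump_class"
| linear: "f \<in> bump_class \<Longrightarrow> (\<lambda>x. (x \<bullet> v) * f x) \<in> bump_class"
| add: "f \<in> bump_class \<Longrightarrow> g \<in> bump_class \<Longrightarrow> (\<lambda>x. f x + g x) \<in> bump_class"
| scale: "f \<in> bump_class \<Longrightarrow> (\<lambda>x. c * f x) \<in> bump_class"

lemma bump_class_derivative:
  "f \<in> bump_class \<Longrightarrow> \<exists>f'. (\<forall>x. (f has_derivative f' x) (at x)) \<and> (\<forall>v. (\<lambda>x. f' x v) \<in> bump_class)"
proof (induction rule: bump_class.induct)
  case (base m)
  define g :: "real \<Rightarrow> real" where "g t = flat_fun (m + 2) t - m * flat_fun (m + 1) t" for t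
  define f' :: "'a \<Rightarrow> 'a \<Rightarrow> real" where "f' x v = g (1 - x \<bullet> x) * (- 2 * (x \<bullet> v))" for x v
  have "((\<lambda>x. flat_fun m (1 - x \<bullet> x)) has_derivative f' x) (at x)" for x
  proof -
    have "((\<lambda>x. 1 - x \<bullet> x) has_derivative (\<lambda>v. - 2 * (x \<bullet> v))) (at x)"
      by (auto intro!: derivative_eq_intros simp: inner_commute)
    from has_derivative_compose[OF this flat_fun_has_derivative[of m "1 - x \<bullet> x", unfolded has_field_derivative_def]]
    show ?thesis by (simp add: f'_def[abs_def] g_def)
  qed
  moreover have "(\<lambda>x. f' x v) \<in> bump_class" for v
  proof -
    have "(\<lambda>x. (-2) * ((x \<bullet> v) * (flat_fun (m + 2) (1 - x \<bullet> x) + (- real m) * flat_fun (m + 1) (1 - x \<bullet> x)))) \<in> bump_class"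
      by (intro bump_class.intros)
    also have "(\<lambda>x. (-2) * ((x \<bullet> v) * (flat_fun (m + 2) (1 - x \<bullet> x) + (- real m) * flat_fun (m + 1) (1 - x \<bullet> x))))
        = (\<lambda>x. f' x v)"
      by (rule ext) (simp add: f'_def g_def algebra_simps)
    finally show ?thesis .
  qed
  ultimately show ?case by blast
next
  case (linear f w)
  then obtain f' where f: "\<And>x. (f has_derivative f' x) (at x)" "\<And>v. (\<lambda>x. f' x v) \<in> bump_class" by blast
  have "((\<lambda>x. (x \<bullet> w) * f x) has_derivative (\<lambda>v. (x \<bullet> w) * f' x v + (v \<bullet> w) * f x)) (at x)" for x
    by (intro has_derivative_mult has_derivative_inner_left has_derivative_ident f)
  moreover have "(\<lambda>x. (x \<bullet> w) * f' x v + (v \<bullet> w) * f x) \<in> bump_class" for v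
    by (intro bump_class.add bump_class.linear bump_class.scale f linear)
  ultimately show ?case
    by (intro exI[of _ "\<lambda>x v. (x \<bullet> w) * f' x v + (v \<bullet> w) * f x"]) simp
next
  case (add f g)
  then obtain f' g' where "\<And>x. (f has_derivative f' x) (at x)" "\<And>v. (\<lambda>x. f' x v) \<in> bump_class"
    "\<And>x. (g has_derivative g' x) (at x)" "\<And>v. (\<lambda>x. g' x v) \<in> bump_class" by blast
  then show ?case
    by (intro exI[of _ "\<lambda>x v. f' x v + g' x v"]) (auto intro: has_derivative_add bump_class.add)
next
  case (scale f c)
  then obtain f' where "\<And>x. (f has_derivative f' x) (at x)" "\<And>v. (\<lambda>x. f' x v) \<in> bump_class" by blast
  then show ?case
    by (intro exI[of _ "\<lambda>x v. c * f' x v"]) (auto intro: has_derivative_mult_right bump_class.scale)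
qed

lemma bump_class_Ck: "f \<in> bump_class \<Longrightarrow> Ck n f"
proof (induction n arbitrary: f)
  case 0
  then obtain f' where "\<And>x. (f has_derivative f' x) (at x)" using bump_class_derivative by blast
  then show ?case
    by (auto simp: continuous_on_eq_continuous_at intro: has_derivative_continuous)
next
  case (Suc n)
  then obtain f' where "\<And>x. (f has_derivative f' x) (at x)" "\<And>v. (\<lambda>x. f' x v) \<in> bump_class"
    using bump_class_derivative by blast
  then show ?case by (intro Ck_SucI Suc.IH)
qed

lemma test_functionsI:
  assumes "smooth f" "bounded {x. f x \<noteq> 0}"
  shows "f \<in> test_functions"
  using assms by (simp add: test_functions_def compact_closure)

lemma bump_exists:
  obtains \<phi> :: "real ^ 'n \<Rightarrow> real" where "\<phi> \<in> test_functions" "\<And>x. norm x < 1 \<Longrightarrow> \<phi> x > 0"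
proof
  let ?\<phi> = "\<lambda>x::real^'n. flat_fun 0 (1 - x \<bullet> x)"
  have *: "1 - x \<bullet> x > 0 \<longleftrightarrow> norm x < 1" for x :: "real ^ 'n"
    using abs_square_less_1[of "norm x"] by (simp add: dot_square_norm)
  show "?\<phi> \<in> test_functions"
  proof (rule test_functionsI)
    show "smooth ?\<phi>" by (auto simp: smooth_def intro: bump_class_Ck bump_class.base)
    have "{x. ?\<phi> x \<noteq> 0} \<subseteq> ball 0 1"
      using * by (auto simp: flat_fun_def split: if_splits)
    then show "bounded {x. ?\<phi> x \<noteq> 0}" using bounded_ball bounded_subset by blast
  qed
  show "?\<phi> x > 0" if "norm x < 1" for x using that * by (simp add: flat_fun_def)
qed

section \<open>Left invariance of Lebesgue measure\<close>

text \<open>A map whose difference from the identity is \<open>\<eta>\<close>-Lipschitz sends a cube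
  of side \<open>l\<close> into one of side \<open>(1 + \<eta> * N) * l\<close>. Cover
  \<open>E\<close> by dyadic cubes inside \<open>E\<close> with disjoint interiors and add up the
  volumes.\<close>

lemma near_identity_measure_image:
  fixes F :: "real ^ 'n \<Rightarrow> real ^ 'n"
  assumes E: "open E" "E \<subseteq> ball 0 \<delta>" and FE: "F ` E \<in> sets borel" and \<eta>: "\<eta> \<ge> 0"
    and F: "\<And>x y. x \<in> E \<Longrightarrow> y \<in> E \<Longrightarrow> norm (F x - F y - (x - y)) \<le> \<eta> * norm (x - y)"
  shows "emeasure lborel (F ` E)
    \<le> ennreal ((1 + \<eta> * real CARD('n)) ^ CARD('n)) * emeasure lborel E"
proof (cases "E = {}")
  case False
  define N where "N = CARD('n)"
  have \<delta>: "\<delta> > 0" using False E by (metis ball_empty linorder_not_less subset_empty)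
  let ?c = "1 + \<eta> * real N"
  have c: "?c \<ge> 1" using \<eta> by simp
  define a b :: "real ^ 'n" where "a = (\<chi> i. - \<delta>)" and "b = (\<chi> i. \<delta>)"
  have Ea: "E \<subseteq> cbox a b"
  proof
    fix x assume "x \<in> E"
    then have "norm x < \<delta>" using E by auto
    then have "- \<delta> \<le> x $ i \<and> x $ i \<le> \<delta>" for i
      using component_le_norm_cart[of x i] by linarith
    then show "x \<in> cbox a b" by (simp add: mem_box_cart a_def b_def)
  qed
  have ab: "box a b \<noteq> {}"
    using \<delta> by (auto simp: box_ne_empty Basis_vec_def a_def b_def inner_axis)
  \<comment> \<open>Each covering cube contains a point \<open>x\<close> of \<open>E\<close> and
    lies in \<open>g x\<close>, so the choice \<open>g x = E\<close> on \<open>E\<close> keeps the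
    cubes inside \<open>E\<close>.\<close>
  define g where "g x = (if x \<in> E then E else ball x 1)" for x
  have g: "gauge g" using E by (auto simp: gauge_def g_def)
  obtain \<D> where D: "countable \<D>" "\<Union>\<D> \<subseteq> cbox a b"
      "\<And>K. K \<in> \<D> \<Longrightarrow> interior K \<noteq> {} \<and> (\<exists>c d. K = cbox c d)"
      "pairwise (\<lambda>A B. interior A \<inter> interior B = {}) \<D>"
      "\<And>K. K \<in> \<D> \<Longrightarrow> \<exists>x \<in> E \<inter> K. K \<subseteq> g x"
      "\<And>u v. cbox u v \<in> \<D> \<Longrightarrow> \<exists>n. \<forall>i \<in> Basis. v \<bullet> i - u \<bullet> i = (b \<bullet> i - a \<bullet> i) / 2^n"
      "E \<subseteq> \<Union>\<D>"
    using covering_lemma[OF Ea ab g] by blast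
  have KE: "K \<subseteq> E" if "K \<in> \<D>" for K using D(5)[OF that] by (auto simp: g_def split: if_splits)
  have D_ne: "\<D> \<noteq> {}" using D(7) False by auto
  have cube: "\<exists>C. F ` K \<subseteq> C \<and> C \<in> sets borel \<and>
      emeasure lborel C \<le> ennreal (?c ^ N) * emeasure lborel (interior K)" if K: "K \<in> \<D>" for K
  proof -
    obtain u v where uv: "K = cbox u v" using D(3) K by blast
    obtain n where n: "\<And>i. i \<in> Basis \<Longrightarrow> v \<bullet> i - u \<bullet> i = (b \<bullet> i - a \<bullet> i) / 2^n"
      using D(6) K uv by blast
    define l where "l = 2 * \<delta> / 2 ^ n"
    have l: "l > 0" using \<delta> by (simp add: l_def)
    have vu: "v $ i - u $ i = l" for i
      using n[of "axis i 1"] by (simp add: inner_axis a_def b_def l_def)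
    define y where "y = (1/2) *\<^sub>R (u + v)"
    have yi: "y $ i = u $ i + l / 2" "v $ i = u $ i + l" for i
      using vu[of i] by (auto simp: y_def)
    have yK: "y \<in> K" using l by (auto simp: uv mem_box_cart yi)
    \<comment> \<open>Here \<open>y\<close> is the centre of \<open>K\<close>. The coordinates of
      \<open>x - y\<close> are at most \<open>l / 2\<close> and its norm at most
      \<open>N * l / 2\<close>, so \<open>F\<close> adds an error of at most
      \<open>\<eta> * N * l / 2\<close> per coordinate.\<close>
    let ?C = "cbox (F y - (\<chi> i. ?c * l / 2)) (F y + (\<chi> i. ?c * l / 2))"
    have "F ` K \<subseteq> ?C"
    proof clarify
      fix x assume x: "x \<in> K"
      have xy: "\<bar>(x - y) $ i\<bar> \<le> l / 2" for i
      proof -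
        have "u $ i \<le> x $ i" "x $ i \<le> v $ i" using x by (auto simp: uv mem_box_cart)
        then show ?thesis unfolding vector_minus_component yi by linarith
      qed
      have "norm (x - y) \<le> (\<Sum>i\<in>UNIV. \<bar>(x - y) $ i\<bar>)" by (rule norm_le_l1_cart)
      also have "\<dots> \<le> (\<Sum>i\<in>(UNIV::'n set). l / 2)" by (intro sum_mono xy)
      finally have nxy: "norm (x - y) \<le> real N * (l / 2)" by (simp add: N_def)
      have "\<bar>(F x - F y) $ i\<bar> \<le> ?c * l / 2" for i
      proof -
        have "\<bar>(F x - F y - (x - y)) $ i\<bar> \<le> norm (F x - F y - (x - y))" by (rule component_le_norm_cart)
        also have "\<dots> \<le> \<eta> * norm (x - y)" using F x yK KE K by blast
        also have "\<dots> \<le> \<eta> * (real N * (l / 2))" using nxy \<eta> by (rule mult_left_mono)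
        finally have "\<bar>(F x - F y) $ i - (x - y) $ i\<bar> \<le> \<eta> * real N * l / 2" by simp
        moreover have "?c * l / 2 = l / 2 + \<eta> * real N * l / 2" by (simp add: field_simps)
        ultimately show ?thesis using xy[of i] by linarith
      qed
      then have "F y $ i - ?c * l / 2 \<le> F x $ i \<and> F x $ i \<le> F y $ i + ?c * l / 2" for i
        unfolding vector_minus_component abs_le_iff by (smt (verit))
      then show "F x \<in> ?C" by (simp add: mem_box_cart)
    qed
    moreover have "emeasure lborel ?C = ennreal (?c ^ N) * emeasure lborel (interior K)"
    proof -
      have Bas: "(Basis :: (real ^ 'n) set) = range (\<lambda>i. axis i 1)" by (auto simp: Basis_vec_def)
      have prodB: "(\<Prod>b\<in>(Basis :: (real ^ 'n) set). z) = z ^ N" for z :: real by (simp add: N_def)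
      let ?lo = "F y - (\<chi> i. ?c * l / 2)" and ?hi = "F y + (\<chi> i. ?c * l / 2)"
      have side: "?hi \<bullet> b - ?lo \<bullet> b = ?c * l" if "b \<in> Basis" for b
        using that by (auto simp: Bas inner_axis field_simps)
      have "emeasure lborel ?C = ennreal (\<Prod>b\<in>Basis. (?hi - ?lo) \<bullet> b)"
      proof (rule emeasure_lborel_cbox)
        fix b :: "real ^ 'n" assume "b \<in> Basis"
        moreover have "0 \<le> ?c * l" using c l by (intro mult_nonneg_nonneg) auto
        ultimately show "?lo \<bullet> b \<le> ?hi \<bullet> b" using side[of b] by linarith
      qed
      also have "(\<Prod>b\<in>Basis. (?hi - ?lo) \<bullet> b) = (\<Prod>b\<in>(Basis :: (real ^ 'n) set). ?c * l)"
        using side by (intro prod.cong) (auto simp only: inner_diff_left)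
      finally have "emeasure lborel ?C = ennreal (\<Prod>b\<in>(Basis :: (real ^ 'n) set). ?c * l)" .
      have side': "v \<bullet> b - u \<bullet> b = l" if "b \<in> Basis" for b
        using that by (auto simp: Bas inner_axis yi)
      have "emeasure lborel (interior K) = ennreal (\<Prod>b\<in>Basis. (v - u) \<bullet> b)"
        unfolding uv interior_cbox using side' l by (intro emeasure_lborel_box) (smt (verit))
      also have "(\<Prod>b\<in>Basis. (v - u) \<bullet> b) = (\<Prod>b\<in>(Basis :: (real ^ 'n) set). l)"
        using side' by (intro prod.cong) (auto simp only: inner_diff_left)
      finally have "emeasure lborel (interior K) = ennreal (\<Prod>b\<in>(Basis :: (real ^ 'n) set). l)" .
      with \<open>emeasure lborel ?C = ennreal (\<Prod>b\<in>(Basis :: (real ^ 'n) set). ?c * l)\<close>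
      show ?thesis using c l by (simp add: prodB N_def power_mult_distrib ennreal_mult)
    qed
    ultimately show ?thesis by (intro exI[of _ ?C]) auto
  qed
  obtain C where C: "\<And>K. K \<in> \<D> \<Longrightarrow> F ` K \<subseteq> C K" "\<And>K. K \<in> \<D> \<Longrightarrow> C K \<in> sets borel"
      "\<And>K. K \<in> \<D> \<Longrightarrow> emeasure lborel (C K) \<le> ennreal (?c ^ N) * emeasure lborel (interior K)"
    using cube by metis
  define e where "e = from_nat_into \<D>"
  have eD: "e n \<in> \<D>" for n using D_ne by (simp add: e_def from_nat_into)
  \<comment> \<open>\<open>from_nat_into\<close> repeats cubes when \<open>\<D>\<close> is finite.
    Keeping first occurrences and passing to interiors makes the sets \<open>Y n\<close> disjoint;
    the interior of a cube has the volume of the cube.\<close>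
  define new where "new n \<longleftrightarrow> (\<forall>m<n. e m \<noteq> e n)" for n
  define X where "X n = (if new n then C (e n) else {})" for n
  define Y where "Y n = (if new n then interior (e n) else {})" for n
  have FX: "F ` E \<subseteq> (\<Union>n. X n)"
  proof clarify
    fix x assume "x \<in> E"
    then obtain K where K: "K \<in> \<D>" "x \<in> K" using D(7) by auto
    have "\<exists>n. e n = K" using K D(1) by (metis e_def from_nat_into_surj)
    define n where "n = (LEAST n. e n = K)"
    have "e n = K" "new n" using LeastI_ex[OF \<open>\<exists>n. e n = K\<close>] not_less_Least
      by (auto simp: n_def new_def)
    then have "F x \<in> X n" using K C(1) by (auto simp: X_def)
    then show "F x \<in> (\<Union>n. X n)" by blast
  qed
  have "emeasure lborel (F ` E) \<le> emeasure lborel (\<Union>n. X n)"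
    by (rule emeasure_mono[OF FX]) (auto simp: X_def intro!: C eD)
  also have "\<dots> \<le> (\<Sum>n. emeasure lborel (X n))"
    by (rule emeasure_subadditive_countably) (auto simp: X_def intro!: C eD)
  also have "\<dots> \<le> (\<Sum>n. ennreal (?c ^ N) * emeasure lborel (Y n))"
    by (rule suminf_le) (auto simp: X_def Y_def intro!: C eD)
  also have "\<dots> = ennreal (?c ^ N) * (\<Sum>n. emeasure lborel (Y n))" by simp
  also have "(\<Sum>n. emeasure lborel (Y n)) = emeasure lborel (\<Union>n. Y n)"
  proof (rule suminf_emeasure)
    show "range Y \<subseteq> sets lborel" by (auto simp: Y_def)
    have *: "Y m \<inter> Y n = {}" if "m < n" for m n
    proof (cases "new m \<and> new n")
      case True
      then have "e m \<noteq> e n" using that by (auto simp: new_def)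
      then show ?thesis using D(4) eD True by (auto simp: Y_def pairwise_def)
    qed (auto simp: Y_def)
    show "disjoint_family Y"
      unfolding disjoint_family_on_def using * by (metis inf_commute linorder_neqE_nat)
  qed
  also have "emeasure lborel (\<Union>n. Y n) \<le> emeasure lborel E"
  proof (rule emeasure_mono)
    show "(\<Union>n. Y n) \<subseteq> E" using KE eD interior_subset by (fastforce simp: Y_def split: if_splits)
  qed (use E in auto)
  finally show ?thesis by (simp add: N_def mult_left_mono)
qed simp

locale quasi_normed_group = stratified_group G k \<sigma>
  for G :: "(real ^ 'n) monoid" (structure) and k :: nat and \<sigma> :: "'n \<Rightarrow> nat" +
  fixes h :: "real ^ 'n \<Rightarrow> real" and Q :: nat
  assumes quasi_norm: "homogeneous_quasi_norm G \<sigma> h"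
    and Q_def: "Q = homogeneous_dimension k \<sigma>"
begin

declare carrier_UNIV [simp]

abbreviation dil :: "real \<Rightarrow> real ^ 'n \<Rightarrow> real ^ 'n" where
  "dil \<equiv> dilation \<sigma>"

section \<open>The origin, the group law and the dilations\<close>

lemma \<sigma>_bounds: "1 \<le> \<sigma> j" "\<sigma> j \<le> k"
  using layer[of j] by auto

lemma dil_component [simp]: "dil r x $ j = r ^ \<sigma> j * x $ j"
  by (simp add: dilation_def)

lemma dil_mult: "r > 0 \<Longrightarrow> dil r (x \<otimes> y) = dil r x \<otimes> dil r y"
  using dilation_iso[of r] by (auto simp: iso_def hom_def)

text \<open>An automorphism fixes the neutral element, while \<open>dil 2\<close> fixes only the
  origin because every exponent \<open>\<sigma> j\<close> is at least 1.\<close>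

lemma one_eq_0: "\<one> = 0"
proof -
  have "group_hom G G (dil 2)"
    using dilation_iso[of 2] by (simp add: group_hom_def group_hom_axioms_def is_group iso_def)
  then have "dil 2 \<one> = \<one>" by (rule group_hom.hom_one)
  then have "2 ^ \<sigma> j * \<one> $ j = \<one> $ j" for j by (metis dil_component)
  moreover have "(2::real) ^ \<sigma> j \<noteq> 1" for j
  proof -
    have "1 < (2::real) ^ \<sigma> j" using \<sigma>_bounds(1)[of j] by (intro one_less_power) auto
    then show ?thesis by simp
  qed
  ultimately have "\<one> $ j = 0" for j by (metis mult_cancel_right1)
  then show ?thesis by (simp add: vec_eq_iff)
qed

lemma zero_mult [simp]: "0 \<otimes> x = x" and mult_zero [simp]: "x \<otimes> 0 = x"
  using l_one[of x] r_one[of x] by (simp_all add: one_eq_0)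

lemma inv_mult_cancel [simp]: "inv a \<otimes> (a \<otimes> x) = x" and mult_inv_cancel [simp]: "a \<otimes> (inv a \<otimes> x) = x"
  by (simp_all add: m_assoc[symmetric] one_eq_0)

lemma inv_mult_self [simp]: "inv a \<otimes> a = 0" and mult_inv_self [simp]: "a \<otimes> inv a = 0"
  by (simp_all add: one_eq_0)

lemma continuous_mult: "continuous_on UNIV (\<lambda>(x, y). x \<otimes> y)"
  by (rule smooth_imp_continuous[OF smooth_mult])

lemma continuous_on_mult' [continuous_intros]:
  assumes "continuous_on S f" "continuous_on S g"
  shows "continuous_on S (\<lambda>x. f x \<otimes> g x)"
  using continuous_on_compose2[OF continuous_mult continuous_on_Pair[OF assms]] by simp

lemma continuous_on_inv' [continuous_intros]:
  assumes "continuous_on S f"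
  shows "continuous_on S (\<lambda>x. inv (f x))"
  using continuous_on_compose2[OF smooth_imp_continuous[OF smooth_inv] assms] by simp

lemma smooth_translation: "smooth (\<lambda>x. a \<otimes> x)"
  using smooth_compose[OF smooth_mult smooth_Pair] by simp

lemma translation_image: "(\<lambda>x. a \<otimes> x) ` E = (\<lambda>x. inv a \<otimes> x) -` E"
proof (intro equalityI subsetI)
  fix x assume "x \<in> (\<lambda>x. inv a \<otimes> x) -` E"
  then show "x \<in> (\<lambda>x. a \<otimes> x) ` E" by (intro image_eqI[of _ _ "inv a \<otimes> x"]) auto
qed auto

lemma dil_dil: "dil r (dil t x) = dil (r * t) x"
  by (simp add: vec_eq_iff power_mult_distrib)

lemma dil_1 [simp]: "dil 1 x = x"
  by (simp add: vec_eq_iff)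

lemma dil_image: "r > 0 \<Longrightarrow> dil r ` E = dil (1 / r) -` E"
proof (intro equalityI subsetI)
  fix x assume "r > 0" "x \<in> dil (1 / r) -` E"
  then show "x \<in> dil r ` E" by (intro image_eqI[of _ _ "dil (1 / r) x"]) (auto simp: dil_dil)
qed (auto simp: dil_dil)

lemma continuous_dil: "continuous_on S (dil r)"
  unfolding dilation_def by (intro continuous_intros)

lemma norm_dil_le:
  assumes "0 \<le> r" "r \<le> 1"
  shows "norm (dil r x) \<le> r * norm x"
proof -
  have "norm (dil r x) \<le> norm (r *\<^sub>R x)"
  proof (rule norm_le_componentwise_cart)
    fix j
    have "r ^ \<sigma> j \<le> r ^ 1" using assms \<sigma>_bounds(1)[of j] by (intro power_decreasing) auto
    then show "norm (dil r x $ j) \<le> norm ((r *\<^sub>R x) $ j)"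
      using assms by (simp add: abs_mult mult_right_mono)
  qed
  then show ?thesis using assms by simp
qed

text \<open>The Jacobian of \<open>dil r\<close> is the product of the factors
  \<open>r ^ \<sigma> j\<close>; this sum identifies it as \<open>r ^ Q\<close>.\<close>

lemma sum_layers: "(\<Sum>j\<in>UNIV. \<sigma> j) = Q"
proof -
  have "(\<Sum>j\<in>UNIV. \<sigma> j) = (\<Sum>i\<in>{1..k}. \<Sum>j\<in>{j \<in> UNIV. \<sigma> j = i}. \<sigma> j)"
    using layer by (intro sum.group[symmetric]) auto
  also have "\<dots> = (\<Sum>i\<in>{1..k}. i * card {j. \<sigma> j = i})"
    by (intro sum.cong) (auto simp: mult.commute)
  finally show ?thesis by (simp add: Q_def homogeneous_dimension_def)
qed

section \<open>Lebesgue measure under dilations and left translations\<close>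

lemma emeasure_dil_vimage:
  assumes r: "r > 0" and A: "A \<in> sets borel"
  shows "emeasure lborel A = ennreal (r ^ Q) * emeasure lborel (dil r -` A)"
proof -
  have Bas: "(Basis :: (real ^ 'n) set) = range (\<lambda>i. axis i 1)" by (auto simp: Basis_vec_def)
  define c :: "real ^ 'n \<Rightarrow> real" where "c j = dil r j \<bullet> j" for j
  have ca: "c (axis i 1) = r ^ \<sigma> i" for i by (simp add: c_def inner_axis)
  have T: "(\<lambda>x::real^'n. 0 + (\<Sum>j\<in>Basis. (c j * (x \<bullet> j)) *\<^sub>R j)) = dil r"
  proof (rule ext, rule vec_eq_iff[THEN iffD2], rule allI)
    fix x i
    have "(\<Sum>j\<in>Basis. (c j * (x \<bullet> j)) *\<^sub>R j) \<bullet> axis i 1 = c (axis i 1) * (x \<bullet> axis i 1)"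
      by (rule inner_sum_left_Basis) (auto simp: Bas)
    then show "(0 + (\<Sum>j\<in>Basis. (c j * (x \<bullet> j)) *\<^sub>R j)) $ i = dil r x $ i"
      by (simp only: ca inner_axis dil_component add_0_left) simp
  qed
  have "(\<Prod>j\<in>Basis. \<bar>c j\<bar>) = (\<Prod>i\<in>UNIV. \<bar>c (axis i 1)\<bar>)"
    unfolding Bas by (subst prod.reindex) (auto intro!: injI simp: axis_eq_axis)
  also have "\<dots> = r ^ Q" using r by (simp add: ca power_sum sum_layers[symmetric])
  finally have P: "(\<Prod>j\<in>Basis. \<bar>c j\<bar>) = r ^ Q" .
  have "lborel = density (distr lborel borel (dil r)) (\<lambda>_. ennreal (r ^ Q))"
  proof -
    have "c j \<noteq> 0" if "j \<in> Basis" for j using that r by (auto simp: Bas ca)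
    from lborel_affine_euclidean[of c 0, unfolded T P, OF this] show ?thesis by simp
  qed
  then have "emeasure lborel A = emeasure (density (distr lborel borel (dil r)) (\<lambda>_. ennreal (r ^ Q))) A"
    by simp
  also have "\<dots> = ennreal (r ^ Q) * emeasure lborel (dil r -` A)"
    using A borel_measurable_continuous_onI[OF continuous_dil]
    by (simp add: emeasure_density nn_integral_cmult emeasure_distr)
  finally show ?thesis .
qed

lemma emeasure_dil_image:
  assumes r: "r > 0" and A: "A \<in> sets borel"
  shows "emeasure lborel (dil r ` A) = ennreal (r ^ Q) * emeasure lborel A"
proof -
  have m: "dil (1 / r) \<in> borel_measurable borel"
    by (rule borel_measurable_continuous_onI[OF continuous_dil])
  have "dil r ` A \<in> sets borel"
    using measurable_sets[OF m A] r by (simp add: dil_image)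
  moreover have "dil r -` (dil r ` A) = A"
    using r by (auto simp: dil_image dil_dil)
  ultimately show ?thesis using emeasure_dil_vimage[OF r, of "dil r ` A"] by simp
qed

text \<open>Translation by 0 is the identity, so the partial derivative at the origin is the
  identity map. By joint continuity it remains within \<open>\<eta>\<close> of it nearby, and the
  mean value inequality on a ball applies to \<open>b \<otimes> x - x\<close>.\<close>

lemma mult_near_identity:
  assumes \<eta>: "\<eta> > 0"
  obtains \<delta> where "\<delta> > 0"
    "\<And>b x y. norm b < \<delta> \<Longrightarrow> norm x < \<delta> \<Longrightarrow> norm y < \<delta> \<Longrightarrow>
       norm ((b \<otimes> x) - (b \<otimes> y) - (x - y)) \<le> \<eta> * norm (x - y)"
proof -
  define m where "m = (\<lambda>(x, y). x \<otimes> y)"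
  have sm: "smooth m" using smooth_mult by (simp add: m_def)
  define D where "D z w = frechet_derivative m (at z) (0, w)" for z w
  have der: "((\<lambda>y. b \<otimes> y) has_derivative D (b, x)) (at x)" for b x
    using smooth_partial_derivative[OF sm, of b x] by (simp add: m_def D_def[abs_def])
  have lin: "linear (D z)" for z using der[of "fst z" "snd z"] has_derivative_linear by force
  have D0: "D (0, 0) w = w" for w
  proof -
    have "((\<lambda>y. y) has_derivative D (0, 0)) (at 0)" using der[of 0 0] by simp
    then show ?thesis using has_derivative_unique[OF _ has_derivative_ident] by metis
  qed
  \<comment> \<open>Each basis vector receives the share \<open>\<eta> / n\<close>, so that the
    operator norm of the deviation is at most \<open>\<eta>\<close>.\<close>
  define n where "n = real DIM(real ^ 'n)"
  have n: "n > 0" by (simp add: n_def)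
  have "\<exists>d>0. \<forall>z. norm z < d \<longrightarrow> norm (D z i - i) < \<eta> / n" for i :: "real ^ 'n"
  proof -
    have "continuous (at 0) (\<lambda>z. D z i)"
      using smooth_imp_continuous_derivative[OF sm, of "(0, i)"]
      by (simp add: D_def continuous_on_eq_continuous_at zero_prod_def)
    moreover have "\<eta> / n > 0" using \<eta> n by simp
    ultimately obtain d where "d > 0" "\<And>z. dist z 0 < d \<Longrightarrow> dist (D z i) (D 0 i) < \<eta> / n"
      unfolding continuous_at_eps_delta by metis
    then show ?thesis using D0[of i] by (auto simp: dist_norm zero_prod_def)
  qed
  then obtain d where d: "\<And>i. d i > 0" "\<And>i z. norm z < d i \<Longrightarrow> norm (D z i - i) < \<eta> / n" by metis
  define e where "e = Min (d ` (Basis :: (real ^ 'n) set))"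
  have e: "e > 0" using d by (simp add: e_def)
  have eD: "norm (D z i - i) \<le> \<eta> / n" if "norm z < e" "i \<in> Basis" for z i
    using d(2)[of z i] that by (auto simp: e_def)
  have "norm ((b \<otimes> x) - (b \<otimes> y) - (x - y)) \<le> \<eta> * norm (x - y)"
    if b: "norm b < e / 2" and x: "norm x < e / 2" and y: "norm y < e / 2" for b x y
  proof -
    have "norm (((b \<otimes> x) - x) - ((b \<otimes> y) - y)) \<le> \<eta> * norm (x - y)"
    proof (rule differentiable_bound[where f = "\<lambda>x. b \<otimes> x - x" and S = "ball 0 (e / 2)" and f' = "\<lambda>z w. D (b, z) w - w"])
      fix z :: "real ^ 'n" assume z: "z \<in> ball 0 (e / 2)"
      show "((\<lambda>x. (b \<otimes> x) - x) has_derivative (\<lambda>w. D (b, z) w - w)) (at z within ball 0 (e / 2))"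
        by (intro has_derivative_diff has_derivative_at_withinI[OF der] has_derivative_ident)
      have nz: "norm (b, z) < e" using norm_Pair_le[of b z] b z by auto
      show "onorm (\<lambda>w. D (b, z) w - w) \<le> \<eta>"
      proof (rule onorm_le)
        fix w
        have "D (b, z) w - w = (\<Sum>i\<in>Basis. (w \<bullet> i) *\<^sub>R (D (b, z) i - i))"
          using linear_Basis_expansion[OF lin, of "(b, z)" w]
          by (simp add: scaleR_diff_right sum_subtractf euclidean_representation)
        also have "norm \<dots> \<le> (\<Sum>i\<in>(Basis::(real^'n) set). norm w * (\<eta> / n))"
        proof (rule sum_norm_le)
          fix i :: "real ^ 'n" assume i: "i \<in> Basis"
          have "norm ((w \<bullet> i) *\<^sub>R (D (b, z) i - i)) = \<bar>w \<bullet> i\<bar> * norm (D (b, z) i - i)" by simp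
          also have "\<dots> \<le> norm w * (\<eta> / n)"
            by (rule mult_mono[OF Basis_le_norm[OF i] eD[OF nz i]]) auto
          finally show "norm ((w \<bullet> i) *\<^sub>R (D (b, z) i - i)) \<le> norm w * (\<eta> / n)" .
        qed
        also have "\<dots> = \<eta> * norm w" using n by (simp add: n_def)
        finally show "norm (D (b, z) w - w) \<le> \<eta> * norm w" .
      qed
    qed (use x y in auto)
    then show ?thesis by (simp add: algebra_simps)
  qed
  then show ?thesis using that[of "e / 2"] e by simp
qed

lemma translation_measurable [measurable]: "(\<lambda>x. a \<otimes> x) \<in> borel_measurable borel"
  by (intro borel_measurable_continuous_onI continuous_intros)

text \<open>Conjugating with the dilation \<open>dil r\<close> does not change the ratio of the two measures, and it
  replaces the translation by \<open>a\<close> with the translation by \<open>dil r a\<close>, which is close to the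
  identity near the origin when \<open>r\<close> is small.\<close>

lemma emeasure_translation_le:
  assumes E: "open E" "bounded E"
  shows "emeasure lborel ((\<lambda>x. a \<otimes> x) ` E) \<le> emeasure lborel E"
proof -
  define c where "c = measure lborel E"
  have c: "emeasure lborel E = ennreal c"
    unfolding c_def using emeasure_bounded_finite[OF E(2)] by (simp add: emeasure_eq_ennreal_measure)
  have img: "(\<lambda>x. b \<otimes> x) ` A \<in> sets borel" if "A \<in> sets borel" for b A
    using measurable_sets[OF translation_measurable that, of "inv b"] by (simp add: translation_image)
  have bound: "emeasure lborel ((\<lambda>x. a \<otimes> x) ` E) \<le> ennreal ((1 + \<eta> * real CARD('n)) ^ CARD('n) * c)"
    if \<eta>: "\<eta> > 0" for \<eta>
  proof -
    obtain \<delta> where \<delta>: "\<delta> > 0"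
      "\<And>b x y. norm b < \<delta> \<Longrightarrow> norm x < \<delta> \<Longrightarrow> norm y < \<delta> \<Longrightarrow>
         norm ((b \<otimes> x) - (b \<otimes> y) - (x - y)) \<le> \<eta> * norm (x - y)"
      using mult_near_identity[OF \<eta>] by blast
    obtain M where M: "M > 0" "\<And>x. x \<in> E \<Longrightarrow> norm x \<le> M" using E(2) bounded_pos by metis
    \<comment> \<open>Since \<open>norm (dil r x) \<le> r * norm x\<close>, this radius brings the
      whole set \<open>E\<close> and the translating element \<open>a\<close> into the region of
      size \<open>\<delta>\<close> at once.\<close>
    define r where "r = min 1 (\<delta> / (2 * (M + norm a)))"
    have r: "r > 0" "r \<le> 1" using \<delta> M by (auto simp: r_def add_pos_nonneg)
    have rM: "r * (M + norm a) < \<delta>"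
    proof -
      have "r * (M + norm a) \<le> \<delta> / (2 * (M + norm a)) * (M + norm a)"
        using M by (intro mult_right_mono) (auto simp: r_def)
      also have "\<dots> = \<delta> / 2"
      proof -
        have "M + norm a \<noteq> 0" using M norm_ge_zero[of a] by linarith
        moreover have "\<delta> / (2 * z) * z = \<delta> / 2" if "z \<noteq> 0" for z using that by simp
        ultimately show ?thesis by blast
      qed
      finally show ?thesis using \<delta> by simp
    qed
    have small: "norm (dil r x) < \<delta>" if "norm x \<le> M + norm a" for x
      using norm_dil_le[of r x] r rM mult_left_mono[OF that, of r] by linarith
    have op: "open (dil r ` E)"
      using r E(1) continuous_dil[of UNIV "1 / r"] by (simp add: dil_image open_vimage)
    have "emeasure lborel ((\<lambda>x. dil r a \<otimes> x) ` dil r ` E)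
      \<le> ennreal ((1 + \<eta> * real CARD('n)) ^ CARD('n)) * emeasure lborel (dil r ` E)"
    proof (rule near_identity_measure_image[OF op, where \<delta> = \<delta>])
      show sub: "dil r ` E \<subseteq> ball 0 \<delta>"
      proof clarify
        fix x assume "x \<in> E"
        then have "norm x \<le> M + norm a" using M(2)[of x] norm_ge_zero[of a] by linarith
        then show "dil r x \<in> ball 0 \<delta>" using small by simp
      qed
      show "norm ((dil r a \<otimes> x) - (dil r a \<otimes> y) - (x - y)) \<le> \<eta> * norm (x - y)"
        if "x \<in> dil r ` E" "y \<in> dil r ` E" for x y
        using sub that small[of a] M by (intro \<delta>) auto
    qed (use \<eta> op img in auto)
    moreover have "(\<lambda>x. dil r a \<otimes> x) ` dil r ` E = dil r ` (\<lambda>x. a \<otimes> x) ` E"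
      using r by (simp add: image_image dil_mult)
    ultimately have "ennreal (r ^ Q) * emeasure lborel ((\<lambda>x. a \<otimes> x) ` E)
        \<le> ennreal (r ^ Q) * (ennreal ((1 + \<eta> * real CARD('n)) ^ CARD('n)) * ennreal c)"
      using r E img by (simp add: emeasure_dil_image c mult_ac)
    then show ?thesis
      using r \<eta> by (subst (asm) ennreal_mult_le_mult_iff) (auto simp: ennreal_mult c_def)
  qed
  \<comment> \<open>Only the factor in \<open>bound\<close> depends on \<open>\<eta>\<close>;
    letting \<open>\<eta>\<close> tend to 0 removes it.\<close>
  have "(\<lambda>n. ennreal ((1 + inverse (real (Suc n)) * real CARD('n)) ^ CARD('n) * c))
      \<longlonglongrightarrow> ennreal ((1 + 0 * real CARD('n)) ^ CARD('n) * c)"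
    by (intro tendsto_ennrealI tendsto_intros LIMSEQ_inverse_real_of_nat)
  then have "emeasure lborel ((\<lambda>x. a \<otimes> x) ` E) \<le> ennreal ((1 + 0 * real CARD('n)) ^ CARD('n) * c)"
    by (rule LIMSEQ_le_const) (intro exI[of _ 0] allI impI bound, simp)
  then show ?thesis by (simp add: c)
qed

text \<open>The inequality for \<open>a\<close> and for \<open>inv a\<close> together give equality
  on boxes, and their volumes determine Lebesgue measure.\<close>

lemma lborel_left_invariant: "distr lborel borel (\<lambda>x. a \<otimes> x) = lborel"
proof (rule lborel_eqI[symmetric])
  fix l u :: "real ^ 'n" assume lu: "\<And>b. b \<in> Basis \<Longrightarrow> l \<bullet> b \<le> u \<bullet> b"
  let ?E = "(\<lambda>x. inv a \<otimes> x) ` box l u"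
  have E: "?E = (\<lambda>x. a \<otimes> x) -` box l u" by (simp add: translation_image)
  have op: "open ?E" unfolding E by (intro open_vimage continuous_intros) auto
  have "?E \<subseteq> (\<lambda>x. inv a \<otimes> x) ` cbox l u" using box_subset_cbox by blast
  moreover have "compact ((\<lambda>x. inv a \<otimes> x) ` cbox l u)"
    by (intro compact_continuous_image continuous_intros compact_cbox)
  ultimately have bd: "bounded ?E" using bounded_subset compact_imp_bounded by blast
  have "(\<lambda>x. a \<otimes> x) ` ?E = box l u" by (simp add: image_image)
  with emeasure_translation_le[OF op bd, of a]
  have "emeasure lborel (box l u) \<le> emeasure lborel ?E" by simp
  moreover have "emeasure lborel ?E \<le> emeasure lborel (box l u)"
    by (rule emeasure_translation_le) auto
  ultimately have "emeasure lborel ?E = emeasure lborel (box l u)" by simp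
  then show "emeasure (distr lborel borel (\<lambda>x. a \<otimes> x)) (box l u) = ennreal (\<Prod>b\<in>Basis. (u - l) \<bullet> b)"
    using lu by (simp add: emeasure_distr E emeasure_lborel_box)
qed simp

section \<open>The quasi-norm and its balls\<close>

lemma h_continuous: "continuous_on UNIV h" and h_nonneg [simp]: "h x \<ge> 0"
  and h_eq_0 [simp]: "h x = 0 \<longleftrightarrow> x = 0" and h_inv [simp]: "h (inv x) = h x"
  and h_dil: "r > 0 \<Longrightarrow> h (dil r x) = r * h x"
  using quasi_norm by (auto simp: homogeneous_quasi_norm_def)

lemma h_0 [simp]: "h 0 = 0"
  by (simp add: h_eq_0)

lemma h_pos: "x \<noteq> 0 \<Longrightarrow> h x > 0"
  using h_nonneg[of x] h_eq_0[of x] by linarith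

lemma h_continuous_on [continuous_intros]: "continuous_on S f \<Longrightarrow> continuous_on S (\<lambda>x. h (f x))"
  using continuous_on_compose2[OF h_continuous] by simp

lemma h_measurable [measurable]: "h \<in> borel_measurable borel"
  by (rule borel_measurable_continuous_onI[OF h_continuous])

lemma h_diff_commute: "h (inv y \<otimes> x) = h (inv x \<otimes> y)"
  using h_inv[of "inv y \<otimes> x"] by (simp add: inv_mult_group)

text \<open>Some dilation \<open>dil r\<close> carries \<open>z\<close> to the Euclidean unit
  sphere, where \<open>h\<close> is bounded below by compactness. Homogeneity then bounds
  \<open>1 / r\<close> by \<open>h z / m\<close>, and each coordinate of \<open>z\<close> is at most
  a power \<open>(1 / r) ^ \<sigma> i\<close> with positive exponent.\<close>

lemma norm_le_h:
  obtains C where "C > 0" "\<And>z. h z \<le> 1 \<Longrightarrow> norm z \<le> C * h z"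
proof -
  have "sphere (0 :: real ^ 'n) 1 \<noteq> {}" using norm_axis_1 by fastforce
  then obtain w where w: "w \<in> sphere 0 1" "\<And>z. z \<in> sphere 0 1 \<Longrightarrow> h w \<le> h z"
    using continuous_attains_inf[OF compact_sphere, of 0 1 h] continuous_on_subset[OF h_continuous]
    by blast
  \<comment> \<open>The cap at 1 allows every power \<open>(1 / m) ^ \<sigma> i\<close> to be
    replaced by the common bound \<open>(1 / m) ^ k\<close>.\<close>
  define m where "m = min 1 (h w)"
  have m: "m > 0" "m \<le> 1" using w(1) h_pos[of w] by (cases "w = 0", auto simp: m_def)
  define C where "C = real CARD('n) * (1 / m) ^ k"
  have "norm z \<le> C * h z" if z: "h z \<le> 1" for z
  proof (cases "z = 0")
    case False
    then obtain j where j: "z $ j \<noteq> 0" by (auto simp: vec_eq_iff)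
    \<comment> \<open>This factor lifts the \<open>j\<close>-th coordinate to at least 1; being at
      least 1 itself, it can only gain when raised to the power \<open>\<sigma> j\<close>.\<close>
    define r0 where "r0 = max 1 (1 / \<bar>z $ j\<bar>)"
    have "1 \<le> r0 * \<bar>z $ j\<bar>" using j by (simp add: r0_def max_def field_simps)
    also have "\<dots> \<le> r0 ^ \<sigma> j * \<bar>z $ j\<bar>"
      using \<sigma>_bounds(1)[of j] by (intro mult_right_mono self_le_power) (auto simp: r0_def)
    also have "\<dots> = \<bar>dil r0 z $ j\<bar>" by (simp add: abs_mult r0_def)
    also have "\<dots> \<le> norm (dil r0 z)" by (rule component_le_norm_cart)
    finally have up: "1 \<le> norm (dil r0 z)" .
    \<comment> \<open>At parameter 0 the map \<open>dil\<close> collapses everything to the origin,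
      which provides the lower end for the intermediate value theorem.\<close>
    have "(0::real) ^ \<sigma> i = 0" for i using \<sigma>_bounds(1)[of i] by (simp add: power_0_left)
    then have "dil 0 z = 0" by (simp add: vec_eq_iff)
    then have "\<exists>r. 0 \<le> r \<and> r \<le> r0 \<and> norm (dil r z) = 1"
      using up by (intro IVT') (auto simp: r0_def dilation_def intro!: continuous_intros)
    then obtain r where r: "r \<ge> 0" "norm (dil r z) = 1" by blast
    then have r0: "r > 0" using \<open>dil 0 z = 0\<close> by (cases "r = 0") auto
    have "m \<le> r * h z" using w(2)[of "dil r z"] r r0 by (simp add: h_dil m_def)
    then have rh: "1 / r \<le> h z * (1 / m)" using r0 m by (simp add: field_simps)
    have comp: "\<bar>z $ i\<bar> \<le> (1 / m) ^ k * h z" for i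
    proof -
      have "\<bar>z $ i\<bar> = (1 / r) ^ \<sigma> i * \<bar>dil r z $ i\<bar>"
        using r0 by (simp add: abs_mult power_divide)
      also have "\<dots> \<le> (1 / r) ^ \<sigma> i * 1"
        using component_le_norm_cart[of "dil r z" i] r r0 by (intro mult_left_mono) auto
      also have "\<dots> \<le> (h z * (1 / m)) ^ \<sigma> i" using rh r0 by (auto intro!: power_mono)
      also have "\<dots> = h z ^ \<sigma> i * (1 / m) ^ \<sigma> i" by (rule power_mult_distrib)
      also have "\<dots> \<le> h z ^ 1 * (1 / m) ^ k"
        using z m \<sigma>_bounds[of i] by (intro mult_mono power_decreasing power_increasing) auto
      finally show ?thesis by (simp add: mult.commute)
    qed
    have "norm z \<le> (\<Sum>i\<in>UNIV. \<bar>z $ i\<bar>)" by (rule norm_le_l1_cart)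
    also have "\<dots> \<le> (\<Sum>i\<in>(UNIV::'n set). (1 / m) ^ k * h z)" by (intro sum_mono comp)
    finally show ?thesis by (simp add: C_def)
  qed simp
  moreover have "C > 0" using m by (simp add: C_def)
  ultimately show ?thesis using that by blast
qed

lemma compact_h_ball: "r \<le> 1 \<Longrightarrow> compact {z. h z \<le> r}"
proof -
  assume r: "r \<le> 1"
  obtain C where C: "C > 0" "\<And>z. h z \<le> 1 \<Longrightarrow> norm z \<le> C * h z"
    using norm_le_h by blast
  have "norm z \<le> C" if "h z \<le> r" for z
  proof -
    have "h z \<le> 1" using that r by simp
    then show ?thesis using C mult_left_mono[of "h z" 1 C] by (force intro: order_trans[OF C(2)])
  qed
  then have "bounded {z. h z \<le> r}" by (auto simp: bounded_iff)
  moreover have "closed {z. h z \<le> r}" by (intro closed_Collect_le continuous_intros h_continuous)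
  ultimately show ?thesis by (simp add: compact_eq_bounded_closed)
qed

definition unit_vol :: real where
  "unit_vol = measure lborel {z. h z < 1}"

lemma unit_h_ball_emeasure: "emeasure lborel {z. h z < 1} = ennreal unit_vol"
proof -
  have sub: "{z. h z < 1} \<subseteq> {z. h z \<le> 1}" by auto
  have "bounded {z. h z < 1}"
    using compact_h_ball[of 1] compact_imp_bounded bounded_subset[OF _ sub] by blast
  from emeasure_bounded_finite[OF this] show ?thesis
    unfolding unit_vol_def by (simp add: emeasure_eq_ennreal_measure)
qed

lemma unit_vol_pos: "unit_vol > 0"
proof -
  have op: "open {z. h z < 1}" by (intro open_Collect_less continuous_intros h_continuous)
  have "{z. h z < 1} \<noteq> {}" using h_eq_0[of 0] by (metis (mono_tags) empty_iff mem_Collect_eq zero_less_one)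
  then have "emeasure lborel {z. h z < 1} \<noteq> 0"
    using op open_not_negligible[OF op] by (auto simp: negligible_iff_emeasure0)
  then show ?thesis using unit_h_ball_emeasure by (cases "unit_vol \<le> 0") (auto simp: ennreal_neg)
qed

lemma h_ball_emeasure:
  assumes "r > 0"
  shows "emeasure lborel {z. h z < r} = ennreal (unit_vol * r ^ Q)"
proof -
  have "dil r -` {z. h z < r} = {z. h z < 1}" using assms by (auto simp: h_dil)
  then show ?thesis
    using emeasure_dil_vimage[OF assms, of "{z. h z < r}"] assms unit_h_ball_emeasure unit_vol_pos
    by (simp add: ennreal_mult mult.commute)
qed

definition hball :: "real ^ 'n \<Rightarrow> real \<Rightarrow> (real ^ 'n) set" where
  "hball x r = {y. h (inv x \<otimes> y) < r}"

lemma hball_measurable [measurable]: "hball x r \<in> sets borel"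
  unfolding hball_def by measurable

lemma emeasure_hball: "r > 0 \<Longrightarrow> emeasure lborel (hball x r) = ennreal (unit_vol * r ^ Q)"
proof -
  assume r: "r > 0"
  have "emeasure lborel {z. h z < r} = emeasure (distr lborel borel (\<lambda>y. inv x \<otimes> y)) {z. h z < r}"
    by (simp add: lborel_left_invariant)
  also have "\<dots> = emeasure lborel (hball x r)"
    by (subst emeasure_distr) (auto simp: hball_def vimage_def)
  finally show ?thesis using h_ball_emeasure[OF r] by simp
qed

lemma measure_hball: "r > 0 \<Longrightarrow> measure lborel (hball x r) = unit_vol * r ^ Q"
  using emeasure_hball[of r x] unit_vol_pos by (simp add: measure_def)

end

section \<open>The fractional Sobolev space\<close>

locale fractional_sobolev = quasi_normed_group G k \<sigma> h Q
  for G :: "(real ^ 'n) monoid" (structure) and k :: nat and \<sigma> :: "'n \<Rightarrow> nat"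
    and h :: "real ^ 'n \<Rightarrow> real" and Q :: nat +
  fixes s p :: real
  assumes s_pos: "0 < s" and s_less_1: "s < 1" and p_gt_1: "1 < p"
begin

lemma p_pos [simp]: "0 < p" "p \<noteq> 0" "0 \<le> p"
  using p_gt_1 by auto

abbreviation K :: "real ^ 'n \<Rightarrow> real ^ 'n \<Rightarrow> real" where
  "K \<equiv> gagliardo_kernel G h Q s p"

abbreviation L2 :: "((real ^ 'n) \<times> (real ^ 'n)) measure" where
  "L2 \<equiv> lborel \<Otimes>\<^sub>M lborel"

text \<open>Distributing the kernel as a \<open>p\<close>-th root turns the Gagliardo seminorm into
  an ordinary \<open>p\<close>-norm over the product measure, of a quantity linear in
  \<open>u\<close>. All facts on \<open>Lp\<close> then apply to it.\<close>

definition dq :: "(real ^ 'n \<Rightarrow> real) \<Rightarrow> (real ^ 'n) \<times> (real ^ 'n) \<Rightarrow> real" where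
  "dq u = (\<lambda>(x, y). (u x - u y) * K x y powr (1 / p))"

abbreviation W :: "(real ^ 'n \<Rightarrow> real) set" where
  "W \<equiv> sobolev G h Q s p"

abbreviation W0 :: "(real ^ 'n \<Rightarrow> real) set" where
  "W0 \<equiv> sobolev0 G h Q s p"

definition N :: "(real ^ 'n \<Rightarrow> real) \<Rightarrow> real" where
  "N u = (LINT x|lborel. \<bar>u x\<bar> powr p) + gagliardo_p G h Q s p u"

lemma K_nonneg [simp]: "K x y \<ge> 0"
  by (simp add: gagliardo_kernel_def)

lemma K_translate: "K (a \<otimes> x) (a \<otimes> y) = K x y"
proof -
  have "inv (a \<otimes> y) \<otimes> (a \<otimes> x) = inv y \<otimes> x"
    by (simp add: inv_mult_group m_assoc)
  then show ?thesis by (simp add: gagliardo_kernel_def)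
qed

lemma pair_h_measurable: "(\<lambda>z. h (inv (snd z) \<otimes> fst z)) \<in> borel_measurable L2"
proof -
  have "(\<lambda>z. h (inv (snd z) \<otimes> fst z)) \<in> borel_measurable (borel :: ((real ^ 'n) \<times> (real ^ 'n)) measure)"
    by (intro borel_measurable_continuous_onI continuous_intros)
  then show ?thesis by (simp add: lborel_prod)
qed

lemma pair_K_measurable [measurable]: "(\<lambda>z. K (fst z) (snd z)) \<in> borel_measurable L2"
  unfolding gagliardo_kernel_def using pair_h_measurable by measurable

lemma dq_measurable:
  assumes [measurable]: "u \<in> borel_measurable borel"
  shows "dq u \<in> borel_measurable L2"
  unfolding dq_def case_prod_beta by measurable

lemma dq_powr: "\<bar>dq u z\<bar> powr p = (case z of (x, y) \<Rightarrow> \<bar>u x - u y\<bar> powr p * K x y)"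
  by (auto simp: dq_def abs_mult powr_mult powr_powr split: prod.split)

lemma dq_add: "dq (\<lambda>x. u x + v x) = (\<lambda>z. dq u z + dq v z)"
  and dq_diff: "dq (\<lambda>x. u x - v x) = (\<lambda>z. dq u z - dq v z)"
  and dq_scale: "dq (\<lambda>x. c * u x) = (\<lambda>z. c * dq u z)"
  by (auto simp: dq_def algebra_simps)

lemma gagliardo_dq: "gagliardo_p G h Q s p u = (LINT z|L2. \<bar>dq u z\<bar> powr p)"
  by (simp add: gagliardo_p_def dq_powr)

lemma W_iff: "u \<in> W \<longleftrightarrow> Lp lborel p u \<and> Lp L2 p (dq u)"
  using dq_measurable[of u] by (auto simp: sobolev_def Lp_def dq_powr)

lemma W_measurable: "u \<in> W \<Longrightarrow> u \<in> borel_measurable borel"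
  by (simp add: sobolev_def)

lemma N_dq: "N u = (LINT x|lborel. \<bar>u x\<bar> powr p) + (LINT z|L2. \<bar>dq u z\<bar> powr p)"
  by (simp add: N_def gagliardo_dq)

lemma N_nonneg: "N u \<ge> 0"
  by (simp add: N_dq)

lemma Lp_le_N: "(LINT x|lborel. \<bar>u x\<bar> powr p) \<le> N u" and gagliardo_le_N: "gagliardo_p G h Q s p u \<le> N u"
  by (simp_all add: N_dq gagliardo_dq)

lemma W_scale: "u \<in> W \<Longrightarrow> (\<lambda>x. c * u x) \<in> W"
  by (simp add: W_iff dq_scale Lp_scale)

lemma N_scale: "N (\<lambda>x. c * u x) = \<bar>c\<bar> powr p * N u"
  by (simp only: N_dq dq_scale integral_powr_scale distrib_left)

lemma W_add:
  assumes "u \<in> W" "v \<in> W"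
  shows "(\<lambda>x. u x + v x) \<in> W" and "N (\<lambda>x. u x + v x) \<le> 2 powr p * (N u + N v)"
proof -
  show "(\<lambda>x. u x + v x) \<in> W" using assms by (simp add: W_iff dq_add Lp_add)
  have "(LINT x|lborel. \<bar>u x + v x\<bar> powr p)
      \<le> 2 powr p * ((LINT x|lborel. \<bar>u x\<bar> powr p) + (LINT x|lborel. \<bar>v x\<bar> powr p))"
    using assms by (intro Lp_add) (auto simp: W_iff)
  moreover have "(LINT z|L2. \<bar>dq u z + dq v z\<bar> powr p)
      \<le> 2 powr p * ((LINT z|L2. \<bar>dq u z\<bar> powr p) + (LINT z|L2. \<bar>dq v z\<bar> powr p))"
    using assms by (intro Lp_add) (auto simp: W_iff)
  ultimately show "N (\<lambda>x. u x + v x) \<le> 2 powr p * (N u + N v)"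
    unfolding N_dq dq_add distrib_left by linarith
qed

lemma W_diff:
  assumes "u \<in> W" "v \<in> W"
  shows "(\<lambda>x. u x - v x) \<in> W" and "N (\<lambda>x. u x - v x) \<le> 2 powr p * (N u + N v)"
  using W_add[OF assms(1) W_scale[OF assms(2), of "-1"]] N_scale[of "-1" v] by simp_all

text \<open>A null set \<open>A\<close> of bad points only spoils
  \<open>A \<times> UNIV \<union> UNIV \<times> A\<close>, which is null for the product
  measure.\<close>

lemma AE_pair_conv:
  assumes "AE x in lborel. (\<lambda>n. f n x) \<longlonglongrightarrow> g x"
  shows "AE z in L2. (\<lambda>n. dq (f n) z) \<longlonglongrightarrow> dq g z"
proof -
  obtain A where A: "{x. \<not> (\<lambda>n. f n x) \<longlonglongrightarrow> g x} \<subseteq> A" "A \<in> null_sets lborel"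
    using assms by (auto elim!: AE_E simp: null_sets_def)
  have "A \<times> UNIV \<union> UNIV \<times> A \<in> null_sets L2"
    using A(2) by (intro null_sets.Un lborel_pair.times_in_null_sets1 lborel_pair.times_in_null_sets2) auto
  then show ?thesis
  proof (rule AE_I')
    show "{z \<in> space L2. \<not> (\<lambda>n. dq (f n) z) \<longlonglongrightarrow> dq g z} \<subseteq> A \<times> UNIV \<union> UNIV \<times> A"
    proof (rule subsetI, rule ccontr)
      fix z assume z: "z \<in> {z \<in> space L2. \<not> (\<lambda>n. dq (f n) z) \<longlonglongrightarrow> dq g z}"
        "z \<notin> A \<times> UNIV \<union> UNIV \<times> A"
      then have "(\<lambda>n. f n (fst z)) \<longlonglongrightarrow> g (fst z)" "(\<lambda>n. f n (snd z)) \<longlonglongrightarrow> g (snd z)"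
        using A(1) by (auto simp: mem_Times_iff)
      then have "(\<lambda>n. dq (f n) z) \<longlonglongrightarrow> dq g z"
        unfolding dq_def case_prod_beta by (intro tendsto_intros)
      then show False using z by simp
    qed
  qed
qed

lemma N_Fatou:
  assumes u: "\<And>n. u n \<in> W" and B: "\<And>n. N (u n) \<le> B"
    and v: "v \<in> borel_measurable borel" and lim: "AE x in lborel. (\<lambda>n. u n x) \<longlonglongrightarrow> v x"
  shows "v \<in> W"
proof -
  have "Lp lborel p v"
    by (rule Lp_Fatou(1)[OF p_pos(1), where f = u and B = B])
      (use u v lim B Lp_le_N in \<open>auto simp: W_iff intro: order_trans\<close>)
  moreover have "Lp L2 p (dq v)"
    by (rule Lp_Fatou(1)[OF p_pos(1), where f = "\<lambda>n. dq (u n)" and B = B])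
      (use u dq_measurable[OF v] AE_pair_conv[OF lim] order_trans[OF gagliardo_le_N B]
        in \<open>auto simp: W_iff gagliardo_dq\<close>)
  ultimately show ?thesis by (simp add: W_iff)
qed

lemma N_brezis_lieb:
  assumes u: "\<And>n. u n \<in> W" and B: "\<And>n. N (u n) \<le> B"
    and v: "v \<in> borel_measurable borel" and lim: "AE x in lborel. (\<lambda>n. u n x) \<longlonglongrightarrow> v x"
  shows "(\<lambda>n. N (u n) - N (\<lambda>x. u n x - v x)) \<longlonglongrightarrow> N v"
proof -
  have 1: "(\<lambda>n. (LINT x|lborel. \<bar>u n x\<bar> powr p) - (LINT x|lborel. \<bar>u n x - v x\<bar> powr p))
      \<longlonglongrightarrow> (LINT x|lborel. \<bar>v x\<bar> powr p)"
    by (rule brezis_lieb[OF p_gt_1, where B = B])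
      (use u v lim B Lp_le_N in \<open>auto simp: W_iff intro: order_trans\<close>)
  have 2: "(\<lambda>n. (LINT z|L2. \<bar>dq (u n) z\<bar> powr p) - (LINT z|L2. \<bar>dq (u n) z - dq v z\<bar> powr p))
      \<longlonglongrightarrow> (LINT z|L2. \<bar>dq v z\<bar> powr p)"
    by (rule brezis_lieb[OF p_gt_1, where B = B])
      (use u dq_measurable[OF v] AE_pair_conv[OF lim] order_trans[OF gagliardo_le_N B]
        in \<open>auto simp: W_iff gagliardo_dq\<close>)
  show ?thesis
    using tendsto_add[OF 1 2] by (simp add: N_dq dq_diff algebra_simps)
qed

section \<open>The closure of the test functions\<close>

text \<open>Trading \<open>\<epsilon>\<close> for \<open>\<epsilon> powr p\<close> removes the root
  from the norm, so closure arguments can use \<open>N\<close>, which is additive over its two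
  integrals.\<close>

lemma W0_iff: "u \<in> W0 \<longleftrightarrow> u \<in> W \<and> (\<forall>\<epsilon>>0. \<exists>\<phi>\<in>test_functions \<inter> W. N (\<lambda>x. u x - \<phi> x) < \<epsilon>)"
proof -
  have norm: "sobolev_norm G h Q s p v = N v powr (1 / p)" for v
    by (simp add: sobolev_norm_def N_def)
  have 1: "N v powr (1 / p) < \<epsilon> \<longleftrightarrow> N v < \<epsilon> powr p" if "\<epsilon> > 0" for v \<epsilon>
  proof -
    have "N v powr (1 / p) < \<epsilon> \<longleftrightarrow> (N v powr (1 / p)) powr p < \<epsilon> powr p"
      using powr_mono2[of p \<epsilon> "N v powr (1 / p)"] powr_less_mono2[of p "N v powr (1 / p)" \<epsilon>] that
        p_pos(1) by (smt (verit) powr_ge_zero)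
    then show ?thesis using N_nonneg[of v] by (simp add: powr_powr)
  qed
  have "(\<forall>\<epsilon>>0. \<exists>\<phi>\<in>test_functions \<inter> W. N (\<lambda>x. u x - \<phi> x) powr (1 / p) < \<epsilon>) \<longleftrightarrow>
        (\<forall>\<epsilon>>0. \<exists>\<phi>\<in>test_functions \<inter> W. N (\<lambda>x. u x - \<phi> x) < \<epsilon>)" (is "?L \<longleftrightarrow> ?R")
  proof
    assume L: ?L
    show ?R
    proof (intro allI impI)
      fix \<epsilon> :: real assume e: "\<epsilon> > 0"
      then have "(\<epsilon> powr (1 / p)) powr p = \<epsilon>" by (simp add: powr_powr)
      with L[rule_format, of "\<epsilon> powr (1 / p)"] e 1[of "\<epsilon> powr (1 / p)"]
      show "\<exists>\<phi>\<in>test_functions \<inter> W. N (\<lambda>x. u x - \<phi> x) < \<epsilon>" by auto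
    qed
  next
    assume R: ?R
    show ?L
    proof (intro allI impI)
      fix \<epsilon> :: real assume e: "\<epsilon> > 0"
      with R[rule_format, of "\<epsilon> powr p"] 1[of \<epsilon>]
      show "\<exists>\<phi>\<in>test_functions \<inter> W. N (\<lambda>x. u x - \<phi> x) powr (1 / p) < \<epsilon>" by auto
    qed
  qed
  then show ?thesis by (auto simp: sobolev0_def norm)
qed

lemma W0_imp_W: "u \<in> W0 \<Longrightarrow> u \<in> W"
  by (simp add: sobolev0_def)

lemma test_add: "\<phi> \<in> test_functions \<Longrightarrow> \<psi> \<in> test_functions \<Longrightarrow> (\<lambda>x. \<phi> x + \<psi> x) \<in> test_functions"
proof (rule test_functionsI)
  assume a: "\<phi> \<in> test_functions" "\<psi> \<in> test_functions"
  then show "smooth (\<lambda>x. \<phi> x + \<psi> x)" by (simp add: test_functions_def smooth_add)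
  have "bounded ({x. \<phi> x \<noteq> 0} \<union> {x. \<psi> x \<noteq> 0})" using a by (simp add: test_functions_def compact_closure)
  then show "bounded {x. \<phi> x + \<psi> x \<noteq> 0}" by (rule bounded_subset) auto
qed

lemma test_scale: "\<phi> \<in> test_functions \<Longrightarrow> (\<lambda>x. c * \<phi> x) \<in> test_functions"
proof (rule test_functionsI)
  assume a: "\<phi> \<in> test_functions"
  then show "smooth (\<lambda>x. c * \<phi> x)" using smooth_scale[of \<phi> c] by (simp add: test_functions_def)
  have "bounded {x. \<phi> x \<noteq> 0}" using a by (simp add: test_functions_def compact_closure)
  then show "bounded {x. c * \<phi> x \<noteq> 0}" by (rule bounded_subset) auto
qed

lemma test_translate: "\<phi> \<in> test_functions \<Longrightarrow> (\<lambda>x. \<phi> (a \<otimes> x)) \<in> test_functions"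
proof (rule test_functionsI)
  assume a: "\<phi> \<in> test_functions"
  then show "smooth (\<lambda>x. \<phi> (a \<otimes> x))"
    by (auto simp: test_functions_def intro: smooth_compose smooth_translation)
  have "compact ((\<lambda>x. inv a \<otimes> x) ` closure {x. \<phi> x \<noteq> 0})"
    using a by (intro compact_continuous_image continuous_intros) (simp add: test_functions_def)
  moreover have "{x. \<phi> (a \<otimes> x) \<noteq> 0} \<subseteq> (\<lambda>x. inv a \<otimes> x) ` closure {x. \<phi> x \<noteq> 0}"
  proof
    fix x assume "x \<in> {x. \<phi> (a \<otimes> x) \<noteq> 0}"
    then have "a \<otimes> x \<in> closure {x. \<phi> x \<noteq> 0}" by (intro subsetD[OF closure_subset]) simp
    then show "x \<in> (\<lambda>x. inv a \<otimes> x) ` closure {x. \<phi> x \<noteq> 0}"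
      by (intro image_eqI[of _ _ "a \<otimes> x"]) auto
  qed
  ultimately show "bounded {x. \<phi> (a \<otimes> x) \<noteq> 0}" using bounded_subset compact_imp_bounded by blast
qed

lemma W0_scale:
  assumes u: "u \<in> W0"
  shows "(\<lambda>x. c * u x) \<in> W0"
  unfolding W0_iff
proof (intro conjI allI impI)
  show "(\<lambda>x. c * u x) \<in> W" by (intro W_scale W0_imp_W u)
  fix \<epsilon> :: real assume e: "\<epsilon> > 0"
  define d where "d = \<epsilon> / (\<bar>c\<bar> powr p + 1)"
  have d: "d > 0" using e by (simp add: d_def add_nonneg_pos)
  then obtain \<phi> where \<phi>: "\<phi> \<in> test_functions \<inter> W" "N (\<lambda>x. u x - \<phi> x) < d"
    using u unfolding W0_iff by blast
  have "N (\<lambda>x. c * u x - c * \<phi> x) = \<bar>c\<bar> powr p * N (\<lambda>x. u x - \<phi> x)"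
    unfolding right_diff_distrib[symmetric] by (rule N_scale)
  also have "\<dots> \<le> \<bar>c\<bar> powr p * d" using \<phi> by (intro mult_left_mono) auto
  also have "\<dots> < (\<bar>c\<bar> powr p + 1) * d" using d by simp
  also have "\<dots> = \<epsilon>"
  proof -
    have "\<bar>c\<bar> powr p + 1 > 0" by (simp add: add_nonneg_pos)
    then show ?thesis by (simp add: d_def)
  qed
  finally show "\<exists>\<psi>\<in>test_functions \<inter> W. N (\<lambda>x. c * u x - \<psi> x) < \<epsilon>"
    using \<phi> test_scale[of \<phi> c] W_scale[of \<phi> c] by (intro bexI[of _ "\<lambda>x. c * \<phi> x"]) auto
qed

lemma W0_add:
  assumes u: "u \<in> W0" and v: "v \<in> W0"
  shows "(\<lambda>x. u x + v x) \<in> W0"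
  unfolding W0_iff
proof (intro conjI allI impI)
  show "(\<lambda>x. u x + v x) \<in> W" by (intro W_add W0_imp_W u v)
  fix \<epsilon> :: real assume e: "\<epsilon> > 0"
  define d where "d = \<epsilon> / (2 * 2 powr p)"
  have d: "d > 0" using e by (simp add: d_def)
  obtain \<phi> where \<phi>: "\<phi> \<in> test_functions \<inter> W" "N (\<lambda>x. u x - \<phi> x) < d"
    using u d unfolding W0_iff by blast
  obtain \<psi> where \<psi>: "\<psi> \<in> test_functions \<inter> W" "N (\<lambda>x. v x - \<psi> x) < d"
    using v d unfolding W0_iff by blast
  have "N (\<lambda>x. (u x - \<phi> x) + (v x - \<psi> x)) \<le> 2 powr p * (N (\<lambda>x. u x - \<phi> x) + N (\<lambda>x. v x - \<psi> x))"
    using \<phi> \<psi> u v by (intro W_add W_diff) (auto dest: W0_imp_W)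
  also have "\<dots> < 2 powr p * (d + d)" using \<phi> \<psi> by (intro mult_strict_left_mono) auto
  also have "\<dots> = \<epsilon>" by (simp add: d_def)
  finally have "N (\<lambda>x. u x + v x - (\<phi> x + \<psi> x)) < \<epsilon>" by (simp add: algebra_simps)
  moreover have "(\<lambda>x. \<phi> x + \<psi> x) \<in> test_functions \<inter> W" using \<phi> \<psi> test_add[of \<phi> \<psi>] W_add[of \<phi> \<psi>] by simp
  ultimately show "\<exists>\<psi>\<in>test_functions \<inter> W. N (\<lambda>x. u x + v x - \<psi> x) < \<epsilon>"
    by (intro bexI[of _ "\<lambda>x. \<phi> x + \<psi> x"]) auto
qed

lemma W0_diff: "u \<in> W0 \<Longrightarrow> v \<in> W0 \<Longrightarrow> (\<lambda>x. u x - v x) \<in> W0"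
  using W0_add[of u "\<lambda>x. (-1) * v x"] W0_scale[of v "-1"] by simp

text \<open>Approximate twice, first in \<open>W0\<close> and then by a test function;
  \<open>d\<close> absorbs the constant \<open>2 powr p\<close> of the triangle inequality.\<close>

lemma W0_closed:
  assumes u: "u \<in> W" and ap: "\<And>\<epsilon>. \<epsilon> > 0 \<Longrightarrow> \<exists>v\<in>W0. N (\<lambda>x. u x - v x) < \<epsilon>"
  shows "u \<in> W0"
  unfolding W0_iff
proof (intro conjI allI impI u)
  fix \<epsilon> :: real assume e: "\<epsilon> > 0"
  define d where "d = \<epsilon> / (2 * 2 powr p)"
  have d: "d > 0" using e by (simp add: d_def)
  obtain v where v: "v \<in> W0" "N (\<lambda>x. u x - v x) < d" using ap d by blast
  obtain \<phi> where \<phi>: "\<phi> \<in> test_functions \<inter> W" "N (\<lambda>x. v x - \<phi> x) < d"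
    using v d unfolding W0_iff by blast
  have "N (\<lambda>x. (u x - v x) + (v x - \<phi> x)) \<le> 2 powr p * (N (\<lambda>x. u x - v x) + N (\<lambda>x. v x - \<phi> x))"
    using \<phi> u v by (intro W_add W_diff) (auto dest: W0_imp_W)
  also have "\<dots> < 2 powr p * (d + d)" using \<phi> v by (intro mult_strict_left_mono) auto
  also have "\<dots> = \<epsilon>" by (simp add: d_def)
  finally have "N (\<lambda>x. u x - \<phi> x) < \<epsilon>" by simp
  then show "\<exists>\<psi>\<in>test_functions \<inter> W. N (\<lambda>x. u x - \<psi> x) < \<epsilon>"
    using \<phi> by (intro bexI[of _ \<phi>]) auto
qed

text \<open>Weak closedness without duality: if \<open>d\<close> is the distance of the limit from the subspace,
  then testing with \<open>w + t (u\<^sub>n - w)\<close> and the Brezis-Lieb lemma give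
  \<open>d \<le> (1 - t)\<^sup>p d + t\<^sup>p B\<close>, and \<open>t \<rightarrow> 0\<close> forces \<open>d = 0\<close>.\<close>

lemma W0_limit:
  assumes u: "\<And>n. u n \<in> W0" and B: "\<And>n. N (u n) \<le> B"
    and v: "v \<in> borel_measurable borel" and lim: "AE x in lborel. (\<lambda>n. u n x) \<longlonglongrightarrow> v x"
  shows "v \<in> W0"
proof -
  have uW: "u n \<in> W" for n using u W0_imp_W by blast
  have vW: "v \<in> W" by (rule N_Fatou[OF uW B v lim])
  define B' where "B' = 2 powr p * (B + N v)"
  have B': "N (\<lambda>x. u n x - v x) \<le> B'" for n
  proof -
    have "2 powr p * (N (u n) + N v) \<le> B'"
      unfolding B'_def by (intro mult_left_mono add_right_mono B) simp
    with W_diff(2)[OF uW[of n] vW] show ?thesis by linarith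
  qed
  define A where "A = (\<lambda>w. N (\<lambda>x. v x - w x)) ` W0"
  define d where "d = Inf A"
  have bdd: "bdd_below A" by (rule bdd_belowI[of _ 0]) (auto simp: A_def N_nonneg)
  have ne: "A \<noteq> {}" using u by (auto simp: A_def)
  have d0: "d \<ge> 0" unfolding d_def by (rule cInf_greatest[OF ne]) (auto simp: A_def N_nonneg)
  have dle: "d \<le> N (\<lambda>x. v x - w x)" if "w \<in> W0" for w
    unfolding d_def by (rule cInf_lower[OF _ bdd]) (use that in \<open>auto simp: A_def\<close>)
  have step: "d \<le> (1 - t) powr p * N (\<lambda>x. v x - w x) + t powr p * B'"
    if t: "0 < t" "t < 1" and w: "w \<in> W0" for t w
  proof -
    define f where "f = (\<lambda>x. (1 - t) * (v x - w x))"
    \<comment> \<open>This is \<open>v\<close> minus the competitor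
      \<open>w + t * (u n - w)\<close>, rewritten so that its limit \<open>f\<close> almost
      everywhere and its deviation \<open>- t * (u n - v)\<close> from it can be read off.\<close>
    define g where "g n = (\<lambda>x. f x - t * (u n x - v x))" for n
    have wW: "w \<in> W" using w W0_imp_W by blast
    have fW: "f \<in> W" unfolding f_def by (intro W_scale W_diff vW wW)
    have gW: "g n \<in> W" for n unfolding g_def by (intro W_diff W_scale fW uW vW)
    have Nt: "N (\<lambda>x. t * (u n x - v x)) \<le> t powr p * B'" for n
      using t B' by (subst N_scale) (simp add: mult_left_mono)
    have gB: "N (g n) \<le> 2 powr p * (N f + t powr p * B')" for n
    proof -
      have "N (g n) \<le> 2 powr p * (N f + N (\<lambda>x. t * (u n x - v x)))"
        unfolding g_def by (intro W_diff W_scale fW uW vW)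
      also have "\<dots> \<le> 2 powr p * (N f + t powr p * B')" using Nt by (intro mult_left_mono) auto
      finally show ?thesis .
    qed
    have glim: "AE x in lborel. (\<lambda>n. g n x) \<longlonglongrightarrow> f x"
      using lim
    proof eventually_elim
      case (elim x)
      then have "(\<lambda>n. g n x) \<longlonglongrightarrow> f x - t * (v x - v x)"
        unfolding g_def by (intro tendsto_intros)
      then show ?case by simp
    qed
    have BL: "(\<lambda>n. N (g n) - N (\<lambda>x. g n x - f x)) \<longlonglongrightarrow> N f"
      by (rule N_brezis_lieb[OF gW gB W_measurable[OF fW] glim])
    have "d - t powr p * B' \<le> N (g n) - N (\<lambda>x. g n x - f x)" for n
    proof -
      have "(\<lambda>x. w x + t * (u n x - w x)) \<in> W0"
        by (intro W0_add W0_scale W0_diff u w)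
      then have "d \<le> N (\<lambda>x. v x - (w x + t * (u n x - w x)))" by (rule dle)
      also have "(\<lambda>x. v x - (w x + t * (u n x - w x))) = g n"
        by (rule ext) (simp add: g_def f_def algebra_simps)
      finally have 1: "d \<le> N (g n)" .
      have "(\<lambda>x. g n x - f x) = (\<lambda>x. (-1) * (t * (u n x - v x)))" by (auto simp: g_def)
      then have "N (\<lambda>x. g n x - f x) = N (\<lambda>x. t * (u n x - v x))"
        using N_scale[of "-1" "\<lambda>x. t * (u n x - v x)"] by simp
      then show ?thesis using 1 Nt[of n] by linarith
    qed
    then have "d - t powr p * B' \<le> N f"
      using LIMSEQ_le_const[OF BL] by blast
    moreover have "N f = (1 - t) powr p * N (\<lambda>x. v x - w x)"
      unfolding f_def using t by (subst N_scale) simp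
    ultimately show ?thesis by linarith
  qed
  \<comment> \<open>The competitor \<open>w\<close> was arbitrary: dividing by
    \<open>(1 - t) powr p\<close> isolates its distance, and the infimum over \<open>w\<close> puts
    \<open>d\<close> on both sides.\<close>
  have step2: "(1 - (1 - t) powr p) * d \<le> t powr p * B'" if t: "0 < t" "t < 1" for t
  proof -
    have "(d - t powr p * B') / (1 - t) powr p \<le> a" if "a \<in> A" for a
      using that step[OF t] t by (auto simp: A_def field_simps)
    then have "(d - t powr p * B') / (1 - t) powr p \<le> d"
      unfolding d_def by (intro cInf_greatest ne) (auto simp: d_def[symmetric])
    then show ?thesis using t by (simp add: field_simps)
  qed
  have "d \<le> 0"
  proof -
    \<comment> \<open>From \<open>p > 1\<close> follows \<open>(1 - t) powr p \<le> 1 - t\<close>,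
      hence the left factor in \<open>step2\<close> is at least \<open>t\<close>. After division by
      \<open>t\<close> the positive power \<open>t powr (p - 1)\<close> remains.\<close>
    have up: "d \<le> t powr (p - 1) * B'" if t: "0 < t" "t < 1" for t
    proof -
      have "(1 - t) powr p \<le> (1 - t) powr 1" using t p_gt_1 by (intro powr_mono') auto
      then have "t * d \<le> (1 - (1 - t) powr p) * d" using t d0 by (intro mult_right_mono) auto
      also have "\<dots> \<le> t powr p * B'" by (rule step2[OF t])
      also have "\<dots> = t * (t powr (p - 1) * B')" using mult_powr_pred[of t p] t by (simp add: mult.commute)
      finally show ?thesis using t by simp
    qed
    have "((\<lambda>t. t powr (p - 1) * B') \<longlongrightarrow> 0 powr (p - 1) * B') (at_right 0)"
      using p_gt_1 by (intro tendsto_intros tendsto_powr') (auto simp: eventually_at_right_less intro: eventually_mono[OF eventually_at_right_less])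
    then have "((\<lambda>t. t powr (p - 1) * B') \<longlongrightarrow> 0) (at_right 0)" by simp
    moreover have "\<forall>\<^sub>F t in at_right 0. d \<le> t powr (p - 1) * B'"
      by (rule eventually_at_rightI[of 0 1]) (auto intro: up)
    ultimately show ?thesis by (rule tendsto_lowerbound) simp
  qed
  show ?thesis
  proof (rule W0_closed[OF vW])
    fix \<epsilon> :: real assume "\<epsilon> > 0"
    then have "Inf A < \<epsilon>" using \<open>d \<le> 0\<close> by (simp add: d_def)
    then show "\<exists>w\<in>W0. N (\<lambda>x. v x - w x) < \<epsilon>"
      using cInf_lessD[OF ne] by (auto simp: A_def)
  qed
qed

section \<open>Translation invariance\<close>

lemma translate_integrable:
  fixes f :: "real ^ 'n \<Rightarrow> real"
  assumes [measurable]: "f \<in> borel_measurable borel"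
  shows "integrable lborel (\<lambda>x. f (a \<otimes> x)) \<longleftrightarrow> integrable lborel f"
    and "(LINT x|lborel. f (a \<otimes> x)) = (LINT x|lborel. f x)"
proof -
  have "integrable lborel f \<longleftrightarrow> integrable (distr lborel borel (\<lambda>x. a \<otimes> x)) f"
    by (simp add: lborel_left_invariant)
  also have "\<dots> \<longleftrightarrow> integrable lborel (\<lambda>x. f (a \<otimes> x))"
    by (subst integrable_distr_eq) auto
  finally show "integrable lborel (\<lambda>x. f (a \<otimes> x)) \<longleftrightarrow> integrable lborel f" by simp
  have "(LINT x|lborel. f x) = (LINT x|distr lborel borel (\<lambda>x. a \<otimes> x). f x)"
    by (simp add: lborel_left_invariant)
  also have "\<dots> = (LINT x|lborel. f (a \<otimes> x))"
    by (subst integral_distr) auto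
  finally show "(LINT x|lborel. f (a \<otimes> x)) = (LINT x|lborel. f x)" by simp
qed

lemma translate_nn_integral:
  assumes [measurable]: "f \<in> borel_measurable borel"
  shows "(\<integral>\<^sup>+x. f (a \<otimes> x) \<partial>lborel) = (\<integral>\<^sup>+x. f x \<partial>lborel)"
proof -
  have "(\<integral>\<^sup>+x. f x \<partial>lborel) = (\<integral>\<^sup>+x. f x \<partial>distr lborel borel (\<lambda>x. a \<otimes> x))"
    by (simp add: lborel_left_invariant)
  also have "\<dots> = (\<integral>\<^sup>+x. f (a \<otimes> x) \<partial>lborel)"
    by (subst nn_integral_distr) auto
  finally show ?thesis by simp
qed

lemma pair_left_invariant: "distr L2 L2 (\<lambda>(x, y). (a \<otimes> x, a \<otimes> y)) = L2"
proof -
  have d: "distr lborel lborel (\<lambda>x. a \<otimes> x) = lborel"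
    using lborel_left_invariant[of a] by (simp cong: distr_cong)
  have "distr lborel lborel (\<lambda>x. a \<otimes> x) \<Otimes>\<^sub>M distr lborel lborel (\<lambda>x. a \<otimes> x)
      = distr L2 L2 (\<lambda>(x, y). (a \<otimes> x, a \<otimes> y))"
    by (rule pair_measure_distr) (auto simp: d lborel.sigma_finite_measure_axioms)
  then show ?thesis by (simp add: d)
qed

lemma dq_translate: "dq (\<lambda>x. u (a \<otimes> x)) z = dq u ((\<lambda>(x, y). (a \<otimes> x, a \<otimes> y)) z)"
  by (auto simp: dq_def K_translate split: prod.split)

lemma W_translate:
  assumes u: "u \<in> W"
  shows "(\<lambda>x. u (a \<otimes> x)) \<in> W" and "N (\<lambda>x. u (a \<otimes> x)) = N u"
proof -
  have [measurable]: "u \<in> borel_measurable borel" using u by (rule W_measurable)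
  have [measurable]: "dq u \<in> borel_measurable L2" by (rule dq_measurable) simp
  let ?T = "\<lambda>(x, y). (a \<otimes> x, a \<otimes> y)"
  have T [measurable]: "?T \<in> L2 \<rightarrow>\<^sub>M L2" by measurable
  have 1: "integrable L2 (\<lambda>z. \<bar>dq (\<lambda>x. u (a \<otimes> x)) z\<bar> powr p)"
    "(LINT z|L2. \<bar>dq (\<lambda>x. u (a \<otimes> x)) z\<bar> powr p) = (LINT z|L2. \<bar>dq u z\<bar> powr p)"
  proof -
    have "integrable (distr L2 L2 ?T) (\<lambda>z. \<bar>dq u z\<bar> powr p)"
      using u by (simp add: pair_left_invariant W_iff Lp_def)
    then show "integrable L2 (\<lambda>z. \<bar>dq (\<lambda>x. u (a \<otimes> x)) z\<bar> powr p)"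
      unfolding dq_translate by (subst (asm) integrable_distr_eq[OF T]) auto
    have "(LINT z|L2. \<bar>dq u z\<bar> powr p) = (LINT z|distr L2 L2 ?T. \<bar>dq u z\<bar> powr p)"
      by (simp add: pair_left_invariant)
    also have "\<dots> = (LINT z|L2. \<bar>dq (\<lambda>x. u (a \<otimes> x)) z\<bar> powr p)"
      unfolding dq_translate by (subst integral_distr[OF T]) auto
    finally show "(LINT z|L2. \<bar>dq (\<lambda>x. u (a \<otimes> x)) z\<bar> powr p) = (LINT z|L2. \<bar>dq u z\<bar> powr p)" by simp
  qed
  have 2: "integrable lborel (\<lambda>x. \<bar>u (a \<otimes> x)\<bar> powr p)"
    using translate_integrable(1)[of "\<lambda>x. \<bar>u x\<bar> powr p" a] u by (simp add: W_iff Lp_def)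
  show "(\<lambda>x. u (a \<otimes> x)) \<in> W"
    using 1 2 dq_measurable[of "\<lambda>x. u (a \<otimes> x)"] by (simp add: W_iff Lp_def)
  show "N (\<lambda>x. u (a \<otimes> x)) = N u"
    using 1 translate_integrable(2)[of "\<lambda>x. \<bar>u x\<bar> powr p" a] by (simp add: N_dq)
qed

lemma W0_translate:
  assumes u: "u \<in> W0"
  shows "(\<lambda>x. u (a \<otimes> x)) \<in> W0"
  unfolding W0_iff
proof (intro conjI allI impI)
  show "(\<lambda>x. u (a \<otimes> x)) \<in> W" by (intro W_translate W0_imp_W u)
  fix \<epsilon> :: real assume "\<epsilon> > 0"
  then obtain \<phi> where \<phi>: "\<phi> \<in> test_functions \<inter> W" "N (\<lambda>x. u x - \<phi> x) < \<epsilon>"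
    using u unfolding W0_iff by blast
  have "N (\<lambda>x. u (a \<otimes> x) - \<phi> (a \<otimes> x)) = N (\<lambda>x. u x - \<phi> x)"
    using W_translate(2)[OF W_diff(1)[OF W0_imp_W[OF u], of \<phi>], of a] \<phi> by simp
  then show "\<exists>\<psi>\<in>test_functions \<inter> W. N (\<lambda>x. u (a \<otimes> x) - \<psi> x) < \<epsilon>"
    using \<phi> test_translate[of \<phi> a] W_translate(1)[of \<phi> a] by (intro bexI[of _ "\<lambda>x. \<phi> (a \<otimes> x)"]) auto
qed

end

section \<open>Test functions have finite norm\<close>

lemma suminf_geometric_ennreal_finite:
  fixes c r :: real
  assumes "0 \<le> c" "0 \<le> r" "r < 1"
  shows "(\<Sum>j. ennreal (c * r ^ j)) < \<infinity>"
proof -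
  have "summable (\<lambda>j. c * r ^ j)" using assms by (intro summable_mult summable_geometric) auto
  then show ?thesis using assms by (subst suminf_ennreal2) auto
qed

lemma term_le_suminf_ennreal: "f j \<le> (\<Sum>j. f j :: ennreal)"
  using sum_le_suminf[of f "{j}"] by simp

context fractional_sobolev
begin

text \<open>The Gagliardo kernel times the \<open>p\<close>-th power of the increment that a bounded
  Lipschitz function may have at \<open>h\<close>-distance \<open>t\<close>.\<close>

definition cutoff_kernel :: "real \<Rightarrow> real" where
  "cutoff_kernel t = min 1 t powr p / t powr (real Q + p * s)"

lemma cutoff_kernel_measurable [measurable]: "cutoff_kernel \<in> borel_measurable borel"
  unfolding cutoff_kernel_def by measurable

lemma cutoff_kernel_nonneg [simp]: "cutoff_kernel t \<ge> 0"
  by (simp add: cutoff_kernel_def)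

text \<open>Sum over dyadic shells: the terms with \<open>h z \<le> 1\<close> decay like \<open>2\<close> to the power
  \<open>- j p (1 - s)\<close>, those with \<open>h z > 1\<close> like \<open>2\<close> to the power \<open>- j p s\<close>.\<close>

lemma nn_integral_cutoff_kernel: "(\<integral>\<^sup>+z. ennreal (cutoff_kernel (h z)) \<partial>lborel) < \<infinity>"
proof -
  define b where "b = real Q + p * s"
  define e where "e = p - b"
  \<comment> \<open>The index is \<open>\<bar>log 2 t\<bar>\<close> rounded down;
    \<open>\<bar>e\<bar>\<close> pays for the rounding whatever the sign of \<open>e\<close>. Shells
    are enlarged to full balls, whose measures are known.\<close>
  define A where "A j z = ennreal (2 powr (\<bar>e\<bar> - real j * e)) * indicator {z. h z < 2 powr (1 - real j)} z"
    for j :: nat and z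
  define B where "B j z = ennreal (2 powr (- (real j * b))) * indicator {z. h z < 2 powr (1 + real j)} z"
    for j :: nat and z
  have b: "b > 0" using s_pos by (simp add: b_def add_nonneg_pos)
  have AB: "ennreal (cutoff_kernel (h z)) \<le> (\<Sum>j. A j z) + (\<Sum>j. B j z)" for z
  proof (cases "z = 0")
    case False
    define t where "t = h z"
    have t: "t > 0" using h_pos[OF False] by (simp add: t_def)
    define v where "v = \<bar>log 2 t\<bar>"
    define j where "j = nat \<lfloor>v\<rfloor>"
    have "v \<ge> 0" by (simp add: v_def)
    then have j: "real j \<le> v" "v < real j + 1" by (auto simp: j_def)
    show ?thesis
    proof (cases "t \<le> 1")
      case True
      then have tv: "t = 2 powr (- v)" using t by (simp add: v_def)
      have "cutoff_kernel t = t powr e"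
        using True t by (simp add: cutoff_kernel_def b_def e_def powr_diff)
      also have "\<dots> = 2 powr (- (v * e))" by (simp add: tv powr_powr)
      also have "\<dots> \<le> 2 powr (\<bar>e\<bar> - real j * e)"
      proof -
        have "(real j - v) * e \<le> \<bar>(real j - v) * e\<bar>" by simp
        also have "\<dots> \<le> 1 * \<bar>e\<bar>" unfolding abs_mult using j by (intro mult_right_mono) auto
        finally show ?thesis by (simp add: algebra_simps)
      qed
      finally have "ennreal (cutoff_kernel t) \<le> ennreal (2 powr (\<bar>e\<bar> - real j * e))" by (rule ennreal_leI)
      moreover have "t < 2 powr (1 - real j)" unfolding tv using j by simp
      ultimately have "ennreal (cutoff_kernel t) \<le> A j z" by (simp add: A_def t_def)
      also have "\<dots> \<le> (\<Sum>j. A j z)" by (rule term_le_suminf_ennreal)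
      finally show ?thesis by (simp add: t_def add_increasing2)
    next
      case False
      then have tv: "t = 2 powr v" using t by (simp add: v_def)
      have "cutoff_kernel t = t powr (- b)"
        using False t by (simp add: cutoff_kernel_def b_def powr_minus_divide del: minus_add_distrib)
      also have "\<dots> = 2 powr (- (v * b))" by (simp add: tv powr_powr)
      also have "\<dots> \<le> 2 powr (- (real j * b))" using j b by (simp add: mult_right_mono)
      finally have "ennreal (cutoff_kernel t) \<le> ennreal (2 powr (- (real j * b)))" by (rule ennreal_leI)
      moreover have "t < 2 powr (1 + real j)" unfolding tv using j by simp
      ultimately have "ennreal (cutoff_kernel t) \<le> B j z" by (simp add: B_def t_def)
      also have "\<dots> \<le> (\<Sum>j. B j z)" by (rule term_le_suminf_ennreal)
      finally show ?thesis by (simp add: t_def add_increasing)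
    qed
  qed (simp add: cutoff_kernel_def)
  have meas: "A j \<in> borel_measurable lborel" "B j \<in> borel_measurable lborel" for j
    unfolding A_def B_def by measurable
  note v0 = unit_vol_pos
  have pw: "(2 powr x) ^ n = 2 powr (real n * x)" for x :: real and n
    by (simp add: powr_realpow[symmetric] powr_powr mult.commute)
  have pw1: "2 powr x * (unit_vol * (2 powr y) ^ Q) = unit_vol * 2 powr (x + real Q * y)" for x y :: real
    by (simp only: pw powr_add mult_ac)
  have pw2: "unit_vol * 2 powr (x + real j * y) = unit_vol * 2 powr x * (2 powr y) ^ j" for x y :: real and j
    by (simp only: pw powr_add mult_ac)
  have IA: "(\<integral>\<^sup>+z. A j z \<partial>lborel) = ennreal (unit_vol * 2 powr (\<bar>e\<bar> + Q) * (2 powr (- (p - p * s))) ^ j)" for j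
  proof -
    have "(\<integral>\<^sup>+z. A j z \<partial>lborel) = ennreal (2 powr (\<bar>e\<bar> - real j * e)) * ennreal (unit_vol * (2 powr (1 - real j)) ^ Q)"
      unfolding A_def by (subst nn_integral_cmult_indicator) (auto simp: h_ball_emeasure)
    also have "\<dots> = ennreal (2 powr (\<bar>e\<bar> - real j * e) * (unit_vol * (2 powr (1 - real j)) ^ Q))"
      using v0 by (intro ennreal_mult[symmetric]) auto
    also have "2 powr (\<bar>e\<bar> - real j * e) * (unit_vol * (2 powr (1 - real j)) ^ Q)
        = unit_vol * 2 powr ((\<bar>e\<bar> - real j * e) + real Q * (1 - real j))"
      by (rule pw1)
    also have "(\<bar>e\<bar> - real j * e) + real Q * (1 - real j) = (\<bar>e\<bar> + Q) + real j * (- (p - p * s))"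
      by (simp add: e_def b_def algebra_simps)
    also have "unit_vol * 2 powr ((\<bar>e\<bar> + Q) + real j * (- (p - p * s)))
        = unit_vol * 2 powr (\<bar>e\<bar> + Q) * (2 powr (- (p - p * s))) ^ j"
      by (rule pw2)
    finally show ?thesis .
  qed
  have IB: "(\<integral>\<^sup>+z. B j z \<partial>lborel) = ennreal (unit_vol * 2 powr Q * (2 powr (- (p * s))) ^ j)" for j
  proof -
    have "(\<integral>\<^sup>+z. B j z \<partial>lborel) = ennreal (2 powr (- (real j * b))) * ennreal (unit_vol * (2 powr (1 + real j)) ^ Q)"
      unfolding B_def by (subst nn_integral_cmult_indicator) (auto simp: h_ball_emeasure)
    also have "\<dots> = ennreal (2 powr (- (real j * b)) * (unit_vol * (2 powr (1 + real j)) ^ Q))"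
      using v0 by (intro ennreal_mult[symmetric]) auto
    also have "2 powr (- (real j * b)) * (unit_vol * (2 powr (1 + real j)) ^ Q)
        = unit_vol * 2 powr (- (real j * b) + real Q * (1 + real j))"
      by (rule pw1)
    also have "- (real j * b) + real Q * (1 + real j) = real Q + real j * (- (p * s))"
      by (simp add: b_def algebra_simps)
    also have "unit_vol * 2 powr (real Q + real j * (- (p * s)))
        = unit_vol * 2 powr Q * (2 powr (- (p * s))) ^ j"
      by (rule pw2)
    finally show ?thesis .
  qed
  have ps: "p * s < p" "0 < p * s" using s_pos s_less_1 by auto
  have r: "2 powr (- (p - p * s)) < 1" "2 powr (- (p * s)) < 1"
    using ps by (auto intro: powr_less_one)
  have "(\<integral>\<^sup>+z. ennreal (cutoff_kernel (h z)) \<partial>lborel) \<le> (\<integral>\<^sup>+z. (\<Sum>j. A j z) + (\<Sum>j. B j z) \<partial>lborel)"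
    by (intro nn_integral_mono AB)
  also have "\<dots> = (\<integral>\<^sup>+z. (\<Sum>j. A j z) \<partial>lborel) + (\<integral>\<^sup>+z. (\<Sum>j. B j z) \<partial>lborel)"
    using meas by (intro nn_integral_add borel_measurable_suminf_order) auto
  also have "\<dots> = (\<Sum>j. \<integral>\<^sup>+z. A j z \<partial>lborel) + (\<Sum>j. \<integral>\<^sup>+z. B j z \<partial>lborel)"
    using meas by (subst (1 2) nn_integral_suminf) auto
  also have "\<dots> < \<infinity>"
    unfolding IA IB using suminf_geometric_ennreal_finite v0 r by (simp add: less_top[symmetric])
  finally show ?thesis .
qed

section \<open>Lipschitz bounds for test functions and finiteness of their norm\<close>

lemma test_bounded:
  assumes "\<phi> \<in> test_functions"
  obtains M where "M > 0" "\<And>x. \<bar>\<phi> x\<bar> \<le> M"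
proof -
  let ?S = "closure {x. \<phi> x \<noteq> 0}"
  have "compact (\<phi> ` ?S)"
    using assms smooth_imp_continuous
    by (intro compact_continuous_image) (auto simp: test_functions_def intro: continuous_on_subset)
  then obtain M where M: "M > 0" "\<And>x. x \<in> ?S \<Longrightarrow> \<bar>\<phi> x\<bar> \<le> M"
    using bounded_pos[of "\<phi> ` ?S"] compact_imp_bounded by auto
  have "\<bar>\<phi> x\<bar> \<le> M" for x
  proof (cases "\<phi> x = 0")
    case False
    then have "x \<in> ?S" by (intro subsetD[OF closure_subset]) simp
    then show ?thesis by (rule M)
  qed (use M in simp)
  then show ?thesis using M that by blast
qed

text \<open>Near 0 the Euclidean norm is at most a multiple of \<open>h\<close>, so a bound on the
  derivative in \<open>z\<close> over the compact set \<open>S \<times> cball 0 C\<close> becomes a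
  Lipschitz bound in \<open>h\<close>.\<close>

lemma test_Lipschitz_near_support:
  assumes \<phi>: "smooth \<phi>" and S: "compact S"
  obtains L where "L > 0" "\<And>y z. y \<in> S \<Longrightarrow> h z \<le> 1 \<Longrightarrow> \<bar>\<phi> (y \<otimes> z) - \<phi> y\<bar> \<le> L * h z"
proof -
  obtain C where C: "C > 0" "\<And>z. h z \<le> 1 \<Longrightarrow> norm z \<le> C * h z" using norm_le_h by blast
  define g where "g = (\<lambda>w. \<phi> (case w of (x, y) \<Rightarrow> x \<otimes> y))"
  have sg: "smooth g" unfolding g_def by (rule smooth_compose[OF \<phi> smooth_mult])
  define D where "D w i = frechet_derivative g (at w) (0, i)" for w i
  have der: "((\<lambda>z. \<phi> (y \<otimes> z)) has_derivative D (y, z)) (at z)" for y z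
    using smooth_partial_derivative[OF sg, of y z] by (simp add: g_def D_def[abs_def])
  have lin: "linear (D w)" for w using der[of "fst w" "snd w"] has_derivative_linear by force
  have cpt: "compact (S \<times> cball (0 :: real ^ 'n) C)" using S by (intro compact_Times compact_cball)
  have "\<exists>B. \<forall>w\<in>S \<times> cball 0 C. \<bar>D w i\<bar> \<le> B" for i
  proof -
    have "compact ((\<lambda>w. D w i) ` (S \<times> cball 0 C))"
      using smooth_imp_continuous_derivative[OF sg, of "(0, i)"]
      by (intro compact_continuous_image cpt) (auto simp: D_def intro: continuous_on_subset)
    from compact_imp_bounded[OF this] show ?thesis unfolding bounded_iff by (force simp: real_norm_def)
  qed
  then obtain B where B: "\<And>i w. w \<in> S \<times> cball 0 C \<Longrightarrow> \<bar>D w i\<bar> \<le> B i" by metis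
  define L where "L = (\<Sum>i\<in>Basis. \<bar>B i\<bar>)"
  have L0: "L \<ge> 0" by (simp add: L_def sum_nonneg)
  have main: "\<bar>\<phi> (y \<otimes> z) - \<phi> y\<bar> \<le> (L * C + 1) * h z" if y: "y \<in> S" and z: "h z \<le> 1" for y z
  proof -
    have "C * h z \<le> C * 1" using z C(1) by (intro mult_left_mono) auto
    then have nz: "norm z \<le> C" using C(2)[OF z] by simp
    have "norm (\<phi> (y \<otimes> z) - \<phi> (y \<otimes> 0)) \<le> L * norm (z - 0)"
    proof (rule differentiable_bound[where f = "\<lambda>z. \<phi> (y \<otimes> z)" and S = "cball 0 C" and f' = "\<lambda>z. D (y, z)"])
      fix x :: "real ^ 'n" assume x: "x \<in> cball 0 C"
      show "((\<lambda>z. \<phi> (y \<otimes> z)) has_derivative D (y, x)) (at x within cball 0 C)"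
        by (rule has_derivative_at_withinI[OF der])
      show "onorm (D (y, x)) \<le> L"
      proof (rule onorm_le)
        fix w
        have "D (y, x) w = (\<Sum>i\<in>Basis. (w \<bullet> i) *\<^sub>R D (y, x) i)"
          by (rule linear_Basis_expansion[OF lin])
        also have "norm \<dots> \<le> (\<Sum>i\<in>(Basis::(real^'n) set). norm w * \<bar>B i\<bar>)"
        proof (rule sum_norm_le)
          fix i :: "real ^ 'n" assume i: "i \<in> Basis"
          have "\<bar>D (y, x) i\<bar> \<le> \<bar>B i\<bar>" using B[of "(y, x)" i] y x by auto
          then have "\<bar>w \<bullet> i\<bar> * \<bar>D (y, x) i\<bar> \<le> norm w * \<bar>B i\<bar>"
            by (intro mult_mono Basis_le_norm i) auto
          then show "norm ((w \<bullet> i) *\<^sub>R D (y, x) i) \<le> norm w * \<bar>B i\<bar>" by (simp add: abs_mult)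
        qed
        also have "\<dots> = L * norm w" by (simp add: L_def sum_distrib_left mult.commute)
        finally show "norm (D (y, x) w) \<le> L * norm w" .
      qed
    qed (use nz C in auto)
    also have "L * norm (z - 0) \<le> L * (C * h z)" using C(2)[OF z] L0 by (simp add: mult_left_mono)
    also have "\<dots> \<le> (L * C + 1) * h z" by (simp add: algebra_simps)
    finally show ?thesis by simp
  qed
  have "L * C + 1 > 0" using L0 C by (intro add_nonneg_pos) auto
  then show ?thesis using that main by blast
qed

text \<open>By symmetry of \<open>h\<close> either point may serve as base point, so it suffices
  that one of them lies in the support; otherwise both values vanish. At distance above 1 the sup
  bound takes over.\<close>

lemma test_Lipschitz:
  assumes \<phi>: "\<phi> \<in> test_functions"
  obtains L where "L > 0" "\<And>x y. \<bar>\<phi> x - \<phi> y\<bar> \<le> L * min 1 (h (inv y \<otimes> x))"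
proof -
  let ?S = "closure {x. \<phi> x \<noteq> 0}"
  have S: "x \<in> ?S" if "\<phi> x \<noteq> 0" for x using that by (intro subsetD[OF closure_subset]) simp
  obtain L where L: "L > 0" "\<And>y z. y \<in> ?S \<Longrightarrow> h z \<le> 1 \<Longrightarrow> \<bar>\<phi> (y \<otimes> z) - \<phi> y\<bar> \<le> L * h z"
    using test_Lipschitz_near_support[of \<phi> ?S] \<phi> by (auto simp: test_functions_def)
  obtain M where M: "M > 0" "\<And>x. \<bar>\<phi> x\<bar> \<le> M" using test_bounded[OF \<phi>] by blast
  define L' where "L' = L + 2 * M"
  have near: "\<bar>\<phi> x - \<phi> y\<bar> \<le> L * h (inv y \<otimes> x)" if "y \<in> ?S" "h (inv y \<otimes> x) \<le> 1" for x y
    using L(2)[OF that] by simp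
  have "\<bar>\<phi> x - \<phi> y\<bar> \<le> L' * min 1 (h (inv y \<otimes> x))" for x y
  proof (cases "h (inv y \<otimes> x) \<le> 1")
    case True
    have "\<bar>\<phi> x - \<phi> y\<bar> \<le> L * h (inv y \<otimes> x)"
    proof (cases "y \<in> ?S \<or> x \<in> ?S")
      case yx: True
      then show ?thesis
      proof
        assume "x \<in> ?S"
        from near[OF this, of y] True show ?thesis
          by (simp add: h_diff_commute[of x y] abs_minus_commute)
      qed (use near True in auto)
    next
      case False
      then have "\<phi> x = 0" "\<phi> y = 0" using S by blast+
      then show ?thesis using L(1) by simp
    qed
    also have "\<dots> \<le> L' * h (inv y \<otimes> x)" using M by (intro mult_right_mono) (auto simp: L'_def)
    finally show ?thesis using True by simp
  next
    case False
    have "\<bar>\<phi> x - \<phi> y\<bar> \<le> 2 * M" using M(2)[of x] M(2)[of y] by linarith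
    then show ?thesis using False L by (simp add: L'_def)
  qed
  moreover have "L' > 0" using L M by (simp add: L'_def)
  ultimately show ?thesis using that by blast
qed

text \<open>The integrand vanishes unless one of the two points lies in the compact support.
  Integrating the other point over the whole group gives, by left invariance, a finite integral of
  \<open>cutoff_kernel\<close> that does not depend on the first.\<close>

lemma test_in_W:
  assumes \<phi>: "\<phi> \<in> test_functions"
  shows "\<phi> \<in> W"
proof -
  let ?S = "closure {x. \<phi> x \<noteq> 0}"
  have S: "x \<in> ?S" if "\<phi> x \<noteq> 0" for x using that by (intro subsetD[OF closure_subset]) simp
  have cS: "compact ?S" using \<phi> by (simp add: test_functions_def)
  have fS: "emeasure lborel ?S < \<infinity>" using emeasure_bounded_finite[OF compact_imp_bounded[OF cS]] by simp
  have [measurable]: "?S \<in> sets borel" by simp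
  have m [measurable]: "\<phi> \<in> borel_measurable borel"
    using \<phi> by (intro borel_measurable_continuous_onI smooth_imp_continuous) (simp add: test_functions_def)
  obtain M where M: "M > 0" "\<And>x. \<bar>\<phi> x\<bar> \<le> M" using test_bounded[OF \<phi>] by blast
  obtain L where L: "L > 0" "\<And>x y. \<bar>\<phi> x - \<phi> y\<bar> \<le> L * min 1 (h (inv y \<otimes> x))"
    using test_Lipschitz[OF \<phi>] by blast
  have "Lp lborel p \<phi>"
    unfolding Lp_def
  proof
    show "integrable lborel (\<lambda>x. \<bar>\<phi> x\<bar> powr p)"
    proof (rule Bochner_Integration.integrable_bound)
      show "integrable lborel (\<lambda>x. M powr p * indicator ?S x)"
        using fS by (intro integrable_mult_right integrable_real_indicator) auto
      show "AE x in lborel. norm (\<bar>\<phi> x\<bar> powr p) \<le> norm (M powr p * indicator ?S x)"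
      proof (rule AE_I2)
        fix x
        show "norm (\<bar>\<phi> x\<bar> powr p) \<le> norm (M powr p * indicator ?S x)"
        proof (cases "\<phi> x = 0")
          case False
          then show ?thesis using S[OF False] M(2)[of x] powr_mono2[of p "\<bar>\<phi> x\<bar>" M] p_gt_1 by simp
        qed simp
      qed
    qed simp
  qed simp
  moreover have "Lp L2 p (dq \<phi>)"
    unfolding Lp_def
  proof
    show dm [measurable]: "dq \<phi> \<in> borel_measurable L2" by (rule dq_measurable) simp
    let ?I = "\<integral>\<^sup>+z. ennreal (cutoff_kernel (h z)) \<partial>lborel"
    define \<Psi> where "\<Psi> z = ennreal (cutoff_kernel (h (inv (snd z) \<otimes> fst z)))" for z
    have [measurable]: "\<Psi> \<in> borel_measurable L2"
      unfolding \<Psi>_def using measurable_compose[OF pair_h_measurable cutoff_kernel_measurable] by simp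
    define F where "F z = (indicator ?S (fst z) + indicator ?S (snd z)) * \<Psi> z" for z
    have le: "ennreal (\<bar>dq \<phi> z\<bar> powr p) \<le> ennreal (L powr p) * F z" for z
    proof -
      obtain x y where z: "z = (x, y)" by (cases z)
      define t where "t = h (inv y \<otimes> x)"
      show ?thesis
      proof (cases "x \<in> ?S \<or> y \<in> ?S")
        case True
        have "\<bar>\<phi> x - \<phi> y\<bar> powr p \<le> (L * min 1 t) powr p"
          using L(2)[of x y] by (intro powr_mono2) (auto simp: t_def)
        also have "\<dots> = L powr p * min 1 t powr p" using L(1) by (simp add: powr_mult t_def)
        finally have "\<bar>\<phi> x - \<phi> y\<bar> powr p * K x y \<le> (L powr p * min 1 t powr p) * K x y"
          by (rule mult_right_mono) simp
        also have "\<dots> = L powr p * cutoff_kernel t"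
          by (simp add: cutoff_kernel_def gagliardo_kernel_def t_def)
        finally have "ennreal (\<bar>dq \<phi> z\<bar> powr p) \<le> ennreal (L powr p) * ennreal (cutoff_kernel t)"
          by (simp add: dq_powr z ennreal_mult[symmetric] ennreal_leI)
        also have "\<dots> \<le> ennreal (L powr p) * F z"
        proof (rule mult_left_mono)
          have "1 \<le> (indicator ?S x + indicator ?S y :: ennreal)" using True by (auto simp: indicator_def)
          then have "1 * \<Psi> z \<le> F z" unfolding F_def z by (intro mult_right_mono) auto
          then show "ennreal (cutoff_kernel t) \<le> F z" by (simp add: \<Psi>_def z t_def)
        qed simp
        finally show ?thesis .
      next
        case False
        then have "\<phi> x = 0" "\<phi> y = 0" using S by blast+
        then show ?thesis by (simp add: z dq_def)
      qed
    qed
    have ind: "(indicator ?S :: real ^ 'n \<Rightarrow> ennreal) \<in> borel_measurable lborel" by simp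
    have ms [measurable]: "(\<lambda>z. indicator ?S (snd z) * \<Psi> z) \<in> borel_measurable L2"
      by (intro borel_measurable_times_ennreal measurable_compose[OF measurable_snd ind]) simp
    have mf [measurable]: "(\<lambda>z. indicator ?S (fst z) * \<Psi> z) \<in> borel_measurable L2"
      by (intro borel_measurable_times_ennreal measurable_compose[OF measurable_fst ind]) simp
    have I1: "(\<integral>\<^sup>+z. indicator ?S (snd z) * \<Psi> z \<partial>L2) = ?I * emeasure lborel ?S"
    proof -
      have "(\<integral>\<^sup>+z. indicator ?S (snd z) * \<Psi> z \<partial>L2)
          = (\<integral>\<^sup>+y. \<integral>\<^sup>+x. indicator ?S y * \<Psi> (x, y) \<partial>lborel \<partial>lborel)"
        using lborel_pair.nn_integral_snd[OF ms] by simp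
      also have "\<dots> = (\<integral>\<^sup>+y. ?I * indicator ?S y \<partial>lborel)"
      proof (intro nn_integral_cong)
        fix y
        have "(\<integral>\<^sup>+x. indicator ?S y * \<Psi> (x, y) \<partial>lborel) = indicator ?S y * (\<integral>\<^sup>+x. \<Psi> (x, y) \<partial>lborel)"
          by (intro nn_integral_cmult) (simp add: \<Psi>_def)
        also have "(\<integral>\<^sup>+x. \<Psi> (x, y) \<partial>lborel) = ?I"
          using translate_nn_integral[of "\<lambda>x. ennreal (cutoff_kernel (h x))" "inv y"] by (simp add: \<Psi>_def)
        finally show "(\<integral>\<^sup>+x. indicator ?S y * \<Psi> (x, y) \<partial>lborel) = ?I * indicator ?S y"
          by (simp add: mult.commute)
      qed
      also have "\<dots> = ?I * emeasure lborel ?S" by (rule nn_integral_cmult_indicator) simp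
      finally show ?thesis .
    qed
    \<comment> \<open>Now the inner variable \<open>y\<close> occurs inverted; the symmetry of
      \<open>h\<close> turns this into a translation by \<open>inv x\<close>, and the computation
      for \<open>I1\<close> repeats.\<close>
    have I2: "(\<integral>\<^sup>+z. indicator ?S (fst z) * \<Psi> z \<partial>L2) = ?I * emeasure lborel ?S"
    proof -
      have "(\<integral>\<^sup>+z. indicator ?S (fst z) * \<Psi> z \<partial>L2)
          = (\<integral>\<^sup>+x. \<integral>\<^sup>+y. indicator ?S x * \<Psi> (x, y) \<partial>lborel \<partial>lborel)"
        using lborel.nn_integral_fst[OF mf] by simp
      also have "\<dots> = (\<integral>\<^sup>+x. ?I * indicator ?S x \<partial>lborel)"
      proof (intro nn_integral_cong)
        fix x
        have "(\<integral>\<^sup>+y. indicator ?S x * \<Psi> (x, y) \<partial>lborel) = indicator ?S x * (\<integral>\<^sup>+y. \<Psi> (x, y) \<partial>lborel)"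
          by (intro nn_integral_cmult) (simp add: \<Psi>_def h_diff_commute[of _ x])
        also have "(\<integral>\<^sup>+y. \<Psi> (x, y) \<partial>lborel) = ?I"
          using translate_nn_integral[of "\<lambda>x. ennreal (cutoff_kernel (h x))" "inv x"]
          by (simp add: \<Psi>_def h_diff_commute[of _ x])
        finally show "(\<integral>\<^sup>+y. indicator ?S x * \<Psi> (x, y) \<partial>lborel) = ?I * indicator ?S x"
          by (simp add: mult.commute)
      qed
      also have "\<dots> = ?I * emeasure lborel ?S" by (rule nn_integral_cmult_indicator) simp
      finally show ?thesis .
    qed
    have "(\<integral>\<^sup>+z. ennreal (\<bar>dq \<phi> z\<bar> powr p) \<partial>L2) \<le> (\<integral>\<^sup>+z. ennreal (L powr p) * F z \<partial>L2)"
      by (intro nn_integral_mono le)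
    also have "\<dots> = ennreal (L powr p) * (\<integral>\<^sup>+z. indicator ?S (fst z) * \<Psi> z + indicator ?S (snd z) * \<Psi> z \<partial>L2)"
      unfolding F_def distrib_right using ms mf by (intro nn_integral_cmult borel_measurable_add)
    also have "\<dots> = ennreal (L powr p) * (?I * emeasure lborel ?S + ?I * emeasure lborel ?S)"
      using nn_integral_add[OF mf ms] by (simp add: I1 I2)
    also have "\<dots> < \<infinity>"
      using nn_integral_cutoff_kernel fS by (auto simp: ennreal_mult_less_top)
    finally show "integrable L2 (\<lambda>z. \<bar>dq \<phi> z\<bar> powr p)"
      by (intro integrableI_nonneg) auto
  qed
  ultimately show ?thesis by (simp add: W_iff)
qed

lemma test_in_W0: "\<phi> \<in> test_functions \<Longrightarrow> \<phi> \<in> W0"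
  unfolding W0_iff
proof (intro conjI allI impI)
  assume \<phi>: "\<phi> \<in> test_functions"
  show W: "\<phi> \<in> W" by (rule test_in_W[OF \<phi>])
  fix \<epsilon> :: real assume "\<epsilon> > 0"
  then show "\<exists>\<psi>\<in>test_functions \<inter> W. N (\<lambda>x. \<phi> x - \<psi> x) < \<epsilon>"
    using \<phi> W by (intro bexI[of _ \<phi>]) (auto simp: N_dq dq_def case_prod_beta)
qed

end

section \<open>Local averages\<close>

context fractional_sobolev
begin

text \<open>The inner Gagliardo integral, used like the density of a Dirichlet integral. Its value
  defaults to 0 where the integral diverges, so pointwise lemmas assume integrability at
  \<open>x\<close>; this holds almost everywhere by \<open>AE_D_integrable\<close>.\<close>

definition D :: "(real ^ 'n \<Rightarrow> real) \<Rightarrow> real ^ 'n \<Rightarrow> real" where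
  "D u x = (LINT y|lborel. \<bar>u x - u y\<bar> powr p * K x y)"

lemma D_nonneg: "D u x \<ge> 0"
  unfolding D_def by (intro Bochner_Integration.integral_nonneg) auto

lemma W_integrable_gagliardo: "u \<in> W \<Longrightarrow> integrable L2 (\<lambda>(x, y). \<bar>u x - u y\<bar> powr p * K x y)"
  by (simp add: sobolev_def)

lemma AE_D_integrable: "u \<in> W \<Longrightarrow> AE x in lborel. integrable lborel (\<lambda>y. \<bar>u x - u y\<bar> powr p * K x y)"
  by (rule lborel_pair.AE_integrable_fst[OF W_integrable_gagliardo])

lemma integrable_D: "u \<in> W \<Longrightarrow> integrable lborel (D u)"
  unfolding D_def by (rule lborel_pair.integrable_fst[OF W_integrable_gagliardo])

lemma integral_D: "u \<in> W \<Longrightarrow> (LINT x|lborel. D u x) = gagliardo_p G h Q s p u"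
  unfolding D_def gagliardo_p_def by (rule lborel_pair.integral_fst[OF W_integrable_gagliardo])

lemma integral_D_le_N: "u \<in> W \<Longrightarrow> (LINT x|lborel. D u x) \<le> N u"
  by (simp add: integral_D gagliardo_le_N)

text \<open>Off the diagonal the kernel is at least the reciprocal of
  \<open>r powr (real Q + p * s)\<close> on the ball. On the diagonal it has the value 0, but so has
  the difference.\<close>

lemma diff_le_kernel:
  assumes "y \<in> hball x r"
  shows "\<bar>u x - u y\<bar> powr p \<le> r powr (real Q + p * s) * (\<bar>u x - u y\<bar> powr p * K x y)"
proof (cases "x = y")
  case False
  define t where "t = h (inv y \<otimes> x)"
  have "inv y \<otimes> x \<noteq> 0" using False mult_inv_cancel[of y x] by force
  then have t: "t > 0" "t < r" using h_pos[of "inv y \<otimes> x"] assms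
    unfolding t_def hball_def by (auto simp: h_diff_commute[of y x])
  have "t powr (real Q + p * s) \<le> r powr (real Q + p * s)"
    using t s_pos by (intro powr_mono2) auto
  then have "1 \<le> r powr (real Q + p * s) * K x y"
    using t by (simp add: gagliardo_kernel_def t_def[symmetric] field_simps)
  from mult_right_mono[OF this, of "\<bar>u x - u y\<bar> powr p"] show ?thesis by (simp add: mult_ac)
qed simp

text \<open>For every \<open>y\<close>, either \<open>\<bar>u x - u y\<bar>\<close> or \<open>\<bar>u y\<bar>\<close> is at least half of \<open>\<bar>u x\<bar>\<close>; averaging over a
  ball around \<open>x\<close> gives an estimate that replaces the Sobolev inequality in what follows.\<close>

lemma ball_volume_le:
  assumes u: "u \<in> W" and x: "integrable lborel (\<lambda>y. \<bar>u x - u y\<bar> powr p * K x y)"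
    and t: "t > 0" "integrable lborel (\<lambda>y. \<bar>u y\<bar> powr t)" and a: "0 < a" "a \<le> \<bar>u x\<bar>" and r: "r > 0"
  shows "unit_vol * r ^ Q \<le> (2 / a) powr p * (r powr (real Q + p * s) * D u x)
     + (2 / a) powr t * (LINT y|lborel. indicator (hball x r) y * \<bar>u y\<bar> powr t)"
proof -
  note [measurable] = W_measurable[OF u]
  let ?b = "real Q + p * s"
  have i1: "integrable lborel (\<lambda>y. (2 / a) powr p * (r powr ?b * (\<bar>u x - u y\<bar> powr p * K x y)))"
    using x by (intro integrable_mult_right)
  have i2: "integrable lborel (\<lambda>y. indicator (hball x r) y * \<bar>u y\<bar> powr t)"
    using t by (intro integrable_mult_indicator[where 'b = real, unfolded real_scaleR_def]) auto
  have i0: "integrable lborel (indicator (hball x r) :: _ \<Rightarrow> real)"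
    using emeasure_hball[OF r, of x] by (intro integrable_real_indicator) auto
  have "unit_vol * r ^ Q = (LINT y|lborel. indicator (hball x r) y)"
    using measure_hball[OF r, of x] by simp
  also have "\<dots> \<le> (LINT y|lborel. (2 / a) powr p * (r powr ?b * (\<bar>u x - u y\<bar> powr p * K x y))
     + (2 / a) powr t * (indicator (hball x r) y * \<bar>u y\<bar> powr t))"
  proof (intro integral_mono i0 Bochner_Integration.integrable_add i1 integrable_mult_right i2)
    fix y
    show "indicator (hball x r) y \<le> (2 / a) powr p * (r powr ?b * (\<bar>u x - u y\<bar> powr p * K x y))
     + (2 / a) powr t * (indicator (hball x r) y * \<bar>u y\<bar> powr t)"
    proof (cases "y \<in> hball x r")
      case True
      have ge: "1 \<le> (2 / a) powr e * d powr e" if "d \<ge> a / 2" "e > 0" for d e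
      proof -
        have "1 \<le> 2 / a * d" using that a by (simp add: field_simps)
        then have "1 \<le> (2 / a * d) powr e" using that by (intro ge_one_powr_ge_zero) auto
        then show ?thesis by (simp only: powr_mult)
      qed
      have k: "(2 / a) powr p * \<bar>u x - u y\<bar> powr p
          \<le> (2 / a) powr p * (r powr ?b * (\<bar>u x - u y\<bar> powr p * K x y))"
        by (intro mult_left_mono diff_le_kernel True) simp
      have "\<bar>u x - u y\<bar> \<ge> a / 2 \<or> \<bar>u y\<bar> \<ge> a / 2" using a by linarith
      then show ?thesis
      proof
        assume "\<bar>u x - u y\<bar> \<ge> a / 2"
        from ge[OF this p_pos(1)] k have "1 \<le> (2 / a) powr p * (r powr ?b * (\<bar>u x - u y\<bar> powr p * K x y))"
          by linarith
        then show ?thesis using True by (simp add: add_increasing2)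
      next
        assume "\<bar>u y\<bar> \<ge> a / 2"
        from ge[OF this t(1)] show ?thesis using True by (simp add: add_increasing)
      qed
    qed simp
  qed
  also have "\<dots> = (2 / a) powr p * (r powr ?b * D u x)
     + (2 / a) powr t * (LINT y|lborel. indicator (hball x r) y * \<bar>u y\<bar> powr t)"
    using i1 i2 by (subst Bochner_Integration.integral_add) (auto simp: D_def)
  finally show ?thesis .
qed

section \<open>Embeddings\<close>

text \<open>At a point with \<open>u x \<noteq> 0\<close> choose the radius for which the second
  term of \<open>ball_volume_le\<close> accounts for at most half of the volume. The first term must
  then carry the other half, which bounds \<open>\<bar>u x\<bar> powr (p + t * \<theta>)\<close> by
  a multiple of \<open>D u x\<close>.\<close>

lemma embedding_step:
  assumes u: "u \<in> W" and t: "t > 0" "integrable lborel (\<lambda>y. \<bar>u y\<bar> powr t)"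
    and T: "(LINT y|lborel. \<bar>u y\<bar> powr t) \<le> T" "T > 0" and Q: "Q > 0"
  defines "\<theta> \<equiv> p * s / real Q"
  defines "C \<equiv> 2 / unit_vol * 2 powr (p + t * \<theta>) * (2 * T / unit_vol) powr \<theta>"
  shows "integrable lborel (\<lambda>y. \<bar>u y\<bar> powr (p + t * \<theta>))"
    and "(LINT y|lborel. \<bar>u y\<bar> powr (p + t * \<theta>)) \<le> C * N u"
proof -
  note [measurable] = W_measurable[OF u]
  note c = unit_vol_pos
  have C0: "C \<ge> 0" using c by (simp add: C_def)
  have \<theta>: "\<theta> > 0" using Q s_pos by (simp add: \<theta>_def)
  have pt: "AE x in lborel. \<bar>u x\<bar> powr (p + t * \<theta>) \<le> C * D u x"
    using AE_D_integrable[OF u]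
  proof eventually_elim
    case (elim x)
    show ?case
    proof (cases "u x = 0")
      case False
      define a where "a = \<bar>u x\<bar>"
      have a: "a > 0" using False by (simp add: a_def)
      \<comment> \<open>The value of \<open>r ^ Q\<close>, solved from
        \<open>(2 / a) powr t * T = unit_vol * X / 2\<close>. As
        \<open>r powr (p * s) = X powr \<theta>\<close>, it brings in \<open>a\<close> to the power
        \<open>- t * \<theta>\<close>, the source of the gained exponent.\<close>
      define X where "X = 2 * T / unit_vol * (2 / a) powr t"
      have X: "X > 0" using T c a by (simp add: X_def)
      define r where "r = X powr (1 / real Q)"
      have r: "r > 0" using X by (simp add: r_def)
      have rQ: "r ^ Q = X" using r X Q by (simp add: powr_realpow[symmetric] r_def powr_powr)
      have rp: "r powr (p * s) = X powr \<theta>" by (simp add: r_def powr_powr \<theta>_def)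
      have "(LINT y|lborel. indicator (hball x r) y * \<bar>u y\<bar> powr t) \<le> (LINT y|lborel. \<bar>u y\<bar> powr t)"
        using t by (intro integral_mono integrable_mult_indicator[where 'b = real, unfolded real_scaleR_def])
          (auto simp: indicator_def)
      then have le: "(2 / a) powr t * (LINT y|lborel. indicator (hball x r) y * \<bar>u y\<bar> powr t) \<le> (2 / a) powr t * T"
        using T by (intro mult_left_mono) auto
      have half: "(2 / a) powr t * T = unit_vol * X / 2" using c by (simp add: X_def)
      have "unit_vol * X \<le> (2 / a) powr p * (r powr (real Q + p * s) * D u x) + unit_vol * X / 2"
        using ball_volume_le[OF u elim t a _ r] le half rQ by (simp add: a_def)
      moreover have "r powr (real Q + p * s) = X * X powr \<theta>"
        using r by (simp add: powr_add rp powr_realpow rQ)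
      ultimately have "unit_vol * X \<le> 2 * ((2 / a) powr p * (X * X powr \<theta> * D u x))" by simp
      then have "X * unit_vol \<le> X * (2 * ((2 / a) powr p * (X powr \<theta> * D u x)))" by (simp add: mult_ac)
      then have "unit_vol \<le> 2 * ((2 / a) powr p * (X powr \<theta> * D u x))" using X by simp
      also have "X powr \<theta> = (2 * T / unit_vol) powr \<theta> * (2 / a) powr (t * \<theta>)"
        by (simp only: X_def powr_mult[of "2 * T / unit_vol"] powr_powr)
      also have "2 * ((2 / a) powr p * ((2 * T / unit_vol) powr \<theta> * (2 / a) powr (t * \<theta>) * D u x))
          = 2 * ((2 / a) powr (p + t * \<theta>) * ((2 * T / unit_vol) powr \<theta> * D u x))"
        by (simp add: powr_add mult_ac)
      also have "(2 / a) powr (p + t * \<theta>) = 2 powr (p + t * \<theta>) / a powr (p + t * \<theta>)"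
        using a by (simp add: powr_divide)
      finally have "a powr (p + t * \<theta>) * unit_vol
          \<le> 2 * (2 powr (p + t * \<theta>) * ((2 * T / unit_vol) powr \<theta> * D u x))"
        using a by (simp add: field_simps)
      then show ?thesis using c by (simp add: C_def a_def[symmetric] field_simps)
    qed (use C0 D_nonneg[of u x] in simp)
  qed
  show i: "integrable lborel (\<lambda>y. \<bar>u y\<bar> powr (p + t * \<theta>))"
  proof (rule Bochner_Integration.integrable_bound[of _ "\<lambda>x. C * D u x"])
    show "AE x in lborel. norm (\<bar>u x\<bar> powr (p + t * \<theta>)) \<le> norm (C * D u x)"
      using pt by eventually_elim auto
  qed (use integrable_D[OF u] in auto)
  have "(LINT y|lborel. \<bar>u y\<bar> powr (p + t * \<theta>)) \<le> (LINT y|lborel. C * D u y)"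
    using integrable_D[OF u] i pt by (intro integral_mono_AE) auto
  also have "\<dots> = C * (LINT y|lborel. D u y)" by simp
  also have "\<dots> \<le> C * N u" by (intro mult_left_mono integral_D_le_N u C0)
  finally show "(LINT y|lborel. \<bar>u y\<bar> powr (p + t * \<theta>)) \<le> C * N u" .
qed

text \<open>Iterating \<open>embedding_step\<close> from \<open>p\<close> moves exponents by
  \<open>t \<mapsto> p + t * \<theta>\<close>, whose fixed point is the critical exponent. Every
  subcritical \<open>t\<close> is thus overtaken, and is reached by interpolation with
  \<open>p\<close>.\<close>

lemma embedding_unit:
  assumes Q: "real Q > p * s" and t: "p \<le> t" "t < real Q * p / (real Q - p * s)"
  shows "\<exists>C. \<forall>u\<in>W. N u \<le> 1 \<longrightarrow> integrable lborel (\<lambda>x. \<bar>u x\<bar> powr t) \<and> (LINT x|lborel. \<bar>u x\<bar> powr t) \<le> C"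
proof -
  have ps: "p * s > 0" using s_pos by simp
  have Q0: "Q > 0" using Q ps by (cases Q) auto
  define \<theta> where "\<theta> = p * s / real Q"
  have \<theta>: "0 < \<theta>" "\<theta> < 1" using Q Q0 ps by (auto simp: \<theta>_def)
  have lim: "real Q * p / (real Q - p * s) = p / (1 - \<theta>)"
    using Q Q0 by (simp add: \<theta>_def field_simps)
  \<comment> \<open>Closed form of the recursion: \<open>\<tau> 0 = p\<close>, and the distance to
    the fixed point shrinks by the factor \<open>\<theta>\<close> each time.\<close>
  define \<tau> where "\<tau> n = p / (1 - \<theta>) * (1 - \<theta> ^ Suc n)" for n
  have \<tau>0: "\<tau> 0 = p" using \<theta> by (simp add: \<tau>_def)
  have \<tau>S: "\<tau> (Suc n) = p + \<tau> n * \<theta>" for n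
    using \<theta> by (simp add: \<tau>_def field_simps)
  have \<tau>p: "\<tau> n \<ge> p" for n
  proof (induction n)
    case (Suc n)
    then have "0 \<le> \<tau> n * \<theta>" using \<theta> p_gt_1 by (intro mult_nonneg_nonneg) linarith+
    then show ?case by (simp add: \<tau>S)
  qed (simp add: \<tau>0)
  let ?P = "\<lambda>t C. \<forall>u\<in>W. N u \<le> 1 \<longrightarrow> integrable lborel (\<lambda>x. \<bar>u x\<bar> powr t) \<and> (LINT x|lborel. \<bar>u x\<bar> powr t) \<le> C"
  have emb: "\<exists>C. ?P (\<tau> n) C" for n
  proof (induction n)
    case 0
    have "?P p 1" using Lp_le_N by (auto simp: W_iff Lp_def intro: order_trans)
    then show ?case unfolding \<tau>0 by blast
  next
    case (Suc n)
    then obtain C where C: "?P (\<tau> n) C" by blast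
    define T where "T = max C 1"
    define C' where "C' = 2 / unit_vol * 2 powr (p + \<tau> n * \<theta>) * (2 * T / unit_vol) powr \<theta>"
    have C'0: "C' \<ge> 0" using unit_vol_pos by (simp add: C'_def)
    have "?P (\<tau> (Suc n)) C'"
    proof (intro ballI impI)
      fix u assume u: "u \<in> W" "N u \<le> 1"
      have tn: "\<tau> n > 0" using \<tau>p[of n] p_gt_1 by linarith
      have i: "integrable lborel (\<lambda>x. \<bar>u x\<bar> powr \<tau> n)" and le: "(LINT x|lborel. \<bar>u x\<bar> powr \<tau> n) \<le> T"
        using C u by (auto simp: T_def intro: max.coboundedI1)
      have T0: "T > 0" by (simp add: T_def)
      note st = embedding_step[OF u(1) tn i le T0 Q0, folded \<theta>_def, folded C'_def]
      have "C' * N u \<le> C' * 1" using u C'0 by (intro mult_left_mono)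
      then show "integrable lborel (\<lambda>x. \<bar>u x\<bar> powr \<tau> (Suc n)) \<and> (LINT x|lborel. \<bar>u x\<bar> powr \<tau> (Suc n)) \<le> C'"
        using st unfolding \<tau>S by simp
    qed
    then show ?case by blast
  qed
  have "(\<lambda>n. p / (1 - \<theta>) * (1 - \<theta> ^ Suc n)) \<longlonglongrightarrow> p / (1 - \<theta>) * (1 - 0)"
    using \<theta> by (intro tendsto_intros LIMSEQ_Suc LIMSEQ_power_zero) auto
  then have "\<tau> \<longlonglongrightarrow> p / (1 - \<theta>)" by (simp add: \<tau>_def[abs_def])
  from order_tendstoD(1)[OF this, of t] t(2) lim have "\<forall>\<^sub>F n in sequentially. t < \<tau> n" by simp
  then obtain n where n: "t < \<tau> n" using eventually_happens'[OF sequentially_bot] by blast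
  obtain C where C: "?P (\<tau> n) C" using emb by blast
  have "?P t (1 + C)"
  proof (intro ballI impI)
    fix u assume u: "u \<in> W" "N u \<le> 1"
    note [measurable] = W_measurable[OF u(1)]
    have i: "integrable lborel (\<lambda>x. \<bar>u x\<bar> powr \<tau> n)" and le: "(LINT x|lborel. \<bar>u x\<bar> powr \<tau> n) \<le> C"
      using C u by auto
    have ip: "integrable lborel (\<lambda>x. \<bar>u x\<bar> powr p)" and lep: "(LINT x|lborel. \<bar>u x\<bar> powr p) \<le> 1"
      using u Lp_le_N[of u] by (auto simp: W_iff Lp_def)
    have pw: "\<bar>a\<bar> powr t \<le> \<bar>a\<bar> powr p + \<bar>a\<bar> powr \<tau> n" for a :: real
    proof (cases "\<bar>a\<bar> \<le> 1")
      case True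
      then have "\<bar>a\<bar> powr t \<le> \<bar>a\<bar> powr p" using t by (intro powr_mono') auto
      then show ?thesis by (simp add: add_increasing2)
    next
      case False
      then have "\<bar>a\<bar> powr t \<le> \<bar>a\<bar> powr \<tau> n" using n by (intro powr_mono) auto
      then show ?thesis by (simp add: add_increasing)
    qed
    have it: "integrable lborel (\<lambda>x. \<bar>u x\<bar> powr t)"
      by (rule Bochner_Integration.integrable_bound[OF Bochner_Integration.integrable_add[OF ip i]])
        (auto intro!: AE_I2 pw order_trans[OF pw])
    have "(LINT x|lborel. \<bar>u x\<bar> powr t) \<le> (LINT x|lborel. \<bar>u x\<bar> powr p + \<bar>u x\<bar> powr \<tau> n)"
      by (intro integral_mono it Bochner_Integration.integrable_add ip i pw)
    also have "\<dots> = (LINT x|lborel. \<bar>u x\<bar> powr p) + (LINT x|lborel. \<bar>u x\<bar> powr \<tau> n)"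
      by (intro Bochner_Integration.integral_add ip i)
    finally show "integrable lborel (\<lambda>x. \<bar>u x\<bar> powr t) \<and> (LINT x|lborel. \<bar>u x\<bar> powr t) \<le> 1 + C"
      using it le lep by simp
  qed
  then show ?thesis by blast
qed

lemma embedding:
  assumes Q: "real Q > p * s" and t: "p \<le> t" "t < real Q * p / (real Q - p * s)" and B: "B > 0"
  obtains C where "C \<ge> 0" "\<And>u. u \<in> W \<Longrightarrow> N u \<le> B \<Longrightarrow> integrable lborel (\<lambda>x. \<bar>u x\<bar> powr t)"
    "\<And>u. u \<in> W \<Longrightarrow> N u \<le> B \<Longrightarrow> (LINT x|lborel. \<bar>u x\<bar> powr t) \<le> C"
proof -
  obtain C where C: "\<And>u. u \<in> W \<Longrightarrow> N u \<le> 1 \<Longrightarrow> integrable lborel (\<lambda>x. \<bar>u x\<bar> powr t)"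
    "\<And>u. u \<in> W \<Longrightarrow> N u \<le> 1 \<Longrightarrow> (LINT x|lborel. \<bar>u x\<bar> powr t) \<le> C"
    using embedding_unit[OF Q t] by blast
  define b where "b = B powr (1 / p)"
  have b: "b > 0" "b powr p = B" using B by (auto simp: b_def powr_powr)
  have "integrable lborel (\<lambda>x. \<bar>u x\<bar> powr t) \<and> (LINT x|lborel. \<bar>u x\<bar> powr t) \<le> b powr t * \<bar>C\<bar>"
    if u: "u \<in> W" "N u \<le> B" for u
  proof -
    let ?v = "\<lambda>x. (1 / b) * u x"
    have v: "?v \<in> W" by (rule W_scale[OF u(1)])
    have "\<bar>1 / b\<bar> powr p = 1 / B" using b by (simp add: powr_divide)
    then have "N ?v = 1 / B * N u" by (simp only: N_scale)
    then have Nv: "N ?v \<le> 1" using u B by simp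
    have eq: "\<bar>u x\<bar> powr t = b powr t * \<bar>?v x\<bar> powr t" for x
      using b by (simp add: abs_mult powr_divide)
    have "(LINT x|lborel. \<bar>?v x\<bar> powr t) \<le> \<bar>C\<bar>" using C(2)[OF v Nv] by simp
    then have "b powr t * (LINT x|lborel. \<bar>?v x\<bar> powr t) \<le> b powr t * \<bar>C\<bar>" by (intro mult_left_mono) auto
    then show ?thesis unfolding eq using C(1)[OF v Nv] by (simp only: integral_mult_right_zero integrable_mult_right_iff) auto
  qed
  then show ?thesis using that[of "b powr t * \<bar>C\<bar>"] by simp
qed

section \<open>Non-vanishing\<close>

text \<open>Values of \<open>\<bar>u\<bar>\<close> up to \<open>l\<close> or from \<open>L\<close>
  on contribute at most 1/4 to the integral of \<open>\<bar>u\<bar> powr q\<close>. If every ball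
  had mass at most \<open>\<delta>\<close>, then \<open>ball_volume_le\<close> would give
  \<open>1 \<le> E * r powr (p * s) * D u x\<close> in the range between, which therefore adds at
  most 1/4 more; the total could not be 1.\<close>

lemma nonvanishing:
  assumes Q: "real Q > p * s" and q: "p < q" "q < real Q * p / (real Q - p * s)" and B: "B > 0"
  obtains r \<delta> where "r > 0" "\<delta> > 0" "r \<le> 1"
    "\<And>u. u \<in> W \<Longrightarrow> N u \<le> B \<Longrightarrow> (LINT x|lborel. \<bar>u x\<bar> powr q) = 1 \<Longrightarrow>
       \<exists>x. (LINT y|lborel. indicator (hball x r) y * \<bar>u y\<bar> powr p) > \<delta>"
proof -
  \<comment> \<open>An exponent strictly between \<open>q\<close> and the critical one, still
    covered by the embedding; it controls the large values.\<close>
  define q2 where "q2 = (q + real Q * p / (real Q - p * s)) / 2"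
  have q2: "q < q2" "q2 < real Q * p / (real Q - p * s)" "p \<le> q2"
  proof -
    have "a < (a + b) / 2 \<and> (a + b) / 2 < b" if "a < b" for a b :: real using that by simp
    from this[OF q(2)] show "q < q2" "q2 < real Q * p / (real Q - p * s)" by (simp_all only: q2_def)
    then show "p \<le> q2" using q(1) by linarith
  qed
  obtain C2 where C2: "C2 \<ge> 0" "\<And>u. u \<in> W \<Longrightarrow> N u \<le> B \<Longrightarrow> integrable lborel (\<lambda>x. \<bar>u x\<bar> powr q2)"
    "\<And>u. u \<in> W \<Longrightarrow> N u \<le> B \<Longrightarrow> (LINT x|lborel. \<bar>u x\<bar> powr q2) \<le> C2"
    using embedding[OF Q q2(3,2) B] by metis
  note c = unit_vol_pos
  define \<eta> where "\<eta> = 1 / (4 * (B + C2))"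
  have \<eta>: "\<eta> > 0" "\<eta> * B + \<eta> * C2 = 1 / 4"
  proof -
    have "B + C2 > 0" using B C2(1) by linarith
    then show "\<eta> > 0" "\<eta> * B + \<eta> * C2 = 1 / 4"
      unfolding distrib_left[symmetric] by (simp_all add: \<eta>_def)
  qed
  \<comment> \<open>The levels solve \<open>l powr (q - p) = \<eta>\<close> and
    \<open>L powr (q - q2) = \<eta>\<close>; the second exponent is negative, so \<open>L\<close>
    serves as a lower threshold.\<close>
  define l where "l = \<eta> powr (1 / (q - p))"
  define L where "L = \<eta> powr (1 / (q - q2))"
  have l: "l > 0" "l powr (q - p) = \<eta>" using \<eta> q by (auto simp: l_def powr_powr)
  have L: "L > 0" "L powr (q - q2) = \<eta>" using \<eta> q2 by (auto simp: L_def powr_powr)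
  define E where "E = 2 / unit_vol * (2 / l) powr p"
  have E: "E > 0" using c l by (simp add: E_def)
  define Y where "Y = L powr q * E * B"
  have Y: "Y > 0" using L E B by (simp add: Y_def)
  \<comment> \<open>\<open>r powr (p * s) * Y\<close> is the contribution of the middle range; this
    radius makes it at most 1/4.\<close>
  define r where "r = min 1 ((1 / (4 * Y)) powr (1 / (p * s)))"
  have ps: "p * s > 0" using s_pos by simp
  have r: "r > 0" "r \<le> 1" using Y by (auto simp: r_def)
  have rY: "r powr (p * s) * Y \<le> 1 / 4"
  proof -
    have "r powr (p * s) \<le> ((1 / (4 * Y)) powr (1 / (p * s))) powr (p * s)"
      using r ps by (intro powr_mono2) (auto simp: r_def)
    also have "\<dots> = 1 / (4 * Y)" using Y ps s_pos by (simp add: powr_powr)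
    finally have "r powr (p * s) * Y \<le> 1 / (4 * Y) * Y" using Y by (intro mult_right_mono) auto
    then show ?thesis using Y by simp
  qed
  \<comment> \<open>At this mass the second term of \<open>ball_volume_le\<close> is exactly half of
    the volume of the ball.\<close>
  define \<delta> where "\<delta> = unit_vol * r ^ Q / 2 / (2 / l) powr p"
  have \<delta>: "\<delta> > 0" "(2 / l) powr p * \<delta> = unit_vol * r ^ Q / 2" using c r l by (auto simp: \<delta>_def)
  have "\<exists>x. (LINT y|lborel. indicator (hball x r) y * \<bar>u y\<bar> powr p) > \<delta>"
    if u: "u \<in> W" "N u \<le> B" and one: "(LINT x|lborel. \<bar>u x\<bar> powr q) = 1" for u
  proof (rule ccontr)
    assume "\<not> ?thesis"
    then have small: "(LINT y|lborel. indicator (hball x r) y * \<bar>u y\<bar> powr p) \<le> \<delta>" for x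
      by (simp add: not_less)
    note [measurable] = W_measurable[OF u(1)]
    have ip: "integrable lborel (\<lambda>x. \<bar>u x\<bar> powr p)" and lep: "(LINT x|lborel. \<bar>u x\<bar> powr p) \<le> B"
      using u Lp_le_N[of u] by (auto simp: W_iff Lp_def)
    let ?w = "\<lambda>x. \<eta> * \<bar>u x\<bar> powr p + \<eta> * \<bar>u x\<bar> powr q2 + L powr q * E * r powr (p * s) * D u x"
    have pt: "AE x in lborel. \<bar>u x\<bar> powr q \<le> ?w x"
      using AE_D_integrable[OF u(1)]
    proof eventually_elim
      case (elim x)
      have nn: "0 \<le> \<eta> * \<bar>u x\<bar> powr p" "0 \<le> \<eta> * \<bar>u x\<bar> powr q2" "0 \<le> L powr q * E * r powr (p * s) * D u x"
        using \<eta> E D_nonneg by simp_all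
      have split: "\<bar>u x\<bar> powr q = \<bar>u x\<bar> powr (q - e) * \<bar>u x\<bar> powr e" for e
        by (simp add: powr_add[symmetric])
      consider "\<bar>u x\<bar> \<le> l" | "\<bar>u x\<bar> \<ge> L" | "l < \<bar>u x\<bar>" "\<bar>u x\<bar> < L" by linarith
      then show ?case
      proof cases
        case 1
        then have "\<bar>u x\<bar> powr (q - p) \<le> l powr (q - p)" using q by (intro powr_mono2) auto
        then have "\<bar>u x\<bar> powr q \<le> \<eta> * \<bar>u x\<bar> powr p" unfolding split[of p] l(2) by (intro mult_right_mono) auto
        then show ?thesis using nn by linarith
      next
        case 2
        then have "\<bar>u x\<bar> powr (q - q2) \<le> L powr (q - q2)" using q2 L by (intro powr_mono2') auto
        then have "\<bar>u x\<bar> powr q \<le> \<eta> * \<bar>u x\<bar> powr q2" unfolding split[of q2] L(2) by (intro mult_right_mono) auto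
        then show ?thesis using nn by linarith
      next
        case 3
        have "unit_vol * r ^ Q \<le> (2 / l) powr p * (r powr (real Q + p * s) * D u x)
          + (2 / l) powr p * (LINT y|lborel. indicator (hball x r) y * \<bar>u y\<bar> powr p)"
          using 3 by (intro ball_volume_le[OF u(1) elim p_pos(1) ip l(1) _ r(1)]) simp
        also have "\<dots> \<le> (2 / l) powr p * (r powr (real Q + p * s) * D u x) + (2 / l) powr p * \<delta>"
          by (intro add_left_mono mult_left_mono small) simp
        finally have "unit_vol * r ^ Q \<le> 2 * ((2 / l) powr p * (r powr (real Q + p * s) * D u x))"
          unfolding \<delta>(2) by simp
        also have "r powr (real Q + p * s) = r ^ Q * r powr (p * s)" using r by (simp add: powr_add powr_realpow)
        finally have "r ^ Q * unit_vol \<le> r ^ Q * (2 * ((2 / l) powr p * (r powr (p * s) * D u x)))"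
          by (simp add: mult_ac)
        then have "unit_vol \<le> 2 * ((2 / l) powr p * (r powr (p * s) * D u x))" using r by simp
        then have one_le: "1 \<le> E * r powr (p * s) * D u x" using c by (simp add: E_def field_simps)
        have "\<bar>u x\<bar> powr q \<le> L powr q * 1" using 3 q by (simp, intro powr_mono2) (use p_gt_1 in auto)
        also have "\<dots> \<le> L powr q * (E * r powr (p * s) * D u x)" by (intro mult_left_mono one_le) simp
        finally show ?thesis using nn by (simp add: mult.assoc)
      qed
    qed
    have iw: "integrable lborel ?w"
      using ip C2(2)[OF u] integrable_D[OF u(1)] by auto
    \<comment> \<open>Integrals of non-integrable functions are 0 by convention, so the value 1
      certifies integrability.\<close>
    have iq: "integrable lborel (\<lambda>x. \<bar>u x\<bar> powr q)" using one not_integrable_integral_eq by fastforce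
    have "(1::real) \<le> (LINT x|lborel. ?w x)"
      unfolding one[symmetric] by (intro integral_mono_AE iq iw pt)
    also have "\<dots> = \<eta> * (LINT x|lborel. \<bar>u x\<bar> powr p) + \<eta> * (LINT x|lborel. \<bar>u x\<bar> powr q2)
        + L powr q * E * r powr (p * s) * (LINT x|lborel. D u x)"
      using ip C2(2)[OF u] integrable_D[OF u(1)] by simp
    also have "\<dots> \<le> \<eta> * B + \<eta> * C2 + L powr q * E * r powr (p * s) * B"
    proof (intro add_mono mult_left_mono)
      show "(LINT x|lborel. D u x) \<le> B" using integral_D_le_N[OF u(1)] u(2) by linarith
    qed (use lep C2(3)[OF u] \<eta> E in auto)
    also have "\<dots> = 1 / 4 + r powr (p * s) * Y" unfolding \<eta>(2) by (simp add: Y_def)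
    also have "\<dots> \<le> 1 / 4 + 1 / 4" using rY by simp
    finally show False by simp
  qed
  then show ?thesis using that r \<delta> by blast
qed

end

section \<open>Local compactness\<close>

text \<open>The integrable weight makes constants integrable over a space of possibly infinite
  measure, so dominated convergence applies to bounded pointwise convergent sequences.\<close>

lemma weighted_L1_Cauchy:
  fixes f :: "nat \<Rightarrow> 'a \<Rightarrow> real"
  assumes f: "\<And>n. f n \<in> borel_measurable M" and C: "\<And>n x. \<bar>f n x\<bar> \<le> C"
    and conv: "\<And>x. convergent (\<lambda>n. f n x)" and \<omega>: "integrable M \<omega>" "\<And>x. \<omega> x > 0"
  shows "integrable M (\<lambda>x. \<omega> x * \<bar>f m x - f n x\<bar>)"
    and "e > 0 \<Longrightarrow> \<exists>n0. \<forall>m\<ge>n0. \<forall>n\<ge>n0. (LINT x|M. \<omega> x * \<bar>f m x - f n x\<bar>) < e"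
proof -
  note [measurable] = f borel_measurable_integrable[OF \<omega>(1)]
  define a where "a x = lim (\<lambda>n. f n x)" for x
  have a: "(\<lambda>n. f n x) \<longlonglongrightarrow> a x" for x
    using conv unfolding a_def by (simp add: convergent_LIMSEQ_iff)
  have am [measurable]: "a \<in> borel_measurable M" unfolding a_def by (intro borel_measurable_lim_metric f)
  have Ca: "\<bar>a x\<bar> \<le> C" for x
    by (rule LIMSEQ_le_const2[OF tendsto_rabs[OF a]]) (use C in blast)
  have bd: "norm (\<omega> x * \<bar>y - z\<bar>) \<le> 2 * C * \<omega> x" if "\<bar>y\<bar> \<le> C" "\<bar>z\<bar> \<le> C" for x y z
  proof -
    have "\<bar>y - z\<bar> \<le> 2 * C" using that by linarith
    then have "\<omega> x * \<bar>y - z\<bar> \<le> \<omega> x * (2 * C)" using \<omega>(2)[of x] by (intro mult_left_mono) auto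
    then show ?thesis using \<omega>(2)[of x] by (simp add: abs_mult mult_ac)
  qed
  have iC: "integrable M (\<lambda>x. 2 * C * \<omega> x)" using \<omega>(1) by simp
  have idif: "integrable M (\<lambda>x. \<omega> x * \<bar>g x - g' x\<bar>)"
    if "g \<in> borel_measurable M" "g' \<in> borel_measurable M" "\<And>x. \<bar>g x\<bar> \<le> C" "\<And>x. \<bar>g' x\<bar> \<le> C" for g g'
  proof (rule Bochner_Integration.integrable_bound[OF iC])
    note [measurable] = that(1,2)
    show "(\<lambda>x. \<omega> x * \<bar>g x - g' x\<bar>) \<in> borel_measurable M" by measurable
    show "AE x in M. norm (\<omega> x * \<bar>g x - g' x\<bar>) \<le> norm (2 * C * \<omega> x)"
    proof (rule AE_I2)
      fix x
      have "2 * C * \<omega> x \<le> norm (2 * C * \<omega> x)" by simp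
      with bd[OF that(3,4), of x x x] show "norm (\<omega> x * \<bar>g x - g' x\<bar>) \<le> norm (2 * C * \<omega> x)"
        by (rule order_trans)
    qed
  qed
  show "integrable M (\<lambda>x. \<omega> x * \<bar>f m x - f n x\<bar>)" by (intro idif f C)
  assume e: "e > 0"
  have "(\<lambda>n. LINT x|M. \<omega> x * \<bar>f n x - a x\<bar>) \<longlonglongrightarrow> (LINT x|M. 0)"
  proof (rule integral_dominated_convergence[where w = "\<lambda>x. 2 * C * \<omega> x"])
    show "AE x in M. (\<lambda>n. \<omega> x * \<bar>f n x - a x\<bar>) \<longlonglongrightarrow> 0"
    proof (rule AE_I2)
      fix x
      have "(\<lambda>n. \<omega> x * \<bar>f n x - a x\<bar>) \<longlonglongrightarrow> \<omega> x * \<bar>a x - a x\<bar>" by (intro tendsto_intros a)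
      then show "(\<lambda>n. \<omega> x * \<bar>f n x - a x\<bar>) \<longlonglongrightarrow> 0" by simp
    qed
    show "AE x in M. norm (\<omega> x * \<bar>f n x - a x\<bar>) \<le> 2 * C * \<omega> x" for n
      by (intro AE_I2 bd C Ca)
  qed (use iC in auto)
  then have "(\<lambda>n. LINT x|M. \<omega> x * \<bar>f n x - a x\<bar>) \<longlonglongrightarrow> 0" by simp
  from order_tendstoD(2)[OF this, of "e / 2"] e
  obtain n0 where n0: "\<And>n. n \<ge> n0 \<Longrightarrow> (LINT x|M. \<omega> x * \<bar>f n x - a x\<bar>) < e / 2"
    by (auto simp: eventually_sequentially)
  show "\<exists>n0. \<forall>m\<ge>n0. \<forall>n\<ge>n0. (LINT x|M. \<omega> x * \<bar>f m x - f n x\<bar>) < e"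
  proof (intro exI[of _ n0] allI impI)
    fix m n assume mn: "m \<ge> n0" "n \<ge> n0"
    have "(LINT x|M. \<omega> x * \<bar>f m x - f n x\<bar>) \<le> (LINT x|M. \<omega> x * \<bar>f m x - a x\<bar> + \<omega> x * \<bar>f n x - a x\<bar>)"
    proof (intro integral_mono Bochner_Integration.integrable_add idif C Ca f am)
      fix x
      have "\<bar>f m x - f n x\<bar> \<le> \<bar>f m x - a x\<bar> + \<bar>f n x - a x\<bar>" by linarith
      then show "\<omega> x * \<bar>f m x - f n x\<bar> \<le> \<omega> x * \<bar>f m x - a x\<bar> + \<omega> x * \<bar>f n x - a x\<bar>"
        using \<omega>(2)[of x] by (simp add: distrib_left[symmetric] del: distrib_left)
    qed
    also have "\<dots> = (LINT x|M. \<omega> x * \<bar>f m x - a x\<bar>) + (LINT x|M. \<omega> x * \<bar>f n x - a x\<bar>)"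
      by (intro Bochner_Integration.integral_add idif C Ca f am)
    also have "\<dots> < e / 2 + e / 2" by (intro add_strict_mono n0 mn)
    finally show "(LINT x|M. \<omega> x * \<bar>f m x - f n x\<bar>) < e" by simp
  qed
qed

context fractional_sobolev
begin

text \<open>A continuous substitute for the indicator of a ball; averages against it depend
  continuously on the centre.\<close>

definition tent :: "real \<Rightarrow> real ^ 'n \<Rightarrow> real" where
  "tent r z = max 0 (1 - h z / r)"

definition tent_mass :: "real \<Rightarrow> real" where
  "tent_mass r = (LINT z|lborel. tent r z)"

definition avg :: "real \<Rightarrow> (real ^ 'n \<Rightarrow> real) \<Rightarrow> real ^ 'n \<Rightarrow> real" where
  "avg r u x = (LINT y|lborel. tent r (inv x \<otimes> y) * u y) / tent_mass r"

lemma tent_measurable [measurable]: "tent r \<in> borel_measurable borel"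
  unfolding tent_def by measurable

lemma tent_nonneg [simp]: "tent r z \<ge> 0"
  by (simp add: tent_def)

lemma tent_le_indicator: "r > 0 \<Longrightarrow> tent r (inv x \<otimes> y) \<le> indicator (hball x r) y"
  by (auto simp: tent_def hball_def indicator_def field_simps)

lemma integrable_hball: "r > 0 \<Longrightarrow> integrable lborel (indicator (hball x r) :: _ \<Rightarrow> real)"
  using emeasure_hball[of r x] by (intro integrable_real_indicator) auto

lemma tent_integrable:
  assumes "r > 0"
  shows "integrable lborel (\<lambda>y. tent r (inv x \<otimes> y))"
  by (rule Bochner_Integration.integrable_bound[OF integrable_hball[OF assms, of x]])
    (use tent_le_indicator[OF assms] in auto)

lemma tent_integral: "(LINT y|lborel. tent r (inv x \<otimes> y)) = tent_mass r"
  unfolding tent_mass_def by (rule translate_integrable(2)) simp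

text \<open>The tent is at least 1/2 on the ball of half the radius. The resulting
  \<open>r ^ Q\<close> cancels that of the kernel bound in \<open>avg_close\<close>.\<close>

lemma tent_mass_ge:
  assumes r: "r > 0"
  shows "tent_mass r \<ge> unit_vol * (r / 2) ^ Q / 2" and "tent_mass r > 0"
proof -
  have "unit_vol * (r / 2) ^ Q / 2 = (LINT y|lborel. 1 / 2 * indicator (hball 0 (r / 2)) y)"
    using measure_hball[of "r / 2" 0] r by simp
  also have "\<dots> \<le> (LINT y|lborel. tent r (inv 0 \<otimes> y))"
  proof (intro integral_mono tent_integrable r integrable_mult_right integrable_hball)
    fix y
    show "1 / 2 * indicator (hball 0 (r / 2)) y \<le> tent r (inv 0 \<otimes> y)"
      using r by (auto simp: tent_def hball_def indicator_def field_simps)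
  qed (use r in auto)
  also have "\<dots> = tent_mass r" by (rule tent_integral)
  finally show 1: "tent_mass r \<ge> unit_vol * (r / 2) ^ Q / 2" .
  have "unit_vol * (r / 2) ^ Q / 2 > 0" using r unit_vol_pos by simp
  with 1 show "tent_mass r > 0" by linarith
qed

lemma abs_le_1_powr: "\<bar>a\<bar> \<le> 1 + \<bar>a\<bar> powr p"
proof (cases "\<bar>a\<bar> \<le> 1")
  case False
  then have "\<bar>a\<bar> powr 1 \<le> \<bar>a\<bar> powr p" using p_gt_1 by (intro powr_mono) auto
  then show ?thesis using False by simp
qed (simp add: add_increasing2)

text \<open>Beyond \<open>\<eta>\<close> the factor \<open>\<bar>a\<bar> powr (1 - p)\<close> is at
  most \<open>\<eta> powr (1 - p)\<close>. The bound is linear in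
  \<open>\<bar>a\<bar> powr p\<close>, so it can be integrated directly.\<close>

lemma abs_le_eta:
  assumes "\<eta> > 0"
  shows "\<bar>a\<bar> \<le> \<eta> + \<eta> powr (1 - p) * \<bar>a\<bar> powr p"
proof (cases "\<bar>a\<bar> \<le> \<eta>")
  case False
  then have a: "\<bar>a\<bar> > 0" using assms by linarith
  have "\<bar>a\<bar> powr (1 - p) \<le> \<eta> powr (1 - p)" using False assms p_gt_1 by (intro powr_mono2') auto
  then have "\<bar>a\<bar> powr (1 - p) * \<bar>a\<bar> powr p \<le> \<eta> powr (1 - p) * \<bar>a\<bar> powr p"
    by (intro mult_right_mono) auto
  moreover have "\<bar>a\<bar> powr (1 - p) * \<bar>a\<bar> powr p = \<bar>a\<bar>" using a by (simp add: powr_add[symmetric])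
  ultimately show ?thesis using assms by linarith
qed (simp add: add_increasing2)

lemma W_integrable_powr: "u \<in> W \<Longrightarrow> integrable lborel (\<lambda>x. \<bar>u x\<bar> powr p)"
  by (simp add: W_iff Lp_def)

lemma tent_u_integrable:
  assumes u: "u \<in> W" and r: "r > 0"
  shows "integrable lborel (\<lambda>y. tent r (inv x \<otimes> y) * u y)"
proof (rule Bochner_Integration.integrable_bound)
  note [measurable] = W_measurable[OF u]
  show "integrable lborel (\<lambda>y. indicator (hball x r) y + \<bar>u y\<bar> powr p)"
    by (intro Bochner_Integration.integrable_add integrable_hball r W_integrable_powr u)
  show "AE y in lborel. norm (tent r (inv x \<otimes> y) * u y) \<le> norm (indicator (hball x r) y + \<bar>u y\<bar> powr p)"
  proof (rule AE_I2)
    fix y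
    have "tent r (inv x \<otimes> y) * \<bar>u y\<bar> \<le> indicator (hball x r) y * (1 + \<bar>u y\<bar> powr p)"
      by (intro mult_mono tent_le_indicator r abs_le_1_powr) auto
    also have "\<dots> \<le> indicator (hball x r) y + \<bar>u y\<bar> powr p" by (auto simp: indicator_def)
    finally show "norm (tent r (inv x \<otimes> y) * u y) \<le> norm (indicator (hball x r) y + \<bar>u y\<bar> powr p)"
      by (simp add: abs_mult)
  qed
  show "(\<lambda>y. tent r (inv x \<otimes> y) * u y) \<in> borel_measurable lborel" by measurable
qed

lemma avg_bound:
  assumes u: "u \<in> W" "N u \<le> B" and r: "r > 0"
  shows "\<bar>avg r u x\<bar> \<le> (unit_vol * r ^ Q + B) / tent_mass r"
proof -
  note [measurable] = W_measurable[OF u(1)]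
  have "\<bar>LINT y|lborel. tent r (inv x \<otimes> y) * u y\<bar> \<le> (LINT y|lborel. \<bar>tent r (inv x \<otimes> y) * u y\<bar>)"
    by (rule integral_abs_bound)
  also have "\<dots> \<le> (LINT y|lborel. indicator (hball x r) y + \<bar>u y\<bar> powr p)"
  proof (intro integral_mono Bochner_Integration.integrable_add integrable_hball r W_integrable_powr u integrable_abs tent_u_integrable)
    fix y
    have "tent r (inv x \<otimes> y) * \<bar>u y\<bar> \<le> indicator (hball x r) y * (1 + \<bar>u y\<bar> powr p)"
      by (intro mult_mono tent_le_indicator r abs_le_1_powr) auto
    also have "\<dots> \<le> indicator (hball x r) y + \<bar>u y\<bar> powr p" by (auto simp: indicator_def)
    finally show "\<bar>tent r (inv x \<otimes> y) * u y\<bar> \<le> indicator (hball x r) y + \<bar>u y\<bar> powr p"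
      by (simp add: abs_mult)
  qed
  also have "\<dots> = unit_vol * r ^ Q + (LINT y|lborel. \<bar>u y\<bar> powr p)"
    using measure_hball[OF r, of x]
    by (subst Bochner_Integration.integral_add) (auto intro: integrable_hball r W_integrable_powr u)
  also have "\<dots> \<le> unit_vol * r ^ Q + B" using Lp_le_N[of u] u by simp
  finally show ?thesis using tent_mass_ge(2)[OF r] by (simp add: avg_def divide_right_mono)
qed

text \<open>Average \<open>\<bar>u x - u y\<bar>\<close> after splitting it at
  \<open>\<eta>\<close>. The kernel bound costs \<open>r powr (real Q + p * s)\<close>, the tent
  mass returns \<open>r ^ Q\<close>, and \<open>r powr (p * s)\<close> remains, which is small
  uniformly over bounded sets.\<close>

lemma avg_close:
  assumes u: "u \<in> W" and x: "integrable lborel (\<lambda>y. \<bar>u x - u y\<bar> powr p * K x y)"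
    and \<eta>: "\<eta> > 0" and r: "r > 0"
  shows "\<bar>u x - avg r u x\<bar> \<le> \<eta> + \<eta> powr (1 - p) * (2 * 2 ^ Q / unit_vol) * r powr (p * s) * D u x"
proof -
  note [measurable] = W_measurable[OF u]
  let ?b = "real Q + p * s"
  let ?c = "\<eta> powr (1 - p) * r powr ?b"
  note c = unit_vol_pos
  have m: "tent_mass r > 0" by (rule tent_mass_ge(2)[OF r])
  have it: "integrable lborel (\<lambda>y. tent r (inv x \<otimes> y) * (u x - u y))"
    unfolding right_diff_distrib
    by (intro Bochner_Integration.integrable_diff integrable_mult_left tent_integrable tent_u_integrable r u)
  have "(LINT y|lborel. tent r (inv x \<otimes> y) * (u x - u y)) =
      (LINT y|lborel. tent r (inv x \<otimes> y) * u x) - (LINT y|lborel. tent r (inv x \<otimes> y) * u y)"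
    unfolding right_diff_distrib
    by (intro Bochner_Integration.integral_diff integrable_mult_left tent_integrable tent_u_integrable r u)
  also have "(LINT y|lborel. tent r (inv x \<otimes> y) * u x) = tent_mass r * u x"
    by (simp add: tent_integral)
  finally have "u x - avg r u x = (LINT y|lborel. tent r (inv x \<otimes> y) * (u x - u y)) / tent_mass r"
    using m by (simp add: avg_def field_simps)
  then have "\<bar>u x - avg r u x\<bar> = \<bar>LINT y|lborel. tent r (inv x \<otimes> y) * (u x - u y)\<bar> / tent_mass r"
    using m by simp
  also have "\<dots> \<le> (\<eta> * tent_mass r + ?c * D u x) / tent_mass r"
  proof (rule divide_right_mono)
    have "\<bar>LINT y|lborel. tent r (inv x \<otimes> y) * (u x - u y)\<bar> \<le> (LINT y|lborel. \<bar>tent r (inv x \<otimes> y) * (u x - u y)\<bar>)"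
      by (rule integral_abs_bound)
    also have "\<dots> \<le> (LINT y|lborel. \<eta> * tent r (inv x \<otimes> y) + ?c * (\<bar>u x - u y\<bar> powr p * K x y))"
    proof (intro integral_mono integrable_abs it Bochner_Integration.integrable_add integrable_mult_right tent_integrable r x)
      fix y
      have "tent r (inv x \<otimes> y) * \<bar>u x - u y\<bar>
          \<le> tent r (inv x \<otimes> y) * (\<eta> + \<eta> powr (1 - p) * \<bar>u x - u y\<bar> powr p)"
        by (intro mult_left_mono abs_le_eta \<eta>) simp
      also have "\<dots> = \<eta> * tent r (inv x \<otimes> y) + \<eta> powr (1 - p) * (tent r (inv x \<otimes> y) * \<bar>u x - u y\<bar> powr p)"
        by (simp add: algebra_simps)
      also have "\<dots> \<le> \<eta> * tent r (inv x \<otimes> y) + \<eta> powr (1 - p) * (r powr ?b * (\<bar>u x - u y\<bar> powr p * K x y))"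
      proof (intro add_left_mono mult_left_mono)
        have "tent r (inv x \<otimes> y) * \<bar>u x - u y\<bar> powr p \<le> indicator (hball x r) y * \<bar>u x - u y\<bar> powr p"
          by (intro mult_right_mono tent_le_indicator r) simp
        also have "\<dots> \<le> r powr ?b * (\<bar>u x - u y\<bar> powr p * K x y)"
          using diff_le_kernel[of y x r u] by (cases "y \<in> hball x r") auto
        finally show "tent r (inv x \<otimes> y) * \<bar>u x - u y\<bar> powr p \<le> r powr ?b * (\<bar>u x - u y\<bar> powr p * K x y)" .
      qed simp
      finally show "\<bar>tent r (inv x \<otimes> y) * (u x - u y)\<bar>
          \<le> \<eta> * tent r (inv x \<otimes> y) + ?c * (\<bar>u x - u y\<bar> powr p * K x y)"
        by (simp add: abs_mult mult.assoc)
    qed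
    also have "\<dots> = \<eta> * tent_mass r + ?c * D u x"
      using x tent_integrable[OF r, of x]
      by (subst Bochner_Integration.integral_add) (auto simp: tent_integral D_def)
    finally show "\<bar>LINT y|lborel. tent r (inv x \<otimes> y) * (u x - u y)\<bar> \<le> \<eta> * tent_mass r + ?c * D u x" .
  qed (use m in simp)
  also have "\<dots> = \<eta> + ?c * D u x / tent_mass r" using m by (simp add: add_divide_distrib)
  also have "\<dots> \<le> \<eta> + ?c * D u x / (unit_vol * (r / 2) ^ Q / 2)"
    using r c D_nonneg by (intro add_left_mono divide_left_mono tent_mass_ge mult_pos_pos m) auto
  also have "\<dots> = \<eta> + \<eta> powr (1 - p) * (2 * 2 ^ Q / unit_vol) * r powr (p * s) * D u x"
    using r c by (simp add: powr_add powr_realpow power_divide)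
  finally show ?thesis .
qed

text \<open>For centres within distance 1 of \<open>x\<close> all tents live on one compact set
  \<open>KK\<close>, where they vary uniformly continuously with the centre. The integral of
  \<open>\<bar>u\<bar>\<close> over \<open>KK\<close> is controlled by \<open>B\<close>, so
  \<open>d\<close> does not depend on \<open>u\<close>.\<close>

lemma avg_equicontinuous:
  assumes r: "0 < r" "r \<le> 1" and B: "B \<ge> 0" and e: "e > 0"
  obtains d where "d > 0"
    "\<And>x' u. dist x' x < d \<Longrightarrow> u \<in> W \<Longrightarrow> N u \<le> B \<Longrightarrow> \<bar>avg r u x' - avg r u x\<bar> \<le> e"
proof -
  have m: "tent_mass r > 0" by (rule tent_mass_ge(2)[OF r(1)])
  define KK where "KK = (\<lambda>w. case w of (a, z) \<Rightarrow> a \<otimes> z) ` (cball x 1 \<times> {z. h z \<le> r})"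
  have cK: "compact KK"
    unfolding KK_def
    by (intro compact_continuous_image continuous_on_subset[OF continuous_mult] compact_Times compact_cball compact_h_ball r) auto
  have [measurable]: "KK \<in> sets borel" using cK by (simp add: borel_closed compact_imp_closed)
  have fK: "emeasure lborel KK < \<infinity>" using emeasure_bounded_finite[OF compact_imp_bounded[OF cK]] by simp
  define V where "V = measure lborel KK + B"
  have V: "V \<ge> 0" using B by (simp add: V_def)
  define e0 where "e0 = e * tent_mass r / (V + 1)"
  have e0: "e0 > 0" using e m V by (simp add: e0_def)
  define F where "F w = tent r (inv (fst w) \<otimes> snd w)" for w
  have "continuous_on (cball x 1 \<times> KK) F"
    unfolding F_def tent_def using r by (intro continuous_intros) auto
  then have "uniformly_continuous_on (cball x 1 \<times> KK) F"
    by (intro compact_uniformly_continuous compact_Times compact_cball cK)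
  then obtain d0 where d0: "d0 > 0" "\<And>w w'. w \<in> cball x 1 \<times> KK \<Longrightarrow> w' \<in> cball x 1 \<times> KK \<Longrightarrow> dist w' w < d0 \<Longrightarrow> dist (F w') (F w) < e0"
    using e0 unfolding uniformly_continuous_on_def by metis
  have out: "F (x', y) = 0" if "x' \<in> cball x 1" "y \<notin> KK" for x' y
  proof -
    have "y = x' \<otimes> (inv x' \<otimes> y)" by simp
    then have "\<not> h (inv x' \<otimes> y) \<le> r" using that unfolding KK_def by (metis (mono_tags, lifting) SigmaI case_prod_conv image_eqI mem_Collect_eq)
    then show ?thesis using r by (simp add: F_def tent_def field_simps)
  qed
  have "\<bar>avg r u x' - avg r u x\<bar> \<le> e" if x': "dist x' x < min d0 1" and u: "u \<in> W" "N u \<le> B" for x' u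
  proof -
    note [measurable] = W_measurable[OF u(1)]
    have diff: "\<bar>F (x', y) - F (x, y)\<bar> \<le> e0 * indicator KK y" for y
    proof (cases "y \<in> KK")
      case True
      have "dist (x', y) (x, y) < d0" using x' by (simp add: dist_Pair_Pair)
      with d0(2)[of "(x, y)" "(x', y)"] True x' show ?thesis by (simp add: dist_real_def dist_commute)
    next
      case False
      then show ?thesis using out[of x' y] out[of x y] x' by (simp add: dist_commute)
    qed
    have iK: "integrable lborel (indicator KK :: _ \<Rightarrow> real)" using fK by (intro integrable_real_indicator) auto
    have i1: "integrable lborel (\<lambda>y. F (x', y) * u y)" "integrable lborel (\<lambda>y. F (x, y) * u y)"
      unfolding F_def using tent_u_integrable[OF u(1) r(1)] by simp_all
    have "\<bar>(LINT y|lborel. F (x', y) * u y) - (LINT y|lborel. F (x, y) * u y)\<bar>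
        = \<bar>LINT y|lborel. F (x', y) * u y - F (x, y) * u y\<bar>"
      using i1 by simp
    also have "\<dots> \<le> (LINT y|lborel. \<bar>F (x', y) * u y - F (x, y) * u y\<bar>)" by (rule integral_abs_bound)
    also have "\<dots> \<le> (LINT y|lborel. e0 * (indicator KK y + \<bar>u y\<bar> powr p))"
    proof (intro integral_mono integrable_abs Bochner_Integration.integrable_diff i1 integrable_mult_right
        Bochner_Integration.integrable_add iK W_integrable_powr u)
      fix y
      have "\<bar>F (x', y) * u y - F (x, y) * u y\<bar> = \<bar>F (x', y) - F (x, y)\<bar> * \<bar>u y\<bar>"
        by (simp only: left_diff_distrib[symmetric] abs_mult)
      also have "\<dots> \<le> (e0 * indicator KK y) * (1 + \<bar>u y\<bar> powr p)"
        using e0 by (intro mult_mono diff abs_le_1_powr) auto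
      also have "\<dots> \<le> e0 * (indicator KK y + \<bar>u y\<bar> powr p)"
        using e0 by (auto simp: indicator_def)
      finally show "\<bar>F (x', y) * u y - F (x, y) * u y\<bar> \<le> e0 * (indicator KK y + \<bar>u y\<bar> powr p)" .
    qed
    also have "\<dots> = e0 * (measure lborel KK + (LINT y|lborel. \<bar>u y\<bar> powr p))"
      using iK W_integrable_powr[OF u(1)] by simp
    also have "\<dots> \<le> e0 * V" using Lp_le_N[of u] u e0 by (simp add: V_def)
    also have "\<dots> \<le> e * tent_mass r"
    proof -
      have "e0 * V \<le> e0 * (V + 1)" using e0 by simp
      also have "\<dots> = e * tent_mass r" using V by (simp add: e0_def)
      finally show ?thesis .
    qed
    finally have "\<bar>(LINT y|lborel. F (x', y) * u y) - (LINT y|lborel. F (x, y) * u y)\<bar> / tent_mass r \<le> e"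
      using m by (simp add: field_simps)
    moreover have "\<bar>avg r u x' - avg r u x\<bar>
        = \<bar>(LINT y|lborel. F (x', y) * u y) - (LINT y|lborel. F (x, y) * u y)\<bar> / tent_mass r"
      using m unfolding avg_def F_def diff_divide_distrib[symmetric] abs_divide by simp
    ultimately show ?thesis by simp
  qed
  then show ?thesis using that[of "min d0 1"] d0(1) by simp
qed

lemma avg_measurable:
  assumes u: "u \<in> W" and r: "0 < r" "r \<le> 1"
  shows "avg r u \<in> borel_measurable borel"
proof (rule borel_measurable_continuous_onI)
  show "continuous_on UNIV (avg r u)"
    unfolding continuous_on_iff
  proof (intro ballI allI impI)
    fix x :: "real ^ 'n" and e :: real assume "e > 0"
    then have "e / 2 > 0" by simp
    from avg_equicontinuous[OF r N_nonneg[of u] this, of x] obtain d where d: "d > 0"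
      "\<And>x' v. dist x' x < d \<Longrightarrow> v \<in> W \<Longrightarrow> N v \<le> N u \<Longrightarrow> \<bar>avg r v x' - avg r v x\<bar> \<le> e / 2" by metis
    then show "\<exists>d>0. \<forall>x'\<in>UNIV. dist x' x < d \<longrightarrow> dist (avg r u x') (avg r u x) < e"
      using u \<open>e > 0\<close> by (intro exI[of _ d]) (force simp: dist_real_def)
  qed
qed

text \<open>One diagonal extraction over a countable dense set of points and all radii at once;
  equicontinuity carries the Cauchy property over to every point.\<close>

lemma avg_convergent_subsequence:
  fixes u :: "nat \<Rightarrow> real ^ 'n \<Rightarrow> real"
  assumes u: "\<And>n. u n \<in> W" and B: "\<And>n. N (u n) \<le> B"
  obtains \<rho> :: "nat \<Rightarrow> nat" where "strict_mono \<rho>" "\<And>k x. convergent (\<lambda>n. avg (inverse (real (Suc k))) (u (\<rho> n)) x)"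
proof -
  let ?r = "\<lambda>k. inverse (real (Suc k))"
  have r: "0 < ?r k" "?r k \<le> 1" for k by (auto simp: field_simps)
  have B0: "B \<ge> 0" using N_nonneg[of "u 0"] B[of 0] by linarith
  obtain X :: "(real ^ 'n) set" where X: "countable X" "\<And>S. open S \<Longrightarrow> S \<noteq> {} \<Longrightarrow> \<exists>d\<in>X. d \<in> S"
    using countable_dense_setE by blast
  define M where "M k = (unit_vol * ?r k ^ Q + B) / tent_mass (?r k)" for k
  have M: "\<bar>avg (?r k) (u n) x\<bar> \<le> M k" for k n x
    unfolding M_def by (rule avg_bound[OF u B r(1)])
  have M0: "M k \<ge> 0" for k using M[of k 0 0] abs_ge_zero order_trans by blast
  \<comment> \<open>The bounds \<open>M k\<close> depend on the radius; normalising by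
    \<open>M k + 1\<close> gives the uniform bound 1 required for the diagonal extraction.\<close>
  define f where "f n = (\<lambda>(x, k). avg (?r k) (u n) x / (M k + 1))" for n
  have "countable (X \<times> (UNIV :: nat set))" using X by simp
  moreover have "norm (f n w) \<le> 1" for n w
    using M[of "snd w" n "fst w"] M0[of "snd w"] by (simp add: f_def case_prod_beta field_simps)
  ultimately obtain \<rho> where \<rho>: "strict_mono (\<rho> :: nat \<Rightarrow> nat)"
    "\<And>w. w \<in> X \<times> UNIV \<Longrightarrow> \<exists>l. (\<lambda>n. f (\<rho> n) w) \<longlonglongrightarrow> l"
    using function_convergent_subsequence[of "X \<times> UNIV" f 1] by metis
  have cX: "Cauchy (\<lambda>n. avg (?r k) (u (\<rho> n)) x)" if "x \<in> X" for k x
  proof -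
    have "(x, k) \<in> X \<times> UNIV" using that by simp
    then obtain l where "(\<lambda>n. f (\<rho> n) (x, k)) \<longlonglongrightarrow> l" using \<rho>(2) by blast
    then have "(\<lambda>n. (M k + 1) * f (\<rho> n) (x, k)) \<longlonglongrightarrow> (M k + 1) * l" by (intro tendsto_intros)
    moreover have "(M k + 1) * f n (x, k) = avg (?r k) (u n) x" for n
      using M0[of k] by (simp add: f_def)
    ultimately show ?thesis using LIMSEQ_imp_Cauchy by simp
  qed
  have "Cauchy (\<lambda>n. avg (?r k) (u (\<rho> n)) x)" for k x
  proof (rule metric_CauchyI)
    fix e :: real assume e: "e > 0"
    then have "e / 3 > 0" by simp
    from avg_equicontinuous[OF r B0 this, of x k] obtain d where d: "d > 0"
      "\<And>x' u. dist x' x < d \<Longrightarrow> u \<in> W \<Longrightarrow> N u \<le> B \<Longrightarrow> \<bar>avg (?r k) u x' - avg (?r k) u x\<bar> \<le> e / 3" by metis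
    obtain x' where x': "x' \<in> X" "dist x' x < d"
      using X(2)[of "ball x d"] d(1) by (auto simp: dist_commute)
    obtain n0 where n0: "\<And>m n. m \<ge> n0 \<Longrightarrow> n \<ge> n0 \<Longrightarrow> dist (avg (?r k) (u (\<rho> m)) x') (avg (?r k) (u (\<rho> n)) x') < e / 3"
      using metric_CauchyD[OF cX[OF x'(1), of k], of "e / 3"] e by auto
    show "\<exists>M. \<forall>m\<ge>M. \<forall>n\<ge>M. dist (avg (?r k) (u (\<rho> m)) x) (avg (?r k) (u (\<rho> n)) x) < e"
    proof (intro exI[of _ n0] allI impI)
      fix m n assume "m \<ge> n0" "n \<ge> n0"
      from n0[OF this] d(2)[OF x'(2) u B, of "\<rho> m"] d(2)[OF x'(2) u B, of "\<rho> n"]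
      show "dist (avg (?r k) (u (\<rho> m)) x) (avg (?r k) (u (\<rho> n)) x) < e"
        unfolding dist_real_def by linarith
    qed
  qed
  then show ?thesis using that[OF \<rho>(1)] by (simp add: Cauchy_convergent_iff)
qed

text \<open>The averages converge pointwise and approximate the functions uniformly in
  \<open>n\<close>. Hence the functions are Cauchy in a weighted \<open>L\<^sup>1\<close> norm, a
  subsequence is Cauchy almost everywhere, and the positive weight can be divided out.\<close>

lemma AE_convergent_subsequence:
  fixes u :: "nat \<Rightarrow> real ^ 'n \<Rightarrow> real"
  assumes u: "\<And>n. u n \<in> W" and B: "\<And>n. N (u n) \<le> B"
  obtains \<rho> :: "nat \<Rightarrow> nat" and v where "strict_mono \<rho>" "v \<in> borel_measurable borel"
    "AE x in lborel. (\<lambda>n. u (\<rho> n) x) \<longlonglongrightarrow> v x"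
proof -
  let ?r = "\<lambda>k. inverse (real (Suc k))"
  have r: "0 < ?r k" "?r k \<le> 1" for k by (auto simp: field_simps)
  have B0: "B \<ge> 0" using N_nonneg[of "u 0"] B[of 0] by linarith
  note c = unit_vol_pos
  note [measurable] = W_measurable[OF u]
  \<comment> \<open>Integrability of the weight treats the whole group at once;
    \<open>\<omega> \<le> 1\<close> lets the terms with \<open>D\<close> and with
    \<open>\<bar>w n x\<bar> powr p\<close> be bounded without weight.\<close>
  obtain \<omega> :: "real ^ 'n \<Rightarrow> real" where \<omega>: "\<omega> \<in> borel_measurable lborel" "\<And>x. \<omega> x > 0" "\<And>x. \<omega> x \<le> 1"
    "integrable lborel \<omega>"
    by (rule sigma_finite_measure.obtain_positive_integrable_function[OF lborel.sigma_finite_measure_axioms]) (rule that)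
  note [measurable] = \<omega>(1)
  obtain \<rho> where \<rho>: "strict_mono \<rho>" "\<And>k x. convergent (\<lambda>n. avg (?r k) (u (\<rho> n)) x)"
    by (rule avg_convergent_subsequence[OF u B]) (rule that)
  define w where "w n = u (\<rho> n)" for n
  have wW: "w n \<in> W" and wB: "N (w n) \<le> B" for n using u B by (auto simp: w_def)
  note [measurable] = W_measurable[OF wW]
  define J where "J = (LINT x|lborel. \<omega> x)"
  have J: "J \<ge> 0" unfolding J_def using \<omega>(2) by (intro Bochner_Integration.integral_nonneg) (simp add: less_imp_le)
  have avg_m: "avg (?r k) (w n) \<in> borel_measurable lborel" for k n
    using avg_measurable[OF wW r] by simp
  note avg_L1 = weighted_L1_Cauchy[where f = "\<lambda>n. avg (?r k) (w n)" for k,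
      OF avg_m avg_bound[OF wW wB r(1)] \<rho>(2)[folded w_def] \<omega>(4,2)]
  have iu: "integrable lborel (\<lambda>x. \<omega> x * w n x)" for n
  proof (rule Bochner_Integration.integrable_bound)
    show "integrable lborel (\<lambda>x. \<omega> x + \<bar>w n x\<bar> powr p)"
      by (intro Bochner_Integration.integrable_add \<omega> W_integrable_powr wW)
    show "AE x in lborel. norm (\<omega> x * w n x) \<le> norm (\<omega> x + \<bar>w n x\<bar> powr p)"
    proof (rule AE_I2)
      fix x
      have "\<omega> x * \<bar>w n x\<bar> \<le> \<omega> x * (1 + \<bar>w n x\<bar> powr p)"
        using \<omega>(2)[of x] by (intro mult_left_mono abs_le_1_powr) auto
      also have "\<dots> \<le> \<omega> x + 1 * \<bar>w n x\<bar> powr p"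
        unfolding distrib_left using \<omega>(3)[of x] by (intro add_mono mult_right_mono) auto
      finally show "norm (\<omega> x * w n x) \<le> norm (\<omega> x + \<bar>w n x\<bar> powr p)"
        using \<omega>(2)[of x] by (simp add: abs_mult)
    qed
  qed simp
  have cauchy: "\<exists>n0. \<forall>i\<ge>n0. \<forall>j\<ge>n0. (LINT x|lborel. norm (\<omega> x * w i x - \<omega> x * w j x)) < e" if e: "e > 0" for e
  proof -
    \<comment> \<open>Three errors share \<open>e\<close>. The order matters: \<open>E\<close> grows
      as \<open>\<eta>\<close> shrinks, so the radius index \<open>k\<close> is chosen after
      \<open>\<eta>\<close>, and \<open>n0\<close> after \<open>k\<close>.\<close>
    define \<eta> where "\<eta> = e / (6 * (J + 1))"
    have \<eta>: "\<eta> > 0" using e J by (simp add: \<eta>_def)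
    have \<eta>J: "2 * \<eta> * J \<le> e / 3"
    proof -
      have "2 * \<eta> * J \<le> 2 * \<eta> * (J + 1)" using \<eta> by simp
      also have "\<dots> = e / 3"
      proof -
        have "2 * (e / (6 * z)) * z = e / 3" if "z \<noteq> 0" for z using that by simp
        from this[of "J + 1"] show ?thesis using J unfolding \<eta>_def by linarith
      qed
      finally show ?thesis .
    qed
    define E where "E = \<eta> powr (1 - p) * (2 * 2 ^ Q / unit_vol)"
    have E: "E \<ge> 0" using c by (simp add: E_def)
    have "(\<lambda>k. E * ?r k powr (p * s) * (2 * B)) \<longlonglongrightarrow> E * 0 powr (p * s) * (2 * B)"
      using s_pos by (intro tendsto_intros tendsto_powr' LIMSEQ_inverse_real_of_nat) auto
    then have "(\<lambda>k. E * ?r k powr (p * s) * (2 * B)) \<longlonglongrightarrow> 0" by simp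
    from order_tendstoD(2)[OF this, of "e / 3"] e obtain k where k: "E * ?r k powr (p * s) * (2 * B) < e / 3"
      using eventually_happens'[OF sequentially_bot] by fastforce
    define E' where "E' = E * ?r k powr (p * s)"
    have E': "E' \<ge> 0" using E by (simp add: E'_def)
    obtain n0 where n0: "\<And>m n. m \<ge> n0 \<Longrightarrow> n \<ge> n0 \<Longrightarrow>
        (LINT x|lborel. \<omega> x * \<bar>avg (?r k) (w m) x - avg (?r k) (w n) x\<bar>) < e / 3"
      using avg_L1(2)[of "e / 3" k] e by auto
    show ?thesis
    proof (intro exI[of _ n0] allI impI)
      fix i j assume ij: "i \<ge> n0" "j \<ge> n0"
      let ?A = "\<lambda>x. \<omega> x * \<bar>avg (?r k) (w i) x - avg (?r k) (w j) x\<bar>"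
      have ii: "integrable lborel (\<lambda>x. 2 * \<eta> * \<omega> x + E' * (D (w i) x + D (w j) x) + ?A x)"
        by (intro Bochner_Integration.integrable_add integrable_mult_right \<omega> integrable_D wW avg_L1(1))
      have "(LINT x|lborel. norm (\<omega> x * w i x - \<omega> x * w j x))
          \<le> (LINT x|lborel. 2 * \<eta> * \<omega> x + E' * (D (w i) x + D (w j) x) + ?A x)"
      proof (rule integral_mono_AE)
        show "integrable lborel (\<lambda>x. norm (\<omega> x * w i x - \<omega> x * w j x))"
          by (intro integrable_norm Bochner_Integration.integrable_diff iu)
        show "AE x in lborel. norm (\<omega> x * w i x - \<omega> x * w j x)
            \<le> 2 * \<eta> * \<omega> x + E' * (D (w i) x + D (w j) x) + ?A x"
          using AE_D_integrable[OF wW[of i]] AE_D_integrable[OF wW[of j]]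
        proof eventually_elim
          case (elim x)
          note avg_close[OF wW elim(1) \<eta> r(1), of k] avg_close[OF wW elim(2) \<eta> r(1), of k]
          then have "\<bar>w i x - avg (?r k) (w i) x\<bar> \<le> \<eta> + E' * D (w i) x"
            "\<bar>w j x - avg (?r k) (w j) x\<bar> \<le> \<eta> + E' * D (w j) x"
            by (simp_all add: E'_def E_def mult.assoc)
          then have "\<bar>w i x - w j x\<bar> \<le> 2 * \<eta> + E' * (D (w i) x + D (w j) x)
              + \<bar>avg (?r k) (w i) x - avg (?r k) (w j) x\<bar>"
            unfolding distrib_left by linarith
          then have "\<omega> x * \<bar>w i x - w j x\<bar> \<le> \<omega> x * (2 * \<eta> + E' * (D (w i) x + D (w j) x)
              + \<bar>avg (?r k) (w i) x - avg (?r k) (w j) x\<bar>)"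
            using \<omega>(2)[of x] by (intro mult_left_mono) auto
          also have "\<dots> = 2 * \<eta> * \<omega> x + \<omega> x * (E' * (D (w i) x + D (w j) x)) + ?A x"
            by (simp add: algebra_simps)
          also have "\<dots> \<le> 2 * \<eta> * \<omega> x + 1 * (E' * (D (w i) x + D (w j) x)) + ?A x"
          proof (intro add_mono order_refl)
            have "0 \<le> E' * (D (w i) x + D (w j) x)" using E' D_nonneg by (intro mult_nonneg_nonneg add_nonneg_nonneg)
            then show "\<omega> x * (E' * (D (w i) x + D (w j) x)) \<le> 1 * (E' * (D (w i) x + D (w j) x))"
              using \<omega>(3)[of x] by (rule mult_right_mono[rotated])
          qed
          moreover have "norm (\<omega> x * w i x - \<omega> x * w j x) = \<omega> x * \<bar>w i x - w j x\<bar>"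
            using \<omega>(2)[of x] by (simp add: right_diff_distrib[symmetric] abs_mult del: right_diff_distrib)
          ultimately show ?case by simp
        qed
      qed (rule ii)
      also have "\<dots> = 2 * \<eta> * J + E' * ((LINT x|lborel. D (w i) x) + (LINT x|lborel. D (w j) x)) + (LINT x|lborel. ?A x)"
        using \<omega>(4) integrable_D[OF wW] avg_L1(1)[of k i j] by (simp add: J_def)
      also have "\<dots> \<le> 2 * \<eta> * J + E' * (B + B) + (LINT x|lborel. ?A x)"
      proof (intro add_mono mult_left_mono E')
        show "(LINT x|lborel. D (w i) x) \<le> B" "(LINT x|lborel. D (w j) x) \<le> B"
          using integral_D_le_N[OF wW] wB order_trans by blast+
      qed (use \<eta> J in auto)
      also have "\<dots> < e / 3 + e / 3 + e / 3"
        using \<eta>J k n0[OF ij] unfolding E'_def[symmetric] mult_2 by linarith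
      finally show "(LINT x|lborel. norm (\<omega> x * w i x - \<omega> x * w j x)) < e" by simp
    qed
  qed
  obtain \<tau> where \<tau>: "strict_mono \<tau>" "AE x in lborel. Cauchy (\<lambda>i. \<omega> x * w (\<tau> i) x)"
    using cauchy_L1_AE_cauchy_subseq[of lborel "\<lambda>n x. \<omega> x * w n x", OF iu cauchy] by blast
  define v where "v x = lim (\<lambda>i. w (\<tau> i) x)" for x
  have "AE x in lborel. (\<lambda>n. u ((\<rho> \<circ> \<tau>) n) x) \<longlonglongrightarrow> v x"
    using \<tau>(2)
  proof eventually_elim
    case (elim x)
    then obtain l where "(\<lambda>i. \<omega> x * w (\<tau> i) x) \<longlonglongrightarrow> l" by (auto simp: Cauchy_convergent_iff convergent_def)
    then have "(\<lambda>i. inverse (\<omega> x) * (\<omega> x * w (\<tau> i) x)) \<longlonglongrightarrow> inverse (\<omega> x) * l" by (intro tendsto_intros)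
    moreover have "inverse (\<omega> x) * (\<omega> x * w (\<tau> i) x) = w (\<tau> i) x" for i using \<omega>(2)[of x] by simp
    ultimately have "convergent (\<lambda>i. w (\<tau> i) x)" by (auto simp: convergent_def)
    then show ?case by (simp add: convergent_LIMSEQ_iff v_def w_def)
  qed
  moreover have "v \<in> borel_measurable borel" unfolding v_def by (rule borel_measurable_lim_metric) simp
  moreover have "strict_mono (\<rho> \<circ> \<tau>)" using \<rho>(1) \<tau>(1) by (rule strict_mono_o)
  ultimately show ?thesis using that by blast
qed

end

section \<open>The constrained minimiser\<close>

locale subcritical = fractional_sobolev G k \<sigma> h Q s p
  for G :: "(real ^ 'n) monoid" (structure) and k :: nat and \<sigma> :: "'n \<Rightarrow> nat"
    and h :: "real ^ 'n \<Rightarrow> real" and Q :: nat and s p :: real +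
  fixes q :: real
  assumes Q_gt: "real Q > p * s" and p_less_q: "p < q" and q_less: "q < real Q * p / (real Q - p * s)"
begin

lemma q_pos [simp]: "0 < q" "q \<noteq> 0" "0 \<le> q" and q_gt_1: "1 < q"
  using p_less_q p_gt_1 by auto

definition R :: "(real ^ 'n \<Rightarrow> real) \<Rightarrow> real" where
  "R u = (LINT x|lborel. \<bar>u x\<bar> powr q)"

lemma R_nonneg: "R u \<ge> 0"
  by (simp add: R_def)

lemma R_scale: "R (\<lambda>x. c * u x) = \<bar>c\<bar> powr q * R u"
  unfolding R_def by (rule integral_powr_scale)

lemma Lq: "u \<in> W \<Longrightarrow> Lp lborel q u"
proof -
  assume u: "u \<in> W"
  have "N u + 1 > 0" using N_nonneg[of u] by linarith
  from embedding[OF Q_gt less_imp_le[OF p_less_q] q_less this] obtain C where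
    "\<And>v. v \<in> W \<Longrightarrow> N v \<le> N u + 1 \<Longrightarrow> integrable lborel (\<lambda>x. \<bar>v x\<bar> powr q)" by metis
  from this[OF u] W_measurable[OF u] show ?thesis by (simp add: Lp_def)
qed

lemma R_pos: "u \<in> W \<Longrightarrow> nontrivial u \<Longrightarrow> R u > 0"
proof -
  assume u: "u \<in> W" "nontrivial u"
  have "R u \<noteq> 0"
  proof
    assume "R u = 0"
    then have "AE x in lborel. \<bar>u x\<bar> powr q = 0"
      unfolding R_def using Lp_integrable[OF Lq[OF u(1)]]
      by (subst (asm) integral_nonneg_eq_0_iff_AE) auto
    then have "AE x in lborel. u x = 0" by simp
    then show False using u(2) by (simp add: nontrivial_def)
  qed
  then show ?thesis using R_nonneg[of u] by linarith
qed

lemma R_translate: "u \<in> W \<Longrightarrow> R (\<lambda>x. u (a \<otimes> x)) = R u"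
  unfolding R_def using W_measurable[of u] by (intro translate_integrable(2)[of "\<lambda>x. \<bar>u x\<bar> powr q"]) simp

lemma R_normalise:
  assumes "R v > 0"
  shows "R (\<lambda>x. R v powr (- 1 / q) * v x) = 1"
proof -
  have "R (\<lambda>x. R v powr (- 1 / q) * v x) = R v powr (- 1) * R v powr 1"
    using assms by (simp add: R_scale powr_powr)
  also have "\<dots> = 1" using assms by (simp add: powr_add[symmetric] del: powr_one)
  finally show ?thesis .
qed

text \<open>The best embedding constant for \<open>p\<close>-th powers. The real \<open>Inf\<close>
  is genuine because \<open>normalised_exists\<close> supplies an element and \<open>N\<close> is
  nonnegative.\<close>

definition sobolev_const :: real where
  "sobolev_const = Inf (N ` {v \<in> W0. R v = 1})"

lemma normalised_exists: "\<exists>v\<in>W0. R v = 1"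
proof -
  obtain \<phi> :: "real ^ 'n \<Rightarrow> real" where \<phi>: "\<phi> \<in> test_functions" "\<And>x. norm x < 1 \<Longrightarrow> \<phi> x > 0"
    using bump_exists by blast
  have "nontrivial \<phi>"
    unfolding nontrivial_def
  proof
    assume "AE x in lborel. \<phi> x = 0"
    then have "AE x in lborel. x \<notin> ball (0 :: real ^ 'n) 1" by eventually_elim (use \<phi>(2) in force)
    then have "ball (0 :: real ^ 'n) 1 \<in> null_sets lborel" by (subst (asm) AE_iff_null_sets[symmetric]) auto
    then have "negligible (ball (0 :: real ^ 'n) 1)" by (simp add: negligible_iff_null_sets null_sets_completionI)
    then show False using open_not_negligible[of "ball (0 :: real ^ 'n) 1"] by simp
  qed
  then have pos: "R \<phi> > 0" by (intro R_pos test_in_W \<phi>)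
  show ?thesis
    using R_normalise[OF pos] W0_scale[OF test_in_W0[OF \<phi>(1)]]
    by (intro bexI[of _ "\<lambda>x. R \<phi> powr (- 1 / q) * \<phi> x"])
qed

lemma sobolev_const_le: "v \<in> W0 \<Longrightarrow> R v = 1 \<Longrightarrow> sobolev_const \<le> N v"
  unfolding sobolev_const_def by (rule cInf_lower) (auto intro!: bdd_belowI[of _ 0] N_nonneg)

lemma sobolev_inequality:
  assumes v: "v \<in> W0"
  shows "sobolev_const * R v powr (p / q) \<le> N v"
proof (cases "R v = 0")
  case False
  then have pos: "R v > 0" using R_nonneg[of v] by linarith
  have "sobolev_const \<le> N (\<lambda>x. R v powr (- 1 / q) * v x)"
    by (intro sobolev_const_le W0_scale v R_normalise pos)
  also have "\<dots> = R v powr (- (p / q)) * N v" by (simp add: N_scale powr_powr)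
  finally have "sobolev_const * R v powr (p / q) \<le> (R v powr (- (p / q)) * N v) * R v powr (p / q)"
    by (intro mult_right_mono) auto
  also have "\<dots> = N v * (R v powr (- (p / q)) * R v powr (p / q))" by (simp only: mult_ac)
  also have "\<dots> = N v" using pos by (simp add: powr_add[symmetric])
  finally show ?thesis .
qed (simp add: N_nonneg)

text \<open>A normalised \<open>v\<close> with \<open>N v < \<epsilon>\<close> could be scaled up
  until \<open>N\<close> is still at most 1 while \<open>R\<close> equals \<open>C + 2\<close>,
  beyond the embedding bound \<open>C\<close>; \<open>\<epsilon>\<close> is chosen for this.\<close>

lemma sobolev_const_pos: "sobolev_const > 0"
proof -
  obtain C where C: "C \<ge> 0" "\<And>u. u \<in> W \<Longrightarrow> N u \<le> 1 \<Longrightarrow> (LINT x|lborel. \<bar>u x\<bar> powr q) \<le> C"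
    using embedding[OF Q_gt less_imp_le[OF p_less_q] q_less zero_less_one] by metis
  define \<epsilon> where "\<epsilon> = (C + 2) powr (- p / q)"
  have e: "\<epsilon> > 0" using C(1) by (simp add: \<epsilon>_def)
  have "\<epsilon> \<le> sobolev_const"
    unfolding sobolev_const_def
  proof (rule cInf_greatest)
    show "N ` {v \<in> W0. R v = 1} \<noteq> {}" using normalised_exists by blast
    fix a assume "a \<in> N ` {v \<in> W0. R v = 1}"
    then obtain v where v: "a = N v" "v \<in> W0" "R v = 1" by blast
    show "\<epsilon> \<le> a"
    proof (rule ccontr)
      assume "\<not> \<epsilon> \<le> a"
      then have lt: "N v < \<epsilon>" using v by simp
      define c where "c = \<epsilon> powr (- 1 / p)"
      have "\<bar>c\<bar> powr p = \<epsilon> powr (- 1 / p * p)" by (simp only: c_def powr_powr abs_of_nonneg powr_ge_zero)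
      then have "\<bar>c\<bar> powr p = 1 / \<epsilon>" using e by (simp add: powr_minus_divide)
      then have "N (\<lambda>x. c * v x) = 1 / \<epsilon> * N v" by (simp only: N_scale)
      then have "N (\<lambda>x. c * v x) \<le> 1" using lt e by simp
      then have "R (\<lambda>x. c * v x) \<le> C" unfolding R_def by (intro C(2) W_scale W0_imp_W v)
      moreover have "R (\<lambda>x. c * v x) = C + 2" using C(1) v(3) by (simp add: R_scale c_def \<epsilon>_def powr_powr)
      ultimately show False by simp
    qed
  qed
  then show ?thesis using e by linarith
qed

section \<open>Compactness of minimising sequences up to translation\<close>

lemma minimising_sequence:
  obtains u where "\<And>n. u n \<in> W0" "\<And>n::nat. R (u n) = 1" "\<And>n. N (u n) \<le> sobolev_const + 1"
    "(\<lambda>n. N (u n)) \<longlonglongrightarrow> sobolev_const"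
proof -
  have "\<exists>v\<in>W0. R v = 1 \<and> N v < sobolev_const + inverse (real (Suc n))" for n
  proof -
    have "Inf (N ` {v \<in> W0. R v = 1}) < sobolev_const + inverse (real (Suc n))"
      unfolding sobolev_const_def[symmetric] by simp
    from cInf_lessD[OF _ this] normalised_exists show ?thesis by blast
  qed
  then obtain u where u: "\<And>n. u n \<in> W0" "\<And>n. R (u n) = 1"
    "\<And>n. N (u n) < sobolev_const + inverse (real (Suc n))" by metis
  have "(\<lambda>n. sobolev_const + inverse (real (Suc n))) \<longlonglongrightarrow> sobolev_const + 0"
    by (intro tendsto_intros LIMSEQ_inverse_real_of_nat)
  then have lim: "(\<lambda>n. sobolev_const + inverse (real (Suc n))) \<longlonglongrightarrow> sobolev_const" by simp
  have "(\<lambda>n. N (u n)) \<longlonglongrightarrow> sobolev_const"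
  proof (rule tendsto_sandwich[OF _ _ tendsto_const lim])
    show "\<forall>\<^sub>F n in sequentially. sobolev_const \<le> N (u n)"
      using sobolev_const_le u(1,2) by simp
    show "\<forall>\<^sub>F n in sequentially. N (u n) \<le> sobolev_const + inverse (real (Suc n))"
      using u(3) by (intro always_eventually allI less_imp_le)
  qed
  moreover have "N (u n) \<le> sobolev_const + 1" for n
  proof -
    have "inverse (real (Suc n)) \<le> 1" by (simp add: field_simps)
    then show ?thesis using u(3)[of n] by linarith
  qed
  ultimately show ?thesis by (intro that[of u] u)
qed

text \<open>Integrability with the larger exponent \<open>q\<close> prevents local loss of mass:
  below the level \<open>l\<close> dominated convergence on the ball applies, and above it
  \<open>\<bar>u n y\<bar> powr p\<close> is at most
  \<open>\<delta> / 2 * \<bar>u n y\<bar> powr q\<close>, with integral at most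
  \<open>\<delta> / 2\<close>.\<close>

lemma zero_limit_contradiction:
  assumes u: "\<And>n::nat. u n \<in> W" "\<And>n. R (u n) = 1" and r: "r > 0" and \<delta>: "\<delta> > 0"
    and ge: "\<And>n. (LINT y|lborel. indicator (hball 0 r) y * \<bar>u n y\<bar> powr p) > \<delta>"
    and lim: "AE x in lborel. (\<lambda>n. u n x) \<longlonglongrightarrow> 0"
  shows False
proof -
  note [measurable] = W_measurable[OF u(1)]
  \<comment> \<open>Solves \<open>l powr (p - q) = \<delta> / 2\<close>; the exponent is negative,
    so the same bound holds at all larger values.\<close>
  define l where "l = (\<delta> / 2) powr (1 / (p - q))"
  have l: "l > 0" "l powr (p - q) = \<delta> / 2" using \<delta> p_less_q by (auto simp: l_def powr_powr)
  let ?B = "hball 0 r"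
  let ?f = "\<lambda>n y. indicator ?B y * min \<bar>u n y\<bar> l powr p"
  have iB: "integrable lborel (\<lambda>y. l powr p * indicator ?B y)"
    by (intro integrable_mult_right integrable_hball r)
  have bd: "norm (?f n y) \<le> l powr p * indicator ?B y" for n y
  proof -
    have "min \<bar>u n y\<bar> l powr p \<le> l powr p" using l by (intro powr_mono2) auto
    then show ?thesis by (auto simp: indicator_def)
  qed
  have fi: "integrable lborel (?f n)" for n
    by (rule Bochner_Integration.integrable_bound[OF iB]) (use bd in \<open>auto intro!: AE_I2 order_trans[OF bd]\<close>)
  have "(\<lambda>n. LINT y|lborel. ?f n y) \<longlonglongrightarrow> (LINT y|(lborel :: (real ^ 'n) measure). 0 :: real)"
  proof (rule integral_dominated_convergence[where w = "\<lambda>y. l powr p * indicator ?B y"])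
    show "AE y in lborel. (\<lambda>n. ?f n y) \<longlonglongrightarrow> 0"
      using lim
    proof eventually_elim
      case (elim y)
      have "(\<lambda>n. min \<bar>u n y\<bar> l powr p) \<longlonglongrightarrow> min \<bar>0\<bar> l powr p"
        using l by (intro tendsto_powr' tendsto_intros elim) auto
      then have "(\<lambda>n. min \<bar>u n y\<bar> l powr p) \<longlonglongrightarrow> 0" using l by simp
      then show ?case by (rule tendsto_mult_right_zero)
    qed
    show "AE y in lborel. norm (?f n y) \<le> l powr p * indicator ?B y" for n
      by (intro AE_I2 bd)
  qed (use iB in auto)
  then have "(\<lambda>n. LINT y|lborel. ?f n y) \<longlonglongrightarrow> 0" by simp
  moreover have "\<delta> / 2 \<le> (LINT y|lborel. ?f n y)" for n
  proof -
    have iq: "integrable lborel (\<lambda>y. \<delta> / 2 * \<bar>u n y\<bar> powr q)"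
      by (intro integrable_mult_right Lp_integrable Lq u)
    have "(LINT y|lborel. indicator ?B y * \<bar>u n y\<bar> powr p) \<le> (LINT y|lborel. ?f n y + \<delta> / 2 * \<bar>u n y\<bar> powr q)"
    proof (intro integral_mono Bochner_Integration.integrable_add fi iq)
      show "integrable lborel (\<lambda>y. indicator ?B y * \<bar>u n y\<bar> powr p)"
        by (intro integrable_mult_indicator[where 'b = real, unfolded real_scaleR_def] W_integrable_powr u) simp
      fix y
      have "\<bar>u n y\<bar> powr p \<le> min \<bar>u n y\<bar> l powr p + \<delta> / 2 * \<bar>u n y\<bar> powr q"
      proof (cases "\<bar>u n y\<bar> \<le> l")
        case True
        then show ?thesis using \<delta> by (simp add: min_absorb1)
      next
        case False
        have "\<bar>u n y\<bar> powr p = \<bar>u n y\<bar> powr (p - q) * \<bar>u n y\<bar> powr q" by (simp add: powr_add[symmetric])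
        also have "\<dots> \<le> l powr (p - q) * \<bar>u n y\<bar> powr q"
          using False l p_less_q by (intro mult_right_mono powr_mono2') auto
        finally have "\<bar>u n y\<bar> powr p \<le> \<delta> / 2 * \<bar>u n y\<bar> powr q" unfolding l(2) .
        then show ?thesis using powr_ge_zero[of "min \<bar>u n y\<bar> l" p] by linarith
      qed
      then show "indicator ?B y * \<bar>u n y\<bar> powr p \<le> ?f n y + \<delta> / 2 * \<bar>u n y\<bar> powr q"
        using \<delta> by (auto simp: indicator_def)
    qed
    also have "\<dots> = (LINT y|lborel. ?f n y) + \<delta> / 2 * R (u n)"
      using Bochner_Integration.integral_add[OF fi iq] by (simp add: R_def)
    finally show ?thesis using ge[of n] u(2)[of n] by simp
  qed
  ultimately have "\<delta> / 2 \<le> 0" using LIMSEQ_le_const by blast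
  then show False using \<delta> by simp
qed

lemma minimiser_exists:
  obtains u where "u \<in> W0" "R u = 1" "N u = sobolev_const"
proof -
  define S where "S = sobolev_const"
  have S: "S > 0" by (simp add: S_def sobolev_const_pos)
  obtain u where u: "\<And>n. u n \<in> W0" "\<And>n::nat. R (u n) = 1" "\<And>n. N (u n) \<le> S + 1"
    "(\<lambda>n. N (u n)) \<longlonglongrightarrow> S"
    using that minimising_sequence[folded S_def] by metis
  have uW: "u n \<in> W" for n using u W0_imp_W by blast
  have "S + 1 > 0" using S by simp
  obtain r \<delta> where r: "r > 0" "\<delta> > 0" "r \<le> 1"
    "\<And>u. u \<in> W \<Longrightarrow> N u \<le> S + 1 \<Longrightarrow> (LINT x|lborel. \<bar>u x\<bar> powr q) = 1 \<Longrightarrow>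
       \<exists>x. (LINT y|lborel. indicator (hball x r) y * \<bar>u y\<bar> powr p) > \<delta>"
    by (rule nonvanishing[OF Q_gt p_less_q q_less \<open>S + 1 > 0\<close>]) (rule that)
  have "\<forall>n. \<exists>x. (LINT y|lborel. indicator (hball x r) y * \<bar>u n y\<bar> powr p) > \<delta>"
    using r(4)[OF uW u(3)] u(2) by (simp add: R_def)
  then obtain x where x: "\<And>n. (LINT y|lborel. indicator (hball (x n) r) y * \<bar>u n y\<bar> powr p) > \<delta>" by metis
  define w where "w n = (\<lambda>y. u n (x n \<otimes> y))" for n
  have w: "w n \<in> W0" "R (w n) = 1" "N (w n) = N (u n)" for n
    unfolding w_def using u uW by (simp_all add: W0_translate R_translate W_translate)
  have wW: "w n \<in> W" for n using w W0_imp_W by blast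
  have wB: "N (w n) \<le> S + 1" for n using w u by simp
  have wge: "(LINT y|lborel. indicator (hball 0 r) y * \<bar>w n y\<bar> powr p) > \<delta>" for n
  proof -
    have "inv 0 = 0" using inv_one by (simp add: one_eq_0)
    then have "indicator (hball 0 r) y = (indicator (hball (x n) r) (x n \<otimes> y) :: real)" for y
      by (simp add: hball_def indicator_def)
    then have "(LINT y|lborel. indicator (hball 0 r) y * \<bar>w n y\<bar> powr p)
        = (LINT y|lborel. indicator (hball (x n) r) (x n \<otimes> y) * \<bar>u n (x n \<otimes> y)\<bar> powr p)"
      by (simp add: w_def)
    also have "\<dots> = (LINT y|lborel. indicator (hball (x n) r) y * \<bar>u n y\<bar> powr p)"
      using W_measurable[OF uW[of n]]
      by (intro translate_integrable(2)[of "\<lambda>y. indicator (hball (x n) r) y * \<bar>u n y\<bar> powr p"]) simp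
    finally show ?thesis using x[of n] by simp
  qed
  obtain \<rho> v where \<rho>: "strict_mono \<rho>" and v: "v \<in> borel_measurable borel"
    and lim: "AE y in lborel. (\<lambda>n. w (\<rho> n) y) \<longlonglongrightarrow> v y"
    by (rule AE_convergent_subsequence[OF wW wB]) (rule that)
  have v0: "v \<in> W0" by (rule W0_limit[OF w(1) wB v lim])
  have vW: "v \<in> W" by (rule W0_imp_W[OF v0])
  \<comment> \<open>The mass fixed at the origin survives the limit; this excludes
    \<open>t = 0\<close>, where the concavity argument would say nothing.\<close>
  have nt: "nontrivial v"
    unfolding nontrivial_def
  proof
    assume "AE y in lborel. v y = 0"
    with lim have "AE y in lborel. (\<lambda>n. w (\<rho> n) y) \<longlonglongrightarrow> 0" by eventually_elim simp
    then show False by (rule zero_limit_contradiction[OF wW w(2) r(1,2) wge])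
  qed
  define t where "t = R v"
  have t0: "t > 0" unfolding t_def by (rule R_pos[OF vW nt])
  let ?d = "\<lambda>n y. w (\<rho> n) y - v y"
  have dW0: "?d n \<in> W0" for n by (intro W0_diff w v0)
  have Nlim: "(\<lambda>n. N (?d n)) \<longlonglongrightarrow> S - N v"
  proof -
    have 1: "(\<lambda>n. N (w (\<rho> n)) - N (?d n)) \<longlonglongrightarrow> N v" by (rule N_brezis_lieb[OF wW wB v lim])
    have 2: "(\<lambda>n. N (w (\<rho> n))) \<longlonglongrightarrow> S"
      using LIMSEQ_subseq_LIMSEQ[OF u(4) \<rho>] by (simp add: w o_def)
    show ?thesis using tendsto_diff[OF 2 1] by simp
  qed
  have Rlim: "(\<lambda>n. R (?d n)) \<longlonglongrightarrow> 1 - t"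
  proof -
    have "(\<lambda>n. R (w (\<rho> n)) - R (?d n)) \<longlonglongrightarrow> R v"
      unfolding R_def
      by (rule brezis_lieb[OF q_gt_1, where B = 1]) (use Lq[OF wW] w(2) v lim in \<open>auto simp: R_def\<close>)
    then have "(\<lambda>n. 1 - R (?d n)) \<longlonglongrightarrow> t" by (simp add: w t_def)
    from tendsto_diff[OF tendsto_const[of 1] this] show ?thesis by simp
  qed
  have t1: "t \<le> 1"
  proof -
    have "0 \<le> 1 - t" by (rule LIMSEQ_le_const[OF Rlim]) (use R_nonneg in blast)
    then show ?thesis by simp
  qed
  define \<kappa> where "\<kappa> = p / q"
  have \<kappa>: "0 < \<kappa>" "\<kappa> < 1" using p_less_q by (auto simp: \<kappa>_def)
  have "(\<lambda>n. S * R (?d n) powr \<kappa>) \<longlonglongrightarrow> S * (1 - t) powr \<kappa>"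
    using \<kappa> R_nonneg by (intro tendsto_intros tendsto_powr' Rlim) auto
  then have "S * (1 - t) powr \<kappa> \<le> S - N v"
    by (rule LIMSEQ_le[OF _ Nlim]) (use sobolev_inequality[OF dW0] in \<open>auto simp: S_def \<kappa>_def\<close>)
  moreover have "S * t powr \<kappa> \<le> N v"
    using sobolev_inequality[OF v0] by (simp add: S_def \<kappa>_def t_def)
  ultimately have sum: "S * ((1 - t) powr \<kappa> + t powr \<kappa>) \<le> S * 1" by (simp add: distrib_left)
  have "t = 1"
  proof (rule ccontr)
    assume "t \<noteq> 1"
    then have t': "0 < t" "t < 1" using t0 t1 by auto
    have "t powr 1 < t powr \<kappa>" using t' \<kappa> by (intro powr_less_mono') auto
    moreover have "(1 - t) powr 1 < (1 - t) powr \<kappa>" using t' \<kappa> by (intro powr_less_mono') auto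
    ultimately have "1 < (1 - t) powr \<kappa> + t powr \<kappa>" using t' by simp
    with sum S show False by (simp add: mult_le_cancel_left)
  qed
  \<comment> \<open>With \<open>t = 1\<close> the limit is admissible, and the nonnegative numbers
    \<open>N (?d n)\<close> converge to \<open>S - N v\<close>.\<close>
  moreover have "N v \<le> S"
  proof -
    have "0 \<le> S - N v" by (rule LIMSEQ_le_const[OF Nlim]) (use N_nonneg in blast)
    then show ?thesis by simp
  qed
  ultimately show ?thesis
    using that[OF v0] sobolev_const_le[OF v0] by (simp add: t_def S_def)
qed

section \<open>The Euler-Lagrange equation\<close>

text \<open>The derivative of \<open>N\<close> at \<open>u\<close> in direction
  \<open>\<psi>\<close>, divided by \<open>p\<close>. Keeping \<open>dq\<close> lets
  \<open>Lp_derivative\<close> supply both summands; \<open>energy_deriv_eq\<close> converts back to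
  the kernel form.\<close>

definition form_p :: "(real ^ 'n \<Rightarrow> real) \<Rightarrow> (real ^ 'n \<Rightarrow> real) \<Rightarrow> real" where
  "form_p u \<psi> = (LINT x|lborel. \<bar>u x\<bar> powr (p - 2) * u x * \<psi> x)
     + (LINT z|L2. \<bar>dq u z\<bar> powr (p - 2) * dq u z * dq \<psi> z)"

definition form_q :: "(real ^ 'n \<Rightarrow> real) \<Rightarrow> (real ^ 'n \<Rightarrow> real) \<Rightarrow> real" where
  "form_q u \<psi> = (LINT x|lborel. \<bar>u x\<bar> powr (q - 2) * u x * \<psi> x)"

lemma N_derivative:
  assumes u: "u \<in> W" and \<psi>: "\<psi> \<in> W"
  shows "((\<lambda>t. N (\<lambda>x. u x + t * \<psi> x)) has_real_derivative p * form_p u \<psi>) (at 0)"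
proof -
  have eq: "N (\<lambda>x. u x + t * \<psi> x) = (LINT x|lborel. \<bar>u x + t * \<psi> x\<bar> powr p)
      + (LINT z|L2. \<bar>dq u z + t * dq \<psi> z\<bar> powr p)" for t
    by (simp only: N_dq dq_add dq_scale)
  show ?thesis
    unfolding eq form_p_def distrib_left
    using u \<psi> by (intro DERIV_add Lp_derivative p_gt_1) (auto simp: W_iff)
qed

lemma R_derivative:
  assumes u: "u \<in> W" and \<psi>: "\<psi> \<in> W"
  shows "((\<lambda>t. R (\<lambda>x. u x + t * \<psi> x)) has_real_derivative q * form_q u \<psi>) (at 0)"
  unfolding R_def form_q_def by (intro Lp_derivative q_gt_1 Lq u \<psi>)

text \<open>The function \<open>F\<close> is nonnegative on the whole line by the homogeneous
  Sobolev inequality and vanishes at 0, so its derivative there is 0. The infimum itself appears as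
  the multiplier.\<close>

lemma euler_lagrange:
  assumes u: "u \<in> W0" "R u = 1" "N u = sobolev_const" and \<psi>: "\<psi> \<in> W0"
  shows "form_p u \<psi> = sobolev_const * form_q u \<psi>"
proof -
  define F where "F t = N (\<lambda>x. u x + t * \<psi> x) - sobolev_const * R (\<lambda>x. u x + t * \<psi> x) powr (p / q)" for t
  have uW: "u \<in> W" "\<psi> \<in> W" using u \<psi> W0_imp_W by auto
  have "((\<lambda>t. R (\<lambda>x. u x + t * \<psi> x) powr (p / q)) has_real_derivative p * form_q u \<psi>) (at 0)"
    using DERIV_chain2[OF has_real_derivative_powr[of "R (\<lambda>x. u x + 0 * \<psi> x)" "p / q"] R_derivative[OF uW]] u(2)
    by simp
  then have dF: "(F has_real_derivative p * form_p u \<psi> - sobolev_const * (p * form_q u \<psi>)) (at 0)"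
    unfolding F_def by (intro DERIV_diff DERIV_cmult N_derivative uW)
  have F0: "F 0 \<le> F t" for t
  proof -
    have "F 0 = 0" using u by (simp add: F_def)
    moreover have "F t \<ge> 0"
      unfolding F_def using sobolev_inequality[OF W0_add[OF u(1) W0_scale[OF \<psi>, of t]]] by simp
    ultimately show ?thesis by simp
  qed
  have "p * form_p u \<psi> - sobolev_const * (p * form_q u \<psi>) = 0"
    by (rule DERIV_local_min[OF dF zero_less_one]) (use F0 in blast)
  then have "p * (form_p u \<psi> - sobolev_const * form_q u \<psi>) = 0" by (simp add: algebra_simps)
  then show ?thesis by simp
qed

lemma energy_deriv_eq:
  assumes u: "u \<in> W" and \<psi>: "\<psi> \<in> W"
  shows "energy_deriv G h Q s p q u \<psi> = form_p u \<psi> - form_q u \<psi>"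
proof -
  have "\<bar>dq u z\<bar> powr (p - 2) * dq u z * dq \<psi> z
      = (case z of (x, y) \<Rightarrow> \<bar>u x - u y\<bar> powr (p - 2) * (u x - u y) * (\<psi> x - \<psi> y) * K x y)" for z
  proof -
    obtain x y where z: "z = (x, y)" by (cases z)
    \<comment> \<open>The \<open>p - 2\<close> factors and the two single factors of
      \<open>dq\<close> carry roots of the kernel whose exponents add up to 1.\<close>
    have "K x y powr (1 / p * (p - 2)) * K x y powr (1 / p) * K x y powr (1 / p)
        = K x y powr (1 / p * (p - 2) + 1 / p + 1 / p)"
      by (simp only: powr_add)
    also have "1 / p * (p - 2) + 1 / p + 1 / p = 1" by (simp add: field_simps)
    finally have "K x y powr (1 / p * (p - 2)) * K x y powr (1 / p) * K x y powr (1 / p) = K x y" by simp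
    moreover have "\<bar>dq u z\<bar> powr (p - 2) = \<bar>u x - u y\<bar> powr (p - 2) * K x y powr (1 / p * (p - 2))"
      by (simp add: z dq_def abs_mult powr_mult powr_powr)
    ultimately show ?thesis by (simp add: z dq_def mult_ac)
  qed
  moreover have "integrable lborel (\<lambda>x. \<bar>u x\<bar> powr (p - 2) * u x * \<psi> x)"
    by (rule Lp_derivative(1)[OF p_gt_1]) (use u \<psi> in \<open>auto simp: W_iff\<close>)
  moreover have "integrable lborel (\<lambda>x. \<bar>u x\<bar> powr (q - 2) * u x * \<psi> x)"
    by (rule Lp_derivative(1)[OF q_gt_1 Lq Lq]) (use u \<psi> in auto)
  ultimately show ?thesis
    by (simp add: energy_deriv_def form_p_def form_q_def)
qed

lemma abs_powr_scale:
  fixes a b c r :: real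
  assumes "c > 0"
  shows "\<bar>c * a\<bar> powr (r - 2) * (c * a) * b = c powr (r - 1) * (\<bar>a\<bar> powr (r - 2) * a * b)"
proof -
  have "c powr (r - 1) = c powr (r - 2) * c" using mult_powr_pred[of c "r - 1"] assms by simp
  then show ?thesis using assms by (simp add: abs_mult powr_mult)
qed

lemma form_scale:
  assumes c: "c > 0"
  shows "form_p (\<lambda>x. c * u x) \<psi> = c powr (p - 1) * form_p u \<psi>"
    and "form_q (\<lambda>x. c * u x) \<psi> = c powr (q - 1) * form_q u \<psi>"
  unfolding form_p_def form_q_def dq_scale abs_powr_scale[OF c] by (simp_all add: distrib_left)

section \<open>Least energy solutions\<close>

lemma energy_eq: "energy G h Q s p q u = 1 / p * N u - 1 / q * R u"
  by (simp add: energy_def N_def R_def distrib_left)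

lemma nehari_iff: "v \<in> nehari G h Q s p q \<longleftrightarrow> v \<in> W0 \<and> nontrivial v \<and> N v = R v"
proof -
  have "energy_deriv G h Q s p q v v = N v - R v" if "v \<in> W0"
    using W_integrable_powr[OF W0_imp_W[OF that]] Lp_integrable[OF Lq[OF W0_imp_W[OF that]]]
    by (simp add: energy_deriv_self N_def R_def)
  then show ?thesis by (auto simp: nehari_def)
qed

text \<open>On the Nehari set \<open>N\<close> and \<open>R\<close> share a value
  \<open>m > 0\<close>, so the Sobolev inequality reads
  \<open>sobolev_const * m powr (p / q) \<le> m\<close> and can be solved for
  \<open>m\<close>.\<close>

lemma nehari_bound:
  assumes v: "v \<in> nehari G h Q s p q"
  shows "sobolev_const powr (q / (q - p)) \<le> N v"
proof -
  have v': "v \<in> W0" "nontrivial v" "N v = R v" using v by (auto simp: nehari_iff)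
  define m where "m = N v"
  have m: "m > 0" "R v = m" using R_pos[OF W0_imp_W] v' by (auto simp: m_def)
  have "sobolev_const * m powr (p / q) \<le> m"
    using sobolev_inequality[OF v'(1)] m by (simp add: m_def)
  also have "m = m powr (1 - p / q) * m powr (p / q)" using m by (simp add: powr_add[symmetric])
  finally have "sobolev_const \<le> m powr (1 - p / q)" using m by simp
  then have "sobolev_const powr (q / (q - p)) \<le> (m powr (1 - p / q)) powr (q / (q - p))"
    using sobolev_const_pos p_less_q by (intro powr_mono2) auto
  also have "\<dots> = m"
  proof -
    have "(1 - p / q) * (q / (q - p)) = 1" using p_less_q by (simp add: field_simps)
    then show ?thesis using m by (simp only: powr_powr) simp
  qed
  finally show ?thesis by (simp add: m_def)
qed

text \<open>A rescaled constrained minimiser attains the bound of \<open>nehari_bound\<close>.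
  Testing a nontrivial weak solution with itself places it in the Nehari set, so minimality there
  covers all competitors.\<close>

theorem least_energy_solution_exists:
  "\<exists>\<phi>. least_energy_solution G h Q s p q \<phi> \<and>
     ereal (energy G h Q s p q \<phi>) = (INF u \<in> nehari G h Q s p q. ereal (energy G h Q s p q u))"
proof -
  define S where "S = sobolev_const"
  have S: "S > 0" by (simp add: S_def sobolev_const_pos)
  obtain u where u: "u \<in> W0" "R u = 1" "N u = S" using minimiser_exists by (auto simp: S_def)
  \<comment> \<open>The two forms scale with \<open>c powr (p - 1)\<close> and
    \<open>c powr (q - 1)\<close>; cancelling the multiplier requires
    \<open>c powr (q - p) = S\<close>.\<close>
  define c where "c = S powr (1 / (q - p))"
  have c: "c > 0" "c powr (q - p) = S" using S p_less_q by (auto simp: c_def powr_powr)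
  define \<phi> where "\<phi> = (\<lambda>x. c * u x)"
  have \<phi>0: "\<phi> \<in> W0" unfolding \<phi>_def by (rule W0_scale[OF u(1)])
  have weak: "weak_solution G h Q s p q \<phi>"
    unfolding weak_solution_def
  proof (intro conjI ballI \<phi>0)
    fix \<psi> assume \<psi>: "\<psi> \<in> W0"
    have "energy_deriv G h Q s p q \<phi> \<psi> = form_p \<phi> \<psi> - form_q \<phi> \<psi>"
      by (intro energy_deriv_eq W0_imp_W \<phi>0 \<psi>)
    also have "\<dots> = c powr (p - 1) * form_p u \<psi> - c powr (q - 1) * form_q u \<psi>"
      unfolding \<phi>_def by (simp only: form_scale[OF c(1)])
    also have "form_p u \<psi> = S * form_q u \<psi>"
      unfolding S_def by (rule euler_lagrange[OF u(1,2) _ \<psi>]) (use u(3) in \<open>simp add: S_def\<close>)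
    also have "c powr (q - 1) = c powr (p - 1) * S"
      unfolding c(2)[symmetric] powr_add[symmetric] by simp
    finally show "energy_deriv G h Q s p q \<phi> \<psi> = 0" by simp
  qed
  have "R \<phi> = c powr q" using c u(2) by (simp add: \<phi>_def R_scale)
  then have "R \<phi> > 0" using c by simp
  have nt: "nontrivial \<phi>"
    unfolding nontrivial_def
  proof
    assume "AE x in lborel. \<phi> x = 0"
    then have "AE x in lborel. \<bar>\<phi> x\<bar> powr q = 0" by eventually_elim simp
    then have "R \<phi> = 0" unfolding R_def by (rule integral_eq_zero_AE)
    then show False using \<open>R \<phi> > 0\<close> by simp
  qed
  have weak_nehari: "v \<in> nehari G h Q s p q" if "weak_solution G h Q s p q v" "nontrivial v" for v
    using that by (auto simp: nehari_def weak_solution_def)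
  have \<phi>N: "\<phi> \<in> nehari G h Q s p q" by (rule weak_nehari[OF weak nt])
  have energy: "energy G h Q s p q v = (1 / p - 1 / q) * N v" if "v \<in> nehari G h Q s p q" for v
    using that by (simp add: nehari_iff energy_eq left_diff_distrib)
  \<comment> \<open>The lower bound from \<open>nehari_bound\<close> is met with equality, which
    makes \<open>\<phi>\<close> minimal.\<close>
  have N\<phi>: "N \<phi> = S powr (q / (q - p))"
  proof -
    have "N \<phi> = c powr p * S" using c u(3) by (simp add: \<phi>_def N_scale)
    also have "\<dots> = c powr p * c powr (q - p)" by (simp only: c(2))
    also have "\<dots> = c powr q" by (simp add: powr_add[symmetric])
    finally show ?thesis by (simp add: c_def powr_powr)
  qed
  have min: "energy G h Q s p q \<phi> \<le> energy G h Q s p q v" if v: "v \<in> nehari G h Q s p q" for v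
  proof -
    have "0 \<le> 1 / p - 1 / q" using p_less_q by (simp add: field_simps)
    then show ?thesis
      unfolding energy[OF v] energy[OF \<phi>N] N\<phi> S_def by (intro mult_left_mono nehari_bound v)
  qed
  have "ereal (energy G h Q s p q \<phi>) = (INF u \<in> nehari G h Q s p q. ereal (energy G h Q s p q u))"
    by (intro antisym INF_greatest INF_lower \<phi>N) (simp add: min)
  moreover have "least_energy_solution G h Q s p q \<phi>"
    unfolding least_energy_solution_def using weak nt min weak_nehari by blast
  ultimately show ?thesis by blast
qed

end

theorem theorem1p1:
  fixes G :: "(real ^ 'n) monoid" and k :: nat and \<sigma> :: "'n \<Rightarrow> nat"
    and h :: "real ^ 'n \<Rightarrow> real" and Q :: nat and s p q :: real
  assumes "stratified_group G k \<sigma>"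
    and "homogeneous_quasi_norm G \<sigma> h"
    and "Q = homogeneous_dimension k \<sigma>"
    and "0 < s" and "s < 1" and "1 < p"
    and "real Q > p * s"
    and "p < q" and "q < real Q * p / (real Q - p * s)"
  shows "\<exists>\<phi>. least_energy_solution G h Q s p q \<phi> \<and>
           ereal (energy G h Q s p q \<phi>) = (INF u \<in> nehari G h Q s p q. ereal (energy G h Q s p q u))"
proof -
  interpret stratified_group G k \<sigma> by fact
  interpret subcritical G k \<sigma> h Q s p q
    by unfold_locales (use assms in auto)
  show ?thesis by (rule least_energy_solution_exists)
qed

end
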